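(* Let $\{(X_i,\epsilon_i),\ i\ge 0\}$, $p$, $q$, $P$, $\pi$, $\mu$, $r$, $Y_i=r(X_i)+\epsilon_i$, the kernel $K$, the bandwidths $h_n>0$, the measurable function $\psi:\mathbb{R}\to\mathbb{R}$ and the notation $\mathbb{E}(\cdot\mid X=x)$ be as described in the context. Assume: (1) $P$ is $\phi$-irreducible and aperiodic, and there exist a function $V:\mathbb{R}\to[1,\infty)$, $\lambda\in(0,1)$, $b\in(0,\infty)$ and a small set $\mathcal{C}$ such that $PV(x)\le \lambda V(x)+b\mathbf{1}_{\mathcal{C}}(x)$ for all $x\in\mathbb{R}$; moreover $\mu(V):=\int_{\mathbb{R}}V(x)\mu(x)\,dx<\infty$; (2) $\displaystyle\sup_{x\in\mathbb{R}}V^{-1/2}(x)(1+|x|)\,\mathbb{E}\left[|\psi(Y)|\mid X=x\right]<\infty$ and $\displaystyle\sup_{x\in\mathbb{R}}V^{-1}(x)\,\mathbb{E}\left[\psi^2(Y)\mid X=x\right]<\infty$; (3) $\displaystyle\sup_{x\in\mathbb{R}}K(x)<\infty$, $\displaystyle\lim_{|x|\to\infty}|x|K(x)=0$, and $\displaystyle\sup_{x\ne x'}\frac{|K(x)-K(x')|}{|x-x'|}<\infty$; (4) $h_n\sim n^{-\beta}$ with $\beta\in(0,1/4)$. Let $x_0\in\mathbb{R}$ and assume that the function $x\mapsto \pi(x)\,\mathbb{E}\left(\psi(Y)\mid X=x\right)$ is continuous at $x_0$. Then, with $$\hat r_{n,\psi}(x_0)=\frac{1}{nh_n}\sum_{i=1}^n\psi(Y_i)K\left(\frac{x_0-X_i}{h_n}\right),$$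 one has $\lim_{n\to\infty}\hat r_{n,\psi}(x_0)=\pi(x_0)\,\mathbb{E}\left(\psi(Y)\mid X=x_0\right)$ with $\mathbb{P}$-probability one.
   Context: All densities are with respect to Lebesgue measure $dx$ on $\mathbb{R}$. $\{(X_i,\epsilon_i),\ i\geq 0\}$ is an $\mathbb{R}^2$-valued Markov chain on a probability space $(\Omega,\mathcal{F},\mathbb{P})$ such that, for measurable $A,B\subseteq\mathbb{R}$ and $n\ge1$, $$\mathbb{P}\left((X_n,\epsilon_n)\in A\times B\mid (X_k,\epsilon_k),\ k\leq n-1\right)=\int_A p(X_{n-1},z)\,q(z,B)\,dz,$$ where $p$ is a transition probability density (that of the marginal Markov chain $\{X_i\}$), and $q(x,B)=\int_B q(x,\epsilon)\,d\epsilon$ is the conditional law of $\epsilon_n$ given $X_n=x$, with transition probability density $q(x,\epsilon)$ (the letter $q$ denotes both the kernel and its density). $\mu$ is the initial distribution (density) of $X_0$. $p$ has an invariant probability density $\pi$, i.e. $\pi(x)=\int_{\mathbb{R}}\pi(y)p(y,x)\,dy$ for $x\in\mathbb{R}$, and $$\int_{\mathbb{R}}\pi(x)\left(\int_{\mathbb{R}}\epsilon\, q(x,\epsilon)\,d\epsilon\right)dx=0.$$ The function $r:\mathbb{R}\to\mathbb{R}$ is the (measurable) regression function and $Y_i=r(X_i)+\epsilon_i$, $i\ge0$. Notation: $\mathbb{E}(U(Y)\mid X=x):=\int_{\mathbb{R}}U(r(x)+\epsilon)\,q(x,\epsilon)\,d\epsilon$ whenever this integral is well defined. $P$ is the Markov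 kernel induced by $p$: $Pf(x)=\int_{\mathbb{R}}p(x,y)f(y)\,dy$. The kernel $K:\mathbb{R}\to[0,\infty)$ is a nonnegative function with $\int_{\mathbb{R}}K(x)\,dx=1$. The terms $\phi$-irreducible, aperiodic and small set have their usual meaning in the theory of general state space Markov chains (Meyn and Tweedie). *)

theory Defs
  imports "HOL-Probability.Probability" "HOL-Library.Landau_Symbols"
begin

section \<open>Markov kernels on a general state space\<close>

text \<open>The terminology is that of Meyn and Tweedie. A kernel on the measurable space \<open>S\<close> is a map
  \<open>P\<close> sending each state to a probability measure on \<open>S\<close>.\<close>

primrec kernel_pow :: "'a measure \<Rightarrow> ('a \<Rightarrow> 'a measure) \<Rightarrow> nat \<Rightarrow> 'a \<Rightarrow> 'a measure" where
  "kernel_pow S P 0 x = return S x"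
| "kernel_pow S P (Suc n) x = bind (P x) (kernel_pow S P n)"

text \<open>Measures \<open>\<phi>\<close> witnessing \<open>\<phi>\<close>-irreducibility are, as usual, sigma-finite and not the zero
  measure.\<close>

definition irreducibility_measure :: "'a measure \<Rightarrow> ('a \<Rightarrow> 'a measure) \<Rightarrow> 'a measure \<Rightarrow> bool" where
  "irreducibility_measure S P \<phi> \<longleftrightarrow>
     sets \<phi> = sets S \<and> sigma_finite_measure \<phi> \<and> emeasure \<phi> (space S) > 0 \<and>
     (\<forall>A\<in>sets S. emeasure \<phi> A > 0 \<longrightarrow>
        (\<forall>x\<in>space S. \<exists>n\<ge>1. emeasure (kernel_pow S P n x) A > 0))"

definition phi_irreducible :: "'a measure \<Rightarrow> ('a \<Rightarrow> 'a measure) \<Rightarrow> bool" where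
  "phi_irreducible S P \<longleftrightarrow> (\<exists>\<phi>. irreducibility_measure S P \<phi>)"

text \<open>Note the argument order: \<open>absolutely_continuous \<psi> \<phi>\<close> says that every \<open>\<psi>\<close>-null set is
  \<open>\<phi>\<close>-null.\<close>

definition maximal_irreducibility_measure ::
  "'a measure \<Rightarrow> ('a \<Rightarrow> 'a measure) \<Rightarrow> 'a measure \<Rightarrow> bool" where
  "maximal_irreducibility_measure S P \<psi> \<longleftrightarrow>
     irreducibility_measure S P \<psi> \<and>
     (\<forall>\<phi>. irreducibility_measure S P \<phi> \<longrightarrow> absolutely_continuous \<psi> \<phi>)"

definition d_cycle ::
  "'a measure \<Rightarrow> ('a \<Rightarrow> 'a measure) \<Rightarrow> nat \<Rightarrow> (nat \<Rightarrow> 'a set) \<Rightarrow> bool" where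
  "d_cycle S P d D \<longleftrightarrow>
     d \<ge> 1 \<and> (\<forall>i<d. D i \<in> sets S) \<and> disjoint_family_on D {..<d} \<and>
     (\<forall>i<d. \<forall>x\<in>D i. emeasure (P x) (D (Suc i mod d)) = 1) \<and>
     (\<exists>\<psi>. maximal_irreducibility_measure S P \<psi> \<and> space S - (\<Union>i<d. D i) \<in> null_sets \<psi>)"

text \<open>The period of an irreducible kernel is the largest \<open>d\<close> for which a \<open>d\<close>-cycle exists, and the
  kernel is aperiodic if the period is 1. The whole space is always a 1-cycle.\<close>

definition aperiodic :: "'a measure \<Rightarrow> ('a \<Rightarrow> 'a measure) \<Rightarrow> bool" where
  "aperiodic S P \<longleftrightarrow> (\<forall>d D. d_cycle S P d D \<longrightarrow> d \<le> 1)"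

definition small_set :: "'a measure \<Rightarrow> ('a \<Rightarrow> 'a measure) \<Rightarrow> 'a set \<Rightarrow> bool" where
  "small_set S P C \<longleftrightarrow>
     C \<in> sets S \<and>
     (\<exists>m\<ge>1. \<exists>\<nu>. sets \<nu> = sets S \<and> emeasure \<nu> (space S) > 0 \<and>
        (\<forall>x\<in>C. \<forall>B\<in>sets S. emeasure \<nu> B \<le> emeasure (kernel_pow S P m x) B))"

section \<open>Densities on the real line\<close>

definition prob_density :: "(real \<Rightarrow> real) \<Rightarrow> bool" where
  "prob_density f \<longleftrightarrow>
     f \<in> borel_measurable borel \<and> (\<forall>x. 0 \<le> f x) \<and> (\<integral>\<^sup>+x. ennreal (f x) \<partial>lborel) = 1"

definition transition_density :: "(real \<Rightarrow> real \<Rightarrow> real) \<Rightarrow> bool" where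
  "transition_density p \<longleftrightarrow>
     (\<lambda>(x, y). p x y) \<in> borel_measurable (borel \<Otimes>\<^sub>M borel) \<and> (\<forall>x. prob_density (p x))"

definition density_kernel :: "(real \<Rightarrow> real \<Rightarrow> real) \<Rightarrow> real \<Rightarrow> real measure" where
  "density_kernel p x = density lborel (\<lambda>y. ennreal (p x y))"

definition invariant_density :: "(real \<Rightarrow> real \<Rightarrow> real) \<Rightarrow> (real \<Rightarrow> real) \<Rightarrow> bool" where
  "invariant_density p f \<longleftrightarrow>
     prob_density f \<and> (\<forall>x. ennreal (f x) = (\<integral>\<^sup>+y. ennreal (f y * p y x) \<partial>lborel))"

text \<open>The condition that the stationary mean of the noise exists and vanishes.\<close>

definition centred_noise :: "(real \<Rightarrow> real) \<Rightarrow> (real \<Rightarrow> real \<Rightarrow> real) \<Rightarrow> bool" where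
  "centred_noise f q \<longleftrightarrow>
     (AE x in density lborel (\<lambda>x. ennreal (f x)). integrable lborel (\<lambda>e. e * q x e)) \<and>
     has_bochner_integral lborel (\<lambda>x. f x * (LINT e|lborel. e * q x e)) 0"

section \<open>The regression model\<close>

definition past_algebra :: "'w measure \<Rightarrow> (nat \<Rightarrow> 'w \<Rightarrow> 'b::topological_space) \<Rightarrow> nat \<Rightarrow> 'w measure" where
  "past_algebra M Z n = sigma (space M) (\<Union>k<n. {Z k -` A \<inter> space M | A. A \<in> sets borel})"

definition regression_chain ::
  "'w measure \<Rightarrow> (nat \<Rightarrow> 'w \<Rightarrow> real) \<Rightarrow> (nat \<Rightarrow> 'w \<Rightarrow> real) \<Rightarrow>
   (real \<Rightarrow> real \<Rightarrow> real) \<Rightarrow> (real \<Rightarrow> real \<Rightarrow> real) \<Rightarrow> (real \<Rightarrow> real) \<Rightarrow> bool" where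
  "regression_chain M X \<epsilon> p q \<mu> \<longleftrightarrow>
     (\<forall>i. X i \<in> borel_measurable M) \<and> (\<forall>i. \<epsilon> i \<in> borel_measurable M) \<and>
     transition_density p \<and> transition_density q \<and>
     prob_density \<mu> \<and> distributed M lborel (X 0) (\<lambda>x. ennreal (\<mu> x)) \<and>
     (\<forall>n\<ge>1. \<forall>A\<in>sets borel. \<forall>B\<in>sets borel. AE \<omega> in M.
        real_cond_exp M (past_algebra M (\<lambda>k \<omega>. (X k \<omega>, \<epsilon> k \<omega>)) n)
          (indicator {\<omega> \<in> space M. X n \<omega> \<in> A \<and> \<epsilon> n \<omega> \<in> B}) \<omega>
        = (LINT z:A|lborel. p (X (n - 1) \<omega>) z * (LINT e:B|lborel. q z e)))"

text \<open>The conditional mean of \<open>U(Y)\<close> given \<open>X = x\<close>. The second version takes values in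
  \<open>[0, \<infinity>]\<close> and is meant for nonnegative \<open>U\<close>, for which no integrability is required.\<close>

definition cond_mean :: "(real \<Rightarrow> real) \<Rightarrow> (real \<Rightarrow> real \<Rightarrow> real) \<Rightarrow> (real \<Rightarrow> real) \<Rightarrow> real \<Rightarrow> real" where
  "cond_mean r q U x = (LINT e|lborel. U (r x + e) * q x e)"

definition nn_cond_mean :: "(real \<Rightarrow> real) \<Rightarrow> (real \<Rightarrow> real \<Rightarrow> real) \<Rightarrow> (real \<Rightarrow> real) \<Rightarrow> real \<Rightarrow> ennreal" where
  "nn_cond_mean r q U x = (\<integral>\<^sup>+e. ennreal (U (r x + e) * q x e) \<partial>lborel)"

definition kernel_estimator ::
  "(real \<Rightarrow> real) \<Rightarrow> (nat \<Rightarrow> real) \<Rightarrow> (real \<Rightarrow> real) \<Rightarrow> (nat \<Rightarrow> 'w \<Rightarrow> real) \<Rightarrow> (nat \<Rightarrow> 'w \<Rightarrow> real) \<Rightarrow>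
   real \<Rightarrow> nat \<Rightarrow> 'w \<Rightarrow> real" where
  "kernel_estimator K h \<psi> X Y x n \<omega> =
     1 / (real n * h n) * (\<Sum>i=1..n. \<psi> (Y i \<omega>) * K ((x - X i \<omega>) / h n))"

end

theory Submission
  imports Defs "HOL-Real_Asymp.Real_Asymp"
begin

text \<open>Put \<open>W = sqrt V\<close>. The drift condition yields \<open>P W \<le> lam' W + b' 1\<^sub>C\<close>, and the resolvent
  \<open>R = (1 - e) \<Sum>\<^sub>k e\<^sup>k P\<^sup>k\<close> turns the minorization of \<open>P\<^sup>m\<close> on \<open>C\<close> into a one-step minorization
  \<open>R \<ge> s \<otimes> \<nu>\<close>, with a drift condition towards \<open>s\<close>. Hence \<open>R - s \<otimes> \<nu>\<close> is a contraction in a weighted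
  supremum norm, and its Neumann series solves the Poisson equation for \<open>P\<close>. So \<open>\<Sum>\<^sub>k\<^sub><\<^sub>n P\<^sup>k f\<close> is bounded by
  a multiple of \<open>W\<close>, uniformly in \<open>n\<close>, whenever \<open>\<pi>(f) = 0\<close>, and sums of \<open>n\<close> centred terms
  \<open>\<psi>(Y\<^sub>i) 1\<^sub>B(X\<^sub>i)\<close> have variance \<open>O(n)\<close>, uniformly in the Borel set \<open>B\<close>.

  To control all bandwidths at once, write the Lipschitz function \<open>K((x\<^sub>0 - x) / h)\<close> approximately as a
  step function and sum by parts: the centred sum is then at most \<open>L / h\<close> times an average of the centred
  sums over intervals \<open>(t, R]\<close>, and these no longer involve \<open>h\<close>. A dyadic maximal inequality over \<open>n < 2\<^sup>k\<close>
  costs only powers of \<open>k\<close>, so the mean square of the normalised fluctuation is \<open>n\<^sup>-\<^sup>1 h\<^sup>-\<^sup>4\<close> up to logarithms, which is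
  summable along \<open>n = 2\<^sup>k\<close> because \<open>\<beta> < 1/4\<close>. The remaining bias is handled by the classical
  approximate identity argument. Positive and negative parts of \<open>\<psi>\<close> are treated separately, but only in the
  fluctuations, since continuity is available only for \<open>\<psi>\<close> itself.\<close>

section \<open>Positive operators on weighted function spaces\<close>

text \<open>The weight is \<open>sqrt V\<close> because a covariance pairs \<open>g (Z i)\<close>,
  square integrable through \<open>V\<close>, with a potential at \<open>X i\<close>; the product is
  integrable once the potential is of order \<open>W\<close>, as \<open>W\<^sup>2 = V\<close>. The
  chain need not start in equilibrium: expectations are under its actual law, where the drift bounds
  those of \<open>V\<close> uniformly in time. The exponent of h has a simple origin. The indicator
  of any interval is charged a full variance of order n, however narrow the window of the kernel.
  Dividing by n h leaves n / (n h)^2, and the Lipschitz constant L / h of the rescaled kernel enters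
  squared. In return the random quantities are free of h, so one random variable per dyadic block
  serves every n in it, and only the order of magnitude of the bandwidths enters. Nonnegative
  summands matter when the kernel is replaced by a step function: the error is then at most the
  uniform error times the sum of the summands, and the size of this sum is again governed by a
  centred sum.\<close>

definition wspace :: "('a::topological_space \<Rightarrow> real) \<Rightarrow> ('a \<Rightarrow> real) set" where
  "wspace W = {f \<in> borel_measurable borel. \<exists>c. \<forall>x. \<bar>f x\<bar> \<le> c * W x}"

lemma wspaceI: "f \<in> borel_measurable borel \<Longrightarrow> (\<And>x. \<bar>f x\<bar> \<le> c * W x) \<Longrightarrow> f \<in> wspace W"
  unfolding wspace_def by blast

lemma wspace_measurable: "f \<in> wspace W \<Longrightarrow> f \<in> borel_measurable borel"
  unfolding wspace_def by blast

locale weight =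
  fixes W :: "'a::topological_space \<Rightarrow> real"
  assumes W_meas: "W \<in> borel_measurable borel" and W_ge1: "\<And>x. 1 \<le> W x"
begin

lemma W_pos: "0 < W x"
  using W_ge1[of x] by linarith

lemma weight_bound_nonneg: "\<bar>y\<bar> \<le> c * W x \<Longrightarrow> 0 \<le> c"
  using W_pos[of x] by (meson abs_ge_zero order_trans zero_le_mult_iff not_less)

lemma wspace_bound:
  assumes "f \<in> wspace W"
  obtains c where "0 \<le> c" "\<And>x. \<bar>f x\<bar> \<le> c * W x"
proof -
  obtain c where c: "\<And>x. \<bar>f x\<bar> \<le> c * W x"
    using assms unfolding wspace_def by blast
  then show thesis using that weight_bound_nonneg[OF c[of undefined]] by blast
qed

lemma wspace_self: "W \<in> wspace W"
  using W_meas W_ge1 by (intro wspaceI[of _ 1]) (auto intro: order_trans[of 0 1] simp: abs_of_nonneg)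

lemma wspace_const: "(\<lambda>x. a) \<in> wspace W"
proof (rule wspaceI[of _ "\<bar>a\<bar>"])
  show "\<bar>a\<bar> \<le> \<bar>a\<bar> * W x" for x
    using mult_left_mono[OF W_ge1[of x] abs_ge_zero[of a]] by simp
qed simp

lemma wspace_mono:
  assumes "f \<in> borel_measurable borel" "g \<in> wspace W" "\<And>x. \<bar>f x\<bar> \<le> \<bar>g x\<bar>"
  shows "f \<in> wspace W"
proof -
  obtain c where c: "\<And>x. \<bar>g x\<bar> \<le> c * W x" using wspace_bound[OF assms(2)] by blast
  show ?thesis by (rule wspaceI[OF assms(1), of c]) (use c assms(3) order_trans in blast)
qed

lemma wspace_add:
  assumes "f \<in> wspace W" "g \<in> wspace W"
  shows "(\<lambda>x. f x + g x) \<in> wspace W"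
proof -
  obtain c d where "\<And>x. \<bar>f x\<bar> \<le> c * W x" "\<And>x. \<bar>g x\<bar> \<le> d * W x"
    using wspace_bound[OF assms(1)] wspace_bound[OF assms(2)] by metis
  then have "\<bar>f x + g x\<bar> \<le> (c + d) * W x" for x
    by (smt (verit) distrib_right)
  then show ?thesis using assms by (intro wspaceI) (auto dest!: wspace_measurable)
qed

lemma wspace_scale:
  assumes "f \<in> wspace W"
  shows "(\<lambda>x. a * f x) \<in> wspace W"
proof -
  obtain c where c: "\<And>x. \<bar>f x\<bar> \<le> c * W x" using wspace_bound[OF assms] by blast
  have "\<bar>a * f x\<bar> \<le> (\<bar>a\<bar> * c) * W x" for x
    using mult_left_mono[OF c abs_ge_zero[of a]] by (simp add: abs_mult mult.assoc)
  then show ?thesis using assms by (intro wspaceI) (auto dest!: wspace_measurable)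
qed

lemma wspace_diff:
  assumes "f \<in> wspace W" "g \<in> wspace W"
  shows "(\<lambda>x. f x - g x) \<in> wspace W"
  using wspace_add[OF assms(1) wspace_scale[OF assms(2), of "-1"]] by simp

lemma wspace_sum:
  assumes "\<And>i. i \<in> I \<Longrightarrow> f i \<in> wspace W"
  shows "(\<lambda>x. \<Sum>i\<in>I. f i x) \<in> wspace W"
  using assms by (induction I rule: infinite_finite_induct) (auto intro: wspace_const wspace_add)

lemma wspace_indicator: "C \<in> sets borel \<Longrightarrow> indicat_real C \<in> wspace W"
  by (rule wspace_mono[OF _ wspace_const[of 1]]) (auto simp: indicator_def)

text \<open>Since \<open>W\<close> is at least 1, adding a constant only changes the norm to an
  equivalent one. The contraction in \<open>poisson_bound\<close> is obtained for a shifted weight,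
  while its input and output are in terms of \<open>W\<close>.\<close>

lemma wspace_shift:
  assumes "0 \<le> a"
  shows "wspace (\<lambda>x. W x + a) = wspace W"
proof
  show "wspace W \<subseteq> wspace (\<lambda>x. W x + a)"
  proof
    fix f assume f: "f \<in> wspace W"
    obtain c where c: "0 \<le> c" "\<And>x. \<bar>f x\<bar> \<le> c * W x" using wspace_bound[OF f] by blast
    have "\<bar>f x\<bar> \<le> c * (W x + a)" for x
      using c(2)[of x] mult_nonneg_nonneg[OF c(1) assms] by (simp add: distrib_left)
    then show "f \<in> wspace (\<lambda>x. W x + a)" using f by (intro wspaceI) (auto dest!: wspace_measurable)
  qed
  show "wspace (\<lambda>x. W x + a) \<subseteq> wspace W"
  proof
    fix f assume f: "f \<in> wspace (\<lambda>x. W x + a)"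
    obtain c where c: "\<And>x. \<bar>f x\<bar> \<le> c * (W x + a)" using f unfolding wspace_def by blast
    show "f \<in> wspace W"
    proof (rule wspaceI[of _ "\<bar>c\<bar> * (1 + a)"])
      show "f \<in> borel_measurable borel" using f by (rule wspace_measurable)
      show "\<bar>f x\<bar> \<le> \<bar>c\<bar> * (1 + a) * W x" for x
      proof -
        have "\<bar>f x\<bar> \<le> \<bar>c\<bar> * (W x + a)"
          using c[of x] assms W_pos[of x]
          by (smt (verit) mult_right_mono)
        also have "\<dots> \<le> \<bar>c\<bar> * ((1 + a) * W x)"
          using mult_left_mono[OF W_ge1[of x] assms] by (intro mult_left_mono) (auto simp: algebra_simps)
        finally show ?thesis by (simp add: mult.assoc)
      qed
    qed
  qed
qed

end

section \<open>Positive functionals and operators\<close>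

locale positive_functional = weight W for W :: "'a::topological_space \<Rightarrow> real" +
  fixes \<phi> :: "('a \<Rightarrow> real) \<Rightarrow> real"
  assumes fun_add: "\<And>f g. f \<in> wspace W \<Longrightarrow> g \<in> wspace W \<Longrightarrow> \<phi> (\<lambda>x. f x + g x) = \<phi> f + \<phi> g"
    and fun_scale: "\<And>f a. f \<in> wspace W \<Longrightarrow> \<phi> (\<lambda>x. a * f x) = a * \<phi> f"
    and fun_nonneg: "\<And>f. f \<in> wspace W \<Longrightarrow> (\<And>x. 0 \<le> f x) \<Longrightarrow> 0 \<le> \<phi> f"
begin

lemma fun_diff:
  assumes "f \<in> wspace W" "g \<in> wspace W"
  shows "\<phi> (\<lambda>x. f x - g x) = \<phi> f - \<phi> g"
  using fun_add[OF assms(1) wspace_scale[OF assms(2), of "-1"]] fun_scale[OF assms(2), of "-1"] by simp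

lemma fun_mono:
  assumes "f \<in> wspace W" "g \<in> wspace W" "\<And>x. f x \<le> g x"
  shows "\<phi> f \<le> \<phi> g"
  using fun_nonneg[OF wspace_diff[OF assms(2,1)]] assms(3) fun_diff[OF assms(2,1)] by simp

end

text \<open>Neither continuity nor a norm bound is postulated. Positivity bounds
  \<open>\<bar>T f\<bar>\<close> by \<open>T g\<close> whenever
  \<open>\<bar>f\<bar> \<le> g\<close>, so the single function \<open>T W\<close> controls the whole
  operator.\<close>

locale positive_operator = weight W for W :: "'a::topological_space \<Rightarrow> real" +
  fixes T :: "('a \<Rightarrow> real) \<Rightarrow> 'a \<Rightarrow> real"
  assumes op_closed: "\<And>f. f \<in> wspace W \<Longrightarrow> T f \<in> wspace W"
    and op_add: "\<And>f g. f \<in> wspace W \<Longrightarrow> g \<in> wspace W \<Longrightarrow> T (\<lambda>x. f x + g x) = (\<lambda>x. T f x + T g x)"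
    and op_scale: "\<And>f a. f \<in> wspace W \<Longrightarrow> T (\<lambda>x. a * f x) = (\<lambda>x. a * T f x)"
    and op_nonneg: "\<And>f x. f \<in> wspace W \<Longrightarrow> (\<And>x. 0 \<le> f x) \<Longrightarrow> 0 \<le> T f x"
begin

lemma op_diff:
  assumes "f \<in> wspace W" "g \<in> wspace W"
  shows "T (\<lambda>x. f x - g x) = (\<lambda>x. T f x - T g x)"
  using op_add[OF assms(1) wspace_scale[OF assms(2), of "-1"]] op_scale[OF assms(2), of "-1"] by simp

lemma op_sum:
  assumes "\<And>i. i \<in> I \<Longrightarrow> f i \<in> wspace W"
  shows "T (\<lambda>x. \<Sum>i\<in>I. f i x) = (\<lambda>x. \<Sum>i\<in>I. T (f i) x)"
proof -
  have zero: "T (\<lambda>x. 0) = (\<lambda>x. 0)"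
    using op_scale[OF wspace_const[of 0], of 0] by simp
  show ?thesis
    using assms
    by (induction I rule: infinite_finite_induct) (auto simp: zero op_add wspace_sum)
qed

lemma op_mono:
  assumes "f \<in> wspace W" "g \<in> wspace W" "\<And>x. f x \<le> g x"
  shows "T f x \<le> T g x"
  using op_nonneg[OF wspace_diff[OF assms(2,1)], of x] assms(3) op_diff[OF assms(2,1)] by simp

lemma op_abs:
  assumes "f \<in> wspace W" "g \<in> wspace W" "\<And>x. \<bar>f x\<bar> \<le> g x"
  shows "\<bar>T f x\<bar> \<le> T g x"
proof -
  have "T f x \<le> T g x" using assms by (intro op_mono) (auto simp: abs_le_iff)
  moreover have "T (\<lambda>x. (-1) * f x) x \<le> T g x"
    using assms by (intro op_mono wspace_scale) (auto simp: abs_le_iff)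
  ultimately show ?thesis using op_scale[OF assms(1), of "-1"] by simp
qed

lemma funpow_closed: "f \<in> wspace W \<Longrightarrow> (T ^^ k) f \<in> wspace W"
  by (induction k) (auto intro: op_closed)

lemma positive_operator_funpow: "positive_operator W (T ^^ k)"
proof (induction k)
  case 0
  show ?case by unfold_locales auto
next
  case (Suc k)
  interpret k: positive_operator W "T ^^ k" by fact
  show ?case
    by unfold_locales (auto simp: op_add[OF k.op_closed k.op_closed] k.op_add op_scale[OF k.op_closed] k.op_scale intro!: op_closed op_nonneg k.op_closed k.op_nonneg)
qed

lemma positive_operator_scale:
  assumes "0 \<le> e"
  shows "positive_operator W (\<lambda>f x. e * T f x)"
  using assms by unfold_locales
    (auto simp: op_add op_scale algebra_simps intro!: wspace_scale op_closed mult_nonneg_nonneg op_nonneg)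

end

section \<open>Neumann series of a contractive positive operator\<close>

locale contractive_operator = positive_operator +
  fixes \<kappa> :: real
  assumes kappa: "0 \<le> \<kappa>" "\<kappa> < 1" and op_W: "\<And>x. T W x \<le> \<kappa> * W x"
begin

definition neumann :: "('a \<Rightarrow> real) \<Rightarrow> 'a \<Rightarrow> real" where
  "neumann f x = (\<Sum>k. (T ^^ k) f x)"

lemma funpow_bound:
  assumes "f \<in> wspace W" "\<And>x. \<bar>f x\<bar> \<le> c * W x"
  shows "\<bar>(T ^^ k) f x\<bar> \<le> c * \<kappa> ^ k * W x"
proof (induction k arbitrary: x)
  case 0
  then show ?case using assms by simp
next
  case (Suc k)
  have "0 \<le> c" by (rule weight_bound_nonneg[OF assms(2)])
  have "\<bar>T ((T ^^ k) f) x\<bar> \<le> T (\<lambda>x. c * \<kappa> ^ k * W x) x"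
    using Suc by (intro op_abs funpow_closed assms wspace_scale wspace_self)
  also have "\<dots> = c * \<kappa> ^ k * T W x" by (simp add: op_scale[OF wspace_self])
  also have "\<dots> \<le> c * \<kappa> ^ k * (\<kappa> * W x)"
    using \<open>0 \<le> c\<close> kappa by (intro mult_left_mono op_W) auto
  finally show ?case by (simp add: mult_ac)
qed

lemma neumann_summable: "f \<in> wspace W \<Longrightarrow> summable (\<lambda>k. (T ^^ k) f x)"
proof -
  assume f: "f \<in> wspace W"
  obtain c where c: "\<And>x. \<bar>f x\<bar> \<le> c * W x" using wspace_bound[OF f] by blast
  show ?thesis
  proof (rule summable_comparison_test')
    show "summable (\<lambda>k. c * \<kappa> ^ k * W x)"
      using kappa by (intro summable_mult summable_mult2 summable_geometric) auto
    show "norm ((T ^^ k) f x) \<le> c * \<kappa> ^ k * W x" for k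
      using funpow_bound[OF f c] by simp
  qed
qed

lemma neumann_bound:
  assumes "f \<in> wspace W" "\<And>x. \<bar>f x\<bar> \<le> c * W x"
  shows "\<bar>neumann f x\<bar> \<le> c / (1 - \<kappa>) * W x"
proof -
  have s: "(\<lambda>k. c * \<kappa> ^ k * W x) sums (c * (1 / (1 - \<kappa>)) * W x)"
    using kappa by (intro sums_mult sums_mult2 geometric_sums) auto
  have "norm (neumann f x) \<le> (\<Sum>k. c * \<kappa> ^ k * W x)"
    unfolding neumann_def
    by (intro norm_suminf_le) (use funpow_bound[OF assms] s in \<open>auto simp: sums_iff\<close>)
  then show ?thesis using s by (simp add: sums_iff)
qed

lemma positive_operator_neumann: "positive_operator W neumann"
proof
  fix f g x and a :: real assume f: "f \<in> wspace W"
  note [measurable] = wspace_measurable[OF funpow_closed[OF f]]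
  obtain c where c: "\<And>x. \<bar>f x\<bar> \<le> c * W x" using wspace_bound[OF f] by blast
  show "neumann f \<in> wspace W"
  proof (rule wspaceI)
    show "neumann f \<in> borel_measurable borel"
      unfolding neumann_def by measurable
    show "\<bar>neumann f x\<bar> \<le> c / (1 - \<kappa>) * W x" for x by (rule neumann_bound[OF f c])
  qed
  { assume g: "g \<in> wspace W"
    show "neumann (\<lambda>x. f x + g x) = (\<lambda>x. neumann f x + neumann g x)"
      unfolding neumann_def
      using positive_operator.op_add[OF positive_operator_funpow f g]
      by (simp add: suminf_add[OF neumann_summable[OF f] neumann_summable[OF g]]) }
  show "neumann (\<lambda>x. a * f x) = (\<lambda>x. a * neumann f x)"
    unfolding neumann_def
    using positive_operator.op_scale[OF positive_operator_funpow f]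
    by (simp add: suminf_mult[OF neumann_summable[OF f]])
  { assume "\<And>x. 0 \<le> f x"
    then show "0 \<le> neumann f x"
      unfolding neumann_def
      by (intro suminf_nonneg neumann_summable f positive_operator.op_nonneg[OF positive_operator_funpow]) }
qed

lemma neumann_split:
  assumes "f \<in> wspace W"
  shows "neumann f x = (\<Sum>k<n. (T ^^ k) f x) + neumann ((T ^^ n) f) x"
  unfolding neumann_def
  using suminf_split_initial_segment[OF neumann_summable[OF assms], of x n]
  by (simp add: funpow_add)

lemma neumann_unfold_right:
  assumes "f \<in> wspace W"
  shows "neumann f x = f x + neumann (T f) x"
  using neumann_split[OF assms, of x 1] by simp

text \<open>\<open>T\<close> has to be exchanged with an infinite sum although it is not assumed
  continuous under pointwise limits. The remainder of the series is \<open>neumann\<close> of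
  \<open>(T ^^ n) f\<close>, which is at most a multiple of \<open>\<kappa> ^ n * W\<close>, and
  positivity keeps that rate after applying \<open>T\<close>.\<close>

lemma neumann_unfold_left:
  assumes "f \<in> wspace W"
  shows "neumann f x = f x + T (neumann f) x"
proof -
  interpret N: positive_operator W neumann by (rule positive_operator_neumann)
  obtain c where c: "\<And>x. \<bar>f x\<bar> \<le> c * W x" using wspace_bound[OF assms] by blast
  have eq: "T (neumann f) x - (\<Sum>k<n. (T ^^ k) (T f) x) = T (neumann ((T ^^ n) f)) x" for n
  proof -
    have "neumann f = (\<lambda>x. (\<Sum>k<n. (T ^^ k) f x) + neumann ((T ^^ n) f) x)"
      using neumann_split[OF assms] by blast
    then have "T (neumann f) x = (\<Sum>k<n. T ((T ^^ k) f) x) + T (neumann ((T ^^ n) f)) x"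
      using op_add[OF wspace_sum N.op_closed[OF funpow_closed[OF assms, of n]], of "{..<n}" "\<lambda>k. (T ^^ k) f"]
        op_sum[of "{..<n}" "\<lambda>k. (T ^^ k) f"] funpow_closed[OF assms] by simp
    then show ?thesis by (simp add: funpow_swap1)
  qed
  have "\<bar>T (neumann ((T ^^ n) f)) x\<bar> \<le> (c / (1 - \<kappa>) * T W x) * \<kappa> ^ n" for n
  proof -
    have "\<bar>T (neumann ((T ^^ n) f)) x\<bar> \<le> T (\<lambda>x. c * \<kappa> ^ n / (1 - \<kappa>) * W x) x"
      using neumann_bound[OF funpow_closed[OF assms] funpow_bound[OF assms c]]
      by (intro op_abs N.op_closed funpow_closed assms wspace_scale wspace_self)
    also have "\<dots> = c * \<kappa> ^ n / (1 - \<kappa>) * T W x"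
      by (simp only: op_scale[OF wspace_self])
    finally show ?thesis by (simp add: mult_ac)
  qed
  then have "(\<lambda>n. T (neumann ((T ^^ n) f)) x) \<longlonglongrightarrow> 0"
    using kappa by (intro Lim_null_comparison[OF always_eventually tendsto_mult_right_zero[OF LIMSEQ_realpow_zero]])
      (auto simp only: real_norm_def)
  then have "(\<lambda>n. \<Sum>k<n. (T ^^ k) (T f) x) \<longlonglongrightarrow> T (neumann f) x"
    unfolding eq[symmetric]
    using tendsto_diff[OF tendsto_const, of "\<lambda>n. T (neumann f) x - (\<Sum>k<n. (T ^^ k) (T f) x)" 0 sequentially "T (neumann f) x"]
    by simp
  then have "neumann (T f) x = T (neumann f) x"
    using summable_LIMSEQ[OF neumann_summable[OF op_closed[OF assms]]] LIMSEQ_unique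
    unfolding neumann_def by blast
  then show ?thesis using neumann_unfold_right[OF assms] by simp
qed

end

section \<open>The Poisson equation under a drift condition\<close>

text \<open>\<open>\<nu>\<close> stands for the minorizing measure of the small set,
  \<open>\<theta>\<close> for the stationary law and \<open>m\<close> for the number of steps of the
  minorization; only their action on \<open>wspace W\<close> is kept.\<close>

locale drift_operator = positive_operator W P + nu: positive_functional W \<nu> + pi: positive_functional W \<theta>
  for W :: "'a::topological_space \<Rightarrow> real" and P \<nu> \<theta> +
  fixes C :: "'a set" and m :: nat and lam b :: real
  assumes P_one: "P (\<lambda>x. 1) = (\<lambda>x. 1)"
    and C_sets: "C \<in> sets borel"
    and lam: "0 \<le> lam" "lam < 1" and b: "0 \<le> b"
    and drift: "\<And>x. P W x \<le> lam * W x + b * indicator C x"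
    and minor: "\<And>f x. f \<in> wspace W \<Longrightarrow> (\<And>x. 0 \<le> f x) \<Longrightarrow> x \<in> C \<Longrightarrow> \<nu> f \<le> (P ^^ m) f x"
    and nu_one: "0 < \<nu> (\<lambda>x. 1)"
    and pi_one: "0 < \<theta> (\<lambda>x. 1)"
    and pi_inv: "\<And>f. f \<in> wspace W \<Longrightarrow> \<theta> (P f) = \<theta> f"
begin

text \<open>The constant \<open>b / (1 - lam)\<close> is the fixed point of
  \<open>y = lam * y + b\<close>, so the additive bound \<open>W + b / (1 - lam)\<close> survives
  one more step; \<open>1 \<le> W\<close> absorbs it into a multiple of \<open>W\<close>.\<close>

lemma funpow_W: "(P ^^ n) W x \<le> (1 + b / (1 - lam)) * W x"
proof -
  have *: "(P ^^ n) W x \<le> W x + b / (1 - lam)" for n x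
  proof (induction n arbitrary: x)
    case 0
    then show ?case using b lam by simp
  next
    case (Suc n)
    have "P ((P ^^ n) W) x = (P ^^ n) (P W) x" by (simp add: funpow_swap1)
    also have "\<dots> \<le> (P ^^ n) (\<lambda>x. lam * W x + b) x"
    proof (rule positive_operator.op_mono[OF positive_operator_funpow])
      show "P W x \<le> lam * W x + b" for x
        using drift[of x] b by (cases "x \<in> C") auto
    qed (intro op_closed wspace_self wspace_add wspace_scale wspace_const)+
    also have "\<dots> = lam * (P ^^ n) W x + (P ^^ n) (\<lambda>x. b * 1) x"
      using positive_operator.op_add[OF positive_operator_funpow wspace_scale[OF wspace_self] wspace_const, of n lam b]
        positive_operator.op_scale[OF positive_operator_funpow wspace_self, of n lam] by simp
    also have "(P ^^ n) (\<lambda>x. b * 1) x = b"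
    proof -
      have "(P ^^ n) (\<lambda>x. 1) = (\<lambda>x. 1)" by (induction n) (auto simp: P_one)
      then show ?thesis
        by (subst positive_operator.op_scale[OF positive_operator_funpow wspace_const]) simp
    qed
    also have "lam * (P ^^ n) W x + b \<le> lam * (W x + b / (1 - lam)) + b"
      using Suc lam by (intro add_right_mono mult_left_mono) auto
    also have "\<dots> = lam * W x + b / (1 - lam)"
      using lam by (simp add: field_simps)
    also have "lam * W x \<le> W x" using lam W_pos[of x] by (simp add: mult_le_cancel_right1)
    finally show ?case by simp
  qed
  have "b / (1 - lam) * 1 \<le> b / (1 - lam) * W x"
    using W_ge1 lam b by (intro mult_left_mono) auto
  then show ?thesis using *[of n x] by (simp add: distrib_right)
qed

text \<open>The equation \<open>u - P u = f\<close> is solved with \<open>u\<close> at most a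
  multiple of \<open>c * W\<close>. The partial sums telescope to \<open>u - (P ^^ n) u\<close>, and
  \<open>funpow_W\<close> bounds the second term independently of \<open>n\<close>. \<open>D\<close>
  is chosen before \<open>f\<close>, which later makes variances uniform over sets.\<close>

theorem poisson_bound:
  obtains D where "0 \<le> D"
    "\<And>f c n x. f \<in> borel_measurable borel \<Longrightarrow> (\<And>x. \<bar>f x\<bar> \<le> c * W x) \<Longrightarrow> \<theta> f = 0 \<Longrightarrow>
       \<bar>\<Sum>k<n. (P ^^ k) f x\<bar> \<le> D * c * W x"
proof -
  \<comment> \<open>\<open>e\<close> is so small that \<open>e P\<close> contracts in the norm weighted by \<open>W\<close>; then \<open>R = (1 - e) (I - e P)\<inverse>\<close>.\<close>
  define e where "e = 1 / (2 * (lam + b + 1))"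
  have e: "0 < e" "e < 1" "e * lam < 1" and e_half: "e * (lam + b) \<le> 1/2"
    using lam b unfolding e_def by (auto simp: field_simps)
  interpret E: contractive_operator W "\<lambda>f x. e * P f x" "1/2"
  proof -
    interpret S: positive_operator W "\<lambda>f x. e * P f x"
      using e by (intro positive_operator_scale) auto
    show "contractive_operator W (\<lambda>f x. e * P f x) (1/2)"
    proof
      fix x
      have "P W x \<le> (lam + b) * W x"
        using drift[of x] b mult_left_mono[OF W_ge1[of x] b] by (cases "x \<in> C") (auto simp: distrib_right)
      then have "e * P W x \<le> e * ((lam + b) * W x)" using e by (intro mult_left_mono) auto
      also have "\<dots> \<le> 1/2 * W x"
        using mult_right_mono[OF e_half] W_pos[of x] by (simp add: mult.assoc less_imp_le)
      finally show "e * P W x \<le> 1/2 * W x" .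
    qed auto
  qed
  define N where "N = E.neumann"
  interpret N: positive_operator W N unfolding N_def by (rule E.positive_operator_neumann)
  have N_left: "N f x = f x + e * P (N f) x" if "f \<in> wspace W" for f x
    unfolding N_def by (rule E.neumann_unfold_left[OF that])
  have C: "indicat_real C \<in> wspace W" by (rule wspace_indicator[OF C_sets])
  have N_pow: "((\<lambda>f x. e * P f x) ^^ k) f = (\<lambda>x. e ^ k * (P ^^ k) f x)" if "f \<in> wspace W" for k f
    by (induction k) (auto simp: op_scale[OF funpow_closed[OF that]] mult_ac)
  \<comment> \<open>In the series for \<open>R\<close>, the terms of order at least \<open>m\<close>
    give \<open>(1 - e) * e ^ m * N ((P ^^ m) f)\<close>, and \<open>(P ^^ m) f\<close> dominates
    \<open>\<nu> f\<close> on \<open>C\<close>.\<close>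
  define s where "s = (\<lambda>x. (1 - e) * e ^ m * N (indicat_real C) x)"
  have s: "s \<in> wspace W" unfolding s_def by (intro wspace_scale N.op_closed C)
  have s_nonneg: "0 \<le> s x" for x
    unfolding s_def using e by (intro mult_nonneg_nonneg N.op_nonneg C) auto
  define R where "R = (\<lambda>f x. (1 - e) * N f x)"
  interpret R: positive_operator W R unfolding R_def using e by (intro N.positive_operator_scale) auto
  have R_minor: "\<nu> f * s x \<le> R f x" if f: "f \<in> wspace W" and pos: "\<And>x. 0 \<le> f x" for f x
  proof -
    have "\<nu> f * N (indicat_real C) x = N (\<lambda>x. \<nu> f * indicat_real C x) x"
      by (simp add: N.op_scale[OF C])
    also have "\<dots> \<le> N ((P ^^ m) f) x"
      using minor[OF f pos] positive_operator.op_nonneg[OF positive_operator_funpow f pos, of m]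
      by (intro N.op_mono wspace_scale C funpow_closed f) (auto simp: indicator_def)
    finally have "e ^ m * (\<nu> f * N (indicat_real C) x) \<le> e ^ m * N ((P ^^ m) f) x"
      using e by (intro mult_left_mono) auto
    also have "\<dots> = N (\<lambda>x. e ^ m * (P ^^ m) f x) x"
      by (simp add: N.op_scale[OF funpow_closed[OF f]])
    also have "\<dots> \<le> N f x"
    proof -
      have "0 \<le> (\<Sum>k<m. ((\<lambda>f x. e * P f x) ^^ k) f x)"
        by (intro sum_nonneg positive_operator.op_nonneg[OF E.positive_operator_funpow f pos])
      then show ?thesis
        using E.neumann_split[OF f, of x m] unfolding N_def N_pow[OF f, of m] by simp
    qed
    finally have "(1 - e) * (e ^ m * (\<nu> f * N (indicat_real C) x)) \<le> (1 - e) * N f x"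
      using e by (intro mult_left_mono) auto
    then show ?thesis unfolding R_def s_def by (simp add: mult_ac)
  qed
  \<comment> \<open>\<open>N W = W + N (e P W)\<close> and the drift yield
    \<open>(1 - e lam) N W \<le> W + e b N 1_C\<close>. Dividing by \<open>1 - e lam\<close> and
    multiplying by \<open>1 - e\<close> gives \<open>l2\<close>; rewriting \<open>N 1_C\<close> in
    terms of \<open>s\<close> gives \<open>b2\<close>, with its factor
    \<open>1 / e ^ m\<close>.\<close>
  define l2 where "l2 = (1 - e) / (1 - e * lam)"
  define b2 where "b2 = e * b / (e ^ m * (1 - e * lam))"
  have l2: "0 \<le> l2" "l2 < 1" and b2: "0 \<le> b2"
    using e lam b unfolding l2_def b2_def by (auto simp: field_simps)
  have R_drift: "R W x \<le> l2 * W x + b2 * s x" for x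
  proof -
    have "N (\<lambda>x. e * P W x) x \<le> N (\<lambda>x. (e * lam) * W x + (e * b) * indicator C x) x"
      using drift e by (intro N.op_mono wspace_scale wspace_add op_closed wspace_self C)
        (auto simp: mult.assoc distrib_left[symmetric] intro!: mult_left_mono)
    also have "\<dots> = (e * lam) * N W x + (e * b) * N (indicat_real C) x"
      by (simp add: N.op_add[OF wspace_scale[OF wspace_self] wspace_scale[OF C]] N.op_scale[OF wspace_self] N.op_scale[OF C])
    finally have "(1 - e * lam) * N W x \<le> W x + e * b * N (indicat_real C) x"
      using E.neumann_unfold_right[OF wspace_self, of x] unfolding N_def[symmetric] by (simp add: algebra_simps)
    then have "N W x \<le> (W x + e * b * N (indicat_real C) x) / (1 - e * lam)"
      using e by (simp add: field_simps)
    then have "(1 - e) * N W x \<le> (1 - e) * ((W x + e * b * N (indicat_real C) x) / (1 - e * lam))"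
      using e by (intro mult_left_mono) auto
    also have "\<dots> = l2 * W x + b2 * s x"
    proof -
      have "b2 * s x = (1 - e) * (e * b * N (indicat_real C) x) / (1 - e * lam)"
        unfolding b2_def s_def using e by simp
      then show ?thesis
        unfolding l2_def by (simp add: add_divide_distrib distrib_left)
    qed
    finally show ?thesis unfolding R_def .
  qed
  have R_one: "R (\<lambda>x. 1) x = 1" for x
  proof -
    have pow: "((\<lambda>f x. e * P f x) ^^ k) (\<lambda>x. 1) = (\<lambda>x. e ^ k)" for k
    proof -
      have "(P ^^ k) (\<lambda>x. 1) = (\<lambda>x. 1)" by (induction k) (auto simp: P_one)
      then show ?thesis using N_pow[OF wspace_const] by simp
    qed
    show ?thesis
      unfolding R_def N_def E.neumann_def pow using e by (simp add: suminf_geometric)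
  qed
  have pi_R: "\<theta> (R f) = \<theta> f" if f: "f \<in> wspace W" for f
  proof -
    have "N f = (\<lambda>x. f x + e * P (N f) x)" using N_left[OF f] by blast
    then have "\<theta> (N f) = \<theta> f + e * \<theta> (N f)"
      using pi.fun_add[OF f wspace_scale[OF op_closed[OF N.op_closed[OF f]]]]
        pi.fun_scale[OF op_closed[OF N.op_closed[OF f]], of e] pi_inv[OF N.op_closed[OF f]] by metis
    then show ?thesis
      unfolding R_def using pi.fun_scale[OF N.op_closed[OF f], of "1 - e"] by (simp add: algebra_simps)
  qed
  \<comment> \<open>Integrating the drift of \<open>R\<close> gives
    \<open>(1 - l2) \<theta> W \<le> b2 \<theta> s\<close>, so \<open>s\<close> has positive
    stationary mass. This forces \<open>\<nu> g = 0\<close> below.\<close>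
  have pi_s: "0 < \<theta> s"
  proof -
    have "0 < \<theta> W"
      using pi_one pi.fun_mono[OF wspace_const wspace_self W_ge1] by linarith
    have "\<theta> W \<le> \<theta> (\<lambda>x. l2 * W x + b2 * s x)"
      unfolding pi_R[OF wspace_self, symmetric]
      by (intro pi.fun_mono R.op_closed wspace_add wspace_scale wspace_self s R_drift)
    also have "\<dots> = l2 * \<theta> W + b2 * \<theta> s"
      by (simp add: pi.fun_add[OF wspace_scale[OF wspace_self] wspace_scale[OF s]] pi.fun_scale[OF wspace_self] pi.fun_scale[OF s])
    finally have "(1 - l2) * \<theta> W \<le> b2 * \<theta> s" by (simp add: algebra_simps)
    moreover have "0 < (1 - l2) * \<theta> W" using l2 \<open>0 < \<theta> W\<close> by simp
    ultimately have "0 < b2 * \<theta> s" by linarith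
    then show ?thesis using b2 pi.fun_nonneg[OF s s_nonneg] by (simp add: zero_less_mult_iff)
  qed
  \<comment> \<open>With \<open>A * \<nu> 1 = b2\<close>, the mass that \<open>Q\<close> subtracts
    from the constant \<open>A\<close> cancels the term \<open>b2 * s\<close> of the drift exactly,
    leaving \<open>Q (W + A) \<le> l2 * W + A\<close>.\<close>
  define A where "A = b2 / \<nu> (\<lambda>x. 1)"
  have A: "0 \<le> A" unfolding A_def using b2 nu_one by simp
  define Q where "Q = (\<lambda>f x. R f x - \<nu> f * s x)"
  \<comment> \<open>The decrease \<open>(1 - l2) W\<close> is at least the fraction
    \<open>(1 - l2) / (1 + A)\<close> of \<open>W + A\<close>, because
    \<open>W + A \<le> (1 + A) W\<close>.\<close>
  define \<kappa> where "\<kappa> = 1 - (1 - l2) / (1 + A)"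
  interpret Q: contractive_operator "\<lambda>x. W x + A" Q \<kappa>
  proof
    show "(\<lambda>x. W x + A) \<in> borel_measurable borel" using W_meas by measurable
    show "1 \<le> W x + A" for x using W_ge1[of x] A by linarith
    show "Q f \<in> wspace (\<lambda>x. W x + A)" if "f \<in> wspace (\<lambda>x. W x + A)" for f
      using that unfolding wspace_shift[OF A] Q_def by (intro wspace_diff wspace_scale R.op_closed s)
    show "Q (\<lambda>x. f x + g x) = (\<lambda>x. Q f x + Q g x)"
      if "f \<in> wspace (\<lambda>x. W x + A)" "g \<in> wspace (\<lambda>x. W x + A)" for f g
      using that unfolding wspace_shift[OF A] Q_def by (simp add: R.op_add nu.fun_add algebra_simps)
    show "Q (\<lambda>x. a * f x) = (\<lambda>x. a * Q f x)" if "f \<in> wspace (\<lambda>x. W x + A)" for f a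
      using that unfolding wspace_shift[OF A] Q_def by (simp add: R.op_scale nu.fun_scale algebra_simps)
    show "0 \<le> Q f x" if "f \<in> wspace (\<lambda>x. W x + A)" "\<And>x. 0 \<le> f x" for f x
      using that unfolding wspace_shift[OF A] Q_def by (simp add: R_minor)
    have "(1 - l2) / (1 + A) \<le> 1"
      using l2 A by (simp add: divide_le_eq)
    then show "0 \<le> \<kappa>" "\<kappa> < 1" unfolding \<kappa>_def using l2 A by auto
    show "Q (\<lambda>x. W x + A) x \<le> \<kappa> * (W x + A)" for x
    proof -
      have "R (\<lambda>x. W x + A * 1) x = R W x + A"
        using R.op_add[OF wspace_self wspace_scale[OF wspace_const[of 1], of A]] R.op_scale[OF wspace_const[of 1], of A]
          R_one[of x] by simp
      moreover have "\<nu> (\<lambda>x. W x + A * 1) = \<nu> W + A * \<nu> (\<lambda>x. 1)"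
        using nu.fun_add[OF wspace_self wspace_scale[OF wspace_const[of 1], of A]] nu.fun_scale[OF wspace_const[of 1], of A]
        by simp
      ultimately have "Q (\<lambda>x. W x + A) x = (R W x + A) - (\<nu> W + A * \<nu> (\<lambda>x. 1)) * s x"
        unfolding Q_def by simp
      also have "\<dots> \<le> (l2 * W x + b2 * s x + A) - (0 + A * \<nu> (\<lambda>x. 1)) * s x"
        using R_drift[of x] s_nonneg[of x] nu.fun_nonneg[OF wspace_self] W_pos
        by (intro diff_mono add_right_mono mult_right_mono) (auto simp: less_imp_le)
      also have "A * \<nu> (\<lambda>x. 1) = b2" unfolding A_def using nu_one by simp
      also have "l2 * W x + b2 * s x + A - (0 + b2) * s x = (W x + A) - (1 - l2) * W x"
        by (simp add: algebra_simps)
      also have "\<dots> \<le> (W x + A) - (1 - l2) * ((W x + A) / (1 + A))"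
      proof -
        have "W x + A \<le> W x * (1 + A)" using mult_right_mono[OF W_ge1[of x] A] by (simp add: algebra_simps)
        then have "(W x + A) / (1 + A) \<le> W x" using A by (simp add: divide_le_eq)
        then show ?thesis using l2 by (intro diff_mono mult_left_mono) auto
      qed
      also have "\<dots> = \<kappa> * (W x + A)" unfolding \<kappa>_def by (simp add: algebra_simps)
      finally show ?thesis by simp
    qed
  qed
  \<comment> \<open>\<open>1 / (1 - \<kappa>)\<close> bounds the Neumann series in the weight
    \<open>W + A\<close>, and \<open>1 + A\<close> returns to \<open>W\<close>. In \<open>D\<close>,
    the factor 2 is the sum of the geometric series with ratio 1/2 for \<open>N\<close>, and
    \<open>2 + b / (1 - lam)\<close> adds the bounds for \<open>u\<close> and
    \<open>(P ^^ n) u\<close>.\<close>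
  define D1 where "D1 = (1 + A) / (1 - \<kappa>)"
  define D where "D = (2 * e * D1) * (2 + b / (1 - lam))"
  have D1: "0 \<le> D1" unfolding D1_def using A Q.kappa by simp
  show thesis
  proof (rule that[of D])
    show "0 \<le> D" unfolding D_def using D1 e lam b by simp
    fix f c n x
    assume fm: "f \<in> borel_measurable borel" and fc: "\<And>x. \<bar>f x\<bar> \<le> c * W x" and f0: "\<theta> f = 0"
    have c: "0 \<le> c" by (rule weight_bound_nonneg[OF fc])
    have f: "f \<in> wspace W" by (rule wspaceI[OF fm fc])
    have f': "f \<in> wspace (\<lambda>x. W x + A)" using f wspace_shift[OF A] by blast
    define g where "g = Q.neumann f"
    have g: "g \<in> wspace W"
      using positive_operator.op_closed[OF Q.positive_operator_neumann f'] unfolding g_def wspace_shift[OF A] .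
    have g_bd: "\<bar>g x\<bar> \<le> c * D1 * W x" for x
    proof -
      have "\<bar>g x\<bar> \<le> c / (1 - \<kappa>) * (W x + A)"
        unfolding g_def
      proof (rule Q.neumann_bound[OF f'])
        show "\<bar>f x\<bar> \<le> c * (W x + A)" for x
          using fc[of x] mult_nonneg_nonneg[OF c A] by (simp add: distrib_left)
      qed
      also have "\<dots> \<le> c / (1 - \<kappa>) * (W x * (1 + A))"
        using c Q.kappa mult_right_mono[OF W_ge1[of x] A] by (intro mult_left_mono) (auto simp: algebra_simps)
      finally show ?thesis unfolding D1_def by (simp add: mult_ac)
    qed
    have g_eq: "g x + \<nu> g * s x = f x + R g x" for x
    proof -
      have "g x = f x + Q g x" unfolding g_def by (rule Q.neumann_unfold_left[OF f'])
      then show ?thesis by (simp add: Q_def)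
    qed
    \<comment> \<open>Applying \<open>\<theta>\<close> to \<open>g + \<nu> g * s = f + R g\<close>:
      invariance cancels \<open>\<theta> g\<close> against \<open>\<theta> (R g)\<close>, which
      leaves \<open>\<nu> g * \<theta> s = \<theta> f = 0\<close>.\<close>
    have "\<theta> g + \<nu> g * \<theta> s = \<theta> f + \<theta> (R g)"
    proof -
      have "\<theta> (\<lambda>x. g x + \<nu> g * s x) = \<theta> (\<lambda>x. f x + R g x)" using g_eq by presburger
      then show ?thesis
        by (simp add: pi.fun_add[OF g wspace_scale[OF s]] pi.fun_add[OF f R.op_closed[OF g]] pi.fun_scale[OF s])
    qed
    then have "\<nu> g = 0" using f0 pi_R[OF g] pi_s by simp
    \<comment> \<open>So \<open>(I - R) g = f\<close>, and \<open>I - R = e (I - P) (I - e P)\<inverse>\<close>.\<close>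
    define u where "u = (\<lambda>x. e * N g x)"
    have u: "u \<in> wspace W" unfolding u_def by (intro wspace_scale N.op_closed g)
    have u_bd: "\<bar>u x\<bar> \<le> (2 * e * D1) * c * W x" for x
      using mult_left_mono[OF E.neumann_bound[OF g g_bd, of x], of e] e
      unfolding u_def N_def by (simp add: abs_mult mult_ac)
    have poisson: "u x - P u x = f x" for x
      using g_eq[of x] N_left[OF g, of x] \<open>\<nu> g = 0\<close>
      unfolding u_def R_def op_scale[OF N.op_closed[OF g]] by (simp add: algebra_simps)
    have "(\<Sum>k<n. (P ^^ k) f x) = (\<Sum>k<n. (P ^^ k) u x - (P ^^ Suc k) u x)"
    proof (rule sum.cong)
      fix k
      have "f = (\<lambda>x. u x - P u x)" using poisson by presburger
      then show "(P ^^ k) f x = (P ^^ k) u x - (P ^^ Suc k) u x"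
        using positive_operator.op_diff[OF positive_operator_funpow u op_closed[OF u], of k]
        by (simp add: funpow_swap1)
    qed simp
    also have "\<dots> = u x - (P ^^ n) u x" by (induction n) auto
    finally have "\<bar>\<Sum>k<n. (P ^^ k) f x\<bar> \<le> \<bar>u x\<bar> + \<bar>(P ^^ n) u x\<bar>" by linarith
    also have "\<bar>(P ^^ n) u x\<bar> \<le> (P ^^ n) (\<lambda>x. (2 * e * D1) * c * W x) x"
      using u_bd by (intro positive_operator.op_abs[OF positive_operator_funpow] u wspace_scale wspace_self)
    also have "\<dots> = (2 * e * D1) * c * (P ^^ n) W x"
      using positive_operator.op_scale[OF positive_operator_funpow wspace_self] by metis
    also have "\<dots> \<le> (2 * e * D1) * c * ((1 + b / (1 - lam)) * W x)"
      using e D1 c by (intro mult_left_mono funpow_W) auto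
    finally show "\<bar>\<Sum>k<n. (P ^^ k) f x\<bar> \<le> D * c * W x"
      using u_bd[of x] unfolding D_def by (simp add: algebra_simps)
  qed
qed

end

section \<open>Transition densities with a small set\<close>

lemma (in prob_space) nn_integral_const_1: "(\<integral>\<^sup>+x. c \<partial>M) = c"
  by (simp add: emeasure_space_1)

definition kernel_operator :: "('a \<Rightarrow> 'b measure) \<Rightarrow> ('b \<Rightarrow> real) \<Rightarrow> 'a \<Rightarrow> real" where
  "kernel_operator \<kappa> f x = (\<integral>y. f y \<partial>\<kappa> x)"

lemma prob_space_density_lborel: "prob_density f \<Longrightarrow> prob_space (density lborel (\<lambda>x. ennreal (f x)))"
  unfolding prob_density_def by (intro prob_spaceI) (simp add: emeasure_density)

locale drift_chain =
  fixes p :: "real \<Rightarrow> real \<Rightarrow> real" and \<pi> V :: "real \<Rightarrow> real" and lam b :: real and C :: "real set"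
  assumes p: "transition_density p"
    and inv: "invariant_density p \<pi>"
    and V_meas [measurable]: "V \<in> borel_measurable borel" and V_ge1: "\<And>x. 1 \<le> V x"
    and lam: "0 < lam" "lam < 1" and b: "0 < b"
    and small: "small_set borel (density_kernel p) C"
    and drift: "\<And>x. (\<integral>\<^sup>+y. ennreal (p x y * V y) \<partial>lborel) \<le> ennreal (lam * V x + b * indicator C x)"
begin

abbreviation "W \<equiv> \<lambda>x. sqrt (V x)"
abbreviation "P \<equiv> kernel_operator (density_kernel p)"
abbreviation "stat \<equiv> density lborel (\<lambda>x. ennreal (\<pi> x))"

lemma p_meas [measurable]: "(\<lambda>(x, y). p x y) \<in> borel_measurable (borel \<Otimes>\<^sub>M borel)"
  using p unfolding transition_density_def by blast

lemma p_dens: "prob_density (p x)"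
  using p unfolding transition_density_def by blast

lemma p_meas1 [measurable]: "p x \<in> borel_measurable borel"
  using p_dens unfolding prob_density_def by blast

lemma p_nonneg: "0 \<le> p x y"
  using p_dens unfolding prob_density_def by blast

lemma pi_dens: "prob_density \<pi>"
  using inv unfolding invariant_density_def by blast

lemma pi_meas [measurable]: "\<pi> \<in> borel_measurable borel"
  using pi_dens unfolding prob_density_def by blast

lemma pi_nonneg: "0 \<le> \<pi> x"
  using pi_dens unfolding prob_density_def by blast

lemma sets_kernel [simp, measurable_cong]: "sets (density_kernel p x) = sets borel"
  unfolding density_kernel_def by simp

lemma prob_space_kernel: "prob_space (density_kernel p x)"
  unfolding density_kernel_def by (rule prob_space_density_lborel[OF p_dens])

lemma prob_space_stat: "prob_space stat"
  by (rule prob_space_density_lborel[OF pi_dens])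

lemma nn_integral_kernel:
  assumes [measurable]: "f \<in> borel_measurable borel"
  shows "(\<integral>\<^sup>+y. f y \<partial>density_kernel p x) = (\<integral>\<^sup>+y. ennreal (p x y) * f y \<partial>lborel)"
  unfolding density_kernel_def by (subst nn_integral_density) auto

lemma measurable_nn_integral_kernel [measurable]:
  assumes [measurable]: "f \<in> borel_measurable borel"
  shows "(\<lambda>x. \<integral>\<^sup>+y. f y \<partial>density_kernel p x) \<in> borel_measurable borel"
proof -
  have [measurable]: "(\<lambda>z. f (snd z)) \<in> borel_measurable (borel \<Otimes>\<^sub>M lborel)"
    by measurable
  show ?thesis unfolding nn_integral_kernel[OF assms] by measurable
qed

lemma kernel_measurable: "density_kernel p \<in> borel \<rightarrow>\<^sub>M subprob_algebra borel"
proof (rule measurable_subprob_algebra)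
  show "subprob_space (density_kernel p x)" for x
    by (rule prob_space_imp_subprob_space[OF prob_space_kernel])
  show "(\<lambda>x. emeasure (density_kernel p x) A) \<in> borel_measurable borel" if [measurable]: "A \<in> sets borel" for A
    using measurable_nn_integral_kernel[of "indicator A"] by simp
qed simp

lemma kernel_V: "(\<integral>\<^sup>+y. ennreal (V y) \<partial>density_kernel p x) \<le> ennreal (lam * V x + b * indicator C x)"
  using drift[of x] by (subst nn_integral_kernel) (auto simp: ennreal_mult'[OF p_nonneg])

lemma stat_kernel:
  assumes [measurable]: "f \<in> borel_measurable borel"
  shows "(\<integral>\<^sup>+x. (\<integral>\<^sup>+y. f y \<partial>density_kernel p x) \<partial>stat) = (\<integral>\<^sup>+x. f x \<partial>stat)"
proof -
  have [measurable]: "(\<lambda>z. f (snd z)) \<in> borel_measurable (lborel \<Otimes>\<^sub>M lborel)"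
    by measurable
  have "(\<integral>\<^sup>+x. (\<integral>\<^sup>+y. f y \<partial>density_kernel p x) \<partial>stat)
      = (\<integral>\<^sup>+x. (\<integral>\<^sup>+y. ennreal (\<pi> x) * (ennreal (p x y) * f y) \<partial>lborel) \<partial>lborel)"
    by (subst nn_integral_density) (auto simp: nn_integral_kernel nn_integral_cmult)
  also have "\<dots> = (\<integral>\<^sup>+y. (\<integral>\<^sup>+x. ennreal (\<pi> x) * (ennreal (p x y) * f y) \<partial>lborel) \<partial>lborel)"
    by (rule lborel_pair.Fubini') measurable
  also have "\<dots> = (\<integral>\<^sup>+y. ennreal (\<pi> y) * f y \<partial>lborel)"
  proof (rule nn_integral_cong)
    fix y
    have "(\<integral>\<^sup>+x. ennreal (\<pi> x) * (ennreal (p x y) * f y) \<partial>lborel) = (\<integral>\<^sup>+x. ennreal (\<pi> x * p x y) * f y \<partial>lborel)"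
      by (simp add: ennreal_mult' pi_nonneg mult.assoc)
    also have "\<dots> = (\<integral>\<^sup>+x. ennreal (\<pi> x * p x y) \<partial>lborel) * f y"
      by (rule nn_integral_multc) measurable
    also have "(\<integral>\<^sup>+x. ennreal (\<pi> x * p x y) \<partial>lborel) = ennreal (\<pi> y)"
      using inv unfolding invariant_density_def by simp
    finally show "(\<integral>\<^sup>+x. ennreal (\<pi> x) * (ennreal (p x y) * f y) \<partial>lborel) = ennreal (\<pi> y) * f y" .
  qed
  also have "\<dots> = (\<integral>\<^sup>+x. f x \<partial>stat)"
    by (subst nn_integral_density) auto
  finally show ?thesis .
qed

section \<open>Stationary moments and the drift of the square root\<close>

lemma stat_V: "(\<integral>\<^sup>+x. ennreal (V x) \<partial>stat) \<le> ennreal (b / (1 - lam))"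
proof -
  interpret S: prob_space stat by (rule prob_space_stat)
  \<comment> \<open>Integrability of \<open>V\<close> is not known yet, so invariance is applied to \<open>min V n\<close>.\<close>
  define g where "g = (\<lambda>(n::nat) x. V x * indicator {x. V x \<le> real n} x)"
  have g_meas [measurable]: "g n \<in> borel_measurable borel" for n unfolding g_def by measurable
  have V0: "0 \<le> V x" for x using V_ge1[of x] by linarith
  have bound: "(\<integral>\<^sup>+x. ennreal (g n x) \<partial>stat) \<le> ennreal (b / (1 - lam))" for n
  proof -
    let ?u = "\<lambda>x. min (V x) (real n)" and ?v = "\<lambda>x. min (lam * V x + b) (real n)"
    have v0: "0 \<le> ?v x" for x using V0[of x] lam b by auto
    have int: "integrable stat ?u" "integrable stat ?v" "integrable stat (g n)"
      using V0 v0 by (auto intro!: S.integrable_const_bound[of _ "real n"] simp: g_def indicator_def)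
    have le: "(\<integral>\<^sup>+y. ennreal (?u y) \<partial>density_kernel p x) \<le> ennreal (?v x)" for x
    proof -
      interpret K: prob_space "density_kernel p x" by (rule prob_space_kernel)
      have "(\<integral>\<^sup>+y. ennreal (?u y) \<partial>density_kernel p x) \<le> (\<integral>\<^sup>+y. ennreal (V y) \<partial>density_kernel p x)"
        by (intro nn_integral_mono ennreal_leI) auto
      also have "\<dots> \<le> ennreal (lam * V x + b * indicator C x)" by (rule kernel_V)
      also have "\<dots> \<le> ennreal (lam * V x + b)" using b by (intro ennreal_leI) (auto simp: indicator_def)
      finally have 1: "(\<integral>\<^sup>+y. ennreal (?u y) \<partial>density_kernel p x) \<le> ennreal (lam * V x + b)" .
      have "(\<integral>\<^sup>+y. ennreal (?u y) \<partial>density_kernel p x) \<le> (\<integral>\<^sup>+y. ennreal (real n) \<partial>density_kernel p x)"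
        by (intro nn_integral_mono ennreal_leI) auto
      then have "(\<integral>\<^sup>+y. ennreal (?u y) \<partial>density_kernel p x) \<le> ennreal (real n)"
        by (simp only: K.nn_integral_const_1)
      with 1 show ?thesis by (auto simp: min_def)
    qed
    have "(\<integral>\<^sup>+x. ennreal (?u x) \<partial>stat) \<le> (\<integral>\<^sup>+x. ennreal (?v x) \<partial>stat)"
      using nn_integral_mono[OF le, of stat "\<lambda>x. x"] stat_kernel[of "\<lambda>y. ennreal (?u y)"] by simp
    then have "(\<integral>x. ?u x \<partial>stat) \<le> (\<integral>x. ?v x \<partial>stat)"
      using V0 v0 int by (simp add: nn_integral_eq_integral)
    then have "(\<integral>x. ?u x - ?v x \<partial>stat) \<le> 0" using int by simp
    \<comment> \<open>Where \<open>V x \<le> n\<close> the truncation of \<open>V\<close> is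
      inactive and the right side is at least \<open>V - (lam V + b)\<close>; elsewhere it is
      nonnegative, while \<open>g n\<close> vanishes. Only bounded functions are subtracted.\<close>
    moreover have "(\<integral>x. (1 - lam) * g n x - b \<partial>stat) \<le> (\<integral>x. ?u x - ?v x \<partial>stat)"
    proof (rule integral_mono)
      show "(1 - lam) * g n x - b \<le> ?u x - ?v x" for x
        using b unfolding g_def by (auto simp: indicator_def algebra_simps)
    qed (use int in auto)
    ultimately have "(1 - lam) * (\<integral>x. g n x \<partial>stat) \<le> b" using int S.prob_space by simp
    then have "(\<integral>x. g n x \<partial>stat) \<le> b / (1 - lam)" using lam by (simp add: field_simps)
    moreover have "(\<integral>\<^sup>+x. ennreal (g n x) \<partial>stat) = ennreal (\<integral>x. g n x \<partial>stat)"
      using int V0 by (intro nn_integral_eq_integral) (auto simp: g_def indicator_def)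
    ultimately show ?thesis by (simp add: ennreal_leI)
  qed
  have lim: "(\<lambda>n. \<integral>\<^sup>+x. ennreal (g n x) \<partial>stat) \<longlonglongrightarrow> (\<integral>\<^sup>+x. ennreal (V x) \<partial>stat)"
  proof (rule nn_integral_LIMSEQ)
    show "incseq (\<lambda>n x. ennreal (g n x))"
      using V0 unfolding g_def by (intro incseq_SucI le_funI ennreal_leI) (auto simp: indicator_def)
    show "(\<lambda>n. ennreal (g n x)) \<longlonglongrightarrow> ennreal (V x)" for x
    proof (rule tendsto_eventually)
      show "\<forall>\<^sub>F n in sequentially. ennreal (g n x) = ennreal (V x)"
        using eventually_ge_at_top[of "nat \<lceil>V x\<rceil>"]
        by eventually_elim (auto simp: g_def indicator_def nat_le_iff ceiling_le_iff)
    qed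
  qed auto
  show ?thesis
    using bound by (intro LIMSEQ_le_const2[OF lim]) auto
qed

lemma C_sets [measurable]: "C \<in> sets borel"
  using small unfolding small_set_def by blast

text \<open>If \<open>C\<close> were empty, then \<open>P V \<le> lam V\<close>, which is
  contradictory after integration against the stationary law, where \<open>V\<close> has a finite
  integral of at least 1. A point of \<open>C\<close> is later used to show that the minorizing
  measure integrates \<open>W\<close>.\<close>

lemma C_nonempty: "C \<noteq> {}"
proof
  assume "C = {}"
  interpret S: prob_space stat by (rule prob_space_stat)
  have V0: "0 \<le> V x" for x using V_ge1[of x] by linarith
  have fin: "(\<integral>\<^sup>+x. ennreal (V x) \<partial>stat) < \<top>" using stat_V by (rule le_less_trans) simp
  then have int: "integrable stat V" using V0 by (intro integrableI_nonneg) auto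
  have "(\<integral>\<^sup>+x. ennreal (V x) \<partial>stat) \<le> (\<integral>\<^sup>+x. ennreal (lam * V x) \<partial>stat)"
    using stat_kernel[of V] nn_integral_mono[OF kernel_V, of stat "\<lambda>x. x"] \<open>C = {}\<close>
    by simp
  then have "(\<integral>x. V x \<partial>stat) \<le> (\<integral>x. lam * V x \<partial>stat)"
    using V0 int lam by (simp add: nn_integral_eq_integral integral_nonneg_AE)
  moreover have "1 \<le> (\<integral>x. V x \<partial>stat)"
    using integral_mono[OF S.integrable_const[of 1] int V_ge1] S.prob_space by simp
  ultimately show False using lam by simp
qed

sublocale weight W
  using V_ge1 by unfold_locales auto

lemma W_V: "W x * W x = V x" "(W x)\<^sup>2 = V x"
  using V_ge1[of x] by auto

text \<open>Jensen's inequality for the square root, in the form of a tangent: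
  \<open>W y \<le> t / 2 + V y / (2 t)\<close>, where \<open>t\<close> is the square root of the
  drift bound at \<open>x\<close>, the optimal choice. Subadditivity of \<open>sqrt\<close> then
  separates the two terms.\<close>

lemma kernel_W: "(\<integral>\<^sup>+y. ennreal (W y) \<partial>density_kernel p x) \<le> ennreal (sqrt lam * W x + sqrt b * indicator C x)"
proof -
  interpret K: prob_space "density_kernel p x" by (rule prob_space_kernel)
  let ?v = "lam * V x + b * indicator C x"
  define t where "t = sqrt ?v"
  have v: "0 < ?v" using lam b V_ge1[of x] by (auto simp: indicator_def intro!: add_pos_nonneg mult_pos_pos)
  then have t: "0 < t" "t * t = ?v" unfolding t_def by auto
  have "(\<integral>\<^sup>+y. ennreal (W y) \<partial>density_kernel p x) \<le> (\<integral>\<^sup>+y. ennreal (t / 2) + ennreal (1 / (2 * t)) * ennreal (V y) \<partial>density_kernel p x)"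
  proof (rule nn_integral_mono)
    fix y
    have "0 \<le> (W y - t)\<^sup>2" by simp
    then have "2 * W y * t \<le> t * t + V y" using W_V(2)[of y] unfolding power2_diff power2_eq_square[of t] by linarith
    then have "W y \<le> t / 2 + 1 / (2 * t) * V y" using t by (simp add: field_simps)
    then show "ennreal (W y) \<le> ennreal (t / 2) + ennreal (1 / (2 * t)) * ennreal (V y)"
      using t V_ge1[of y] by (simp add: ennreal_mult'[symmetric] ennreal_plus[symmetric] ennreal_leI del: ennreal_plus)
  qed
  also have "\<dots> = ennreal (t / 2) + ennreal (1 / (2 * t)) * (\<integral>\<^sup>+y. ennreal (V y) \<partial>density_kernel p x)"
    by (subst nn_integral_add) (auto simp: nn_integral_cmult K.emeasure_space_1)
  also have "\<dots> \<le> ennreal (t / 2) + ennreal (1 / (2 * t)) * ennreal ?v"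
    by (intro add_left_mono mult_left_mono kernel_V) auto
  also have "\<dots> = ennreal (t / 2 + 1 / (2 * t) * ?v)"
    using t v by (simp add: ennreal_mult'[symmetric] ennreal_plus[symmetric] del: ennreal_plus)
  also have "t / 2 + 1 / (2 * t) * ?v = t" unfolding t(2)[symmetric] using t(1) by (simp add: field_simps)
  also have "t \<le> sqrt lam * W x + sqrt b * indicator C x"
    unfolding t_def using sqrt_add_le_add_sqrt[of "lam * V x" "b * indicator C x"] lam b V_ge1[of x]
    by (auto simp: real_sqrt_mult indicator_def)
  finally show ?thesis by (simp add: ennreal_leI)
qed

lemma integrable_kernel:
  assumes f: "f \<in> wspace W"
  shows "integrable (density_kernel p x) f"
proof -
  have "integrable (density_kernel p x) W"
    using W_meas W_pos less_le_trans le_less_trans[OF kernel_W[of x]]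
    by (intro integrableI_nonneg) (auto simp: less_imp_le)
  moreover obtain c where c: "\<And>x. \<bar>f x\<bar> \<le> c * W x" using wspace_bound[OF f] by blast
  ultimately show ?thesis
    using wspace_measurable[OF f] order_trans[OF c abs_ge_self]
    by (intro Bochner_Integration.integrable_bound[of _ "\<lambda>x. c * W x" f]) (auto)
qed

lemma integrable_stat:
  assumes f: "f \<in> wspace W"
  shows "integrable stat f"
proof -
  have "integrable stat V"
    using order_trans[OF zero_le_one V_ge1] stat_V by (intro integrableI_nonneg) (auto simp: le_less_trans)
  moreover obtain c where c: "0 \<le> c" "\<And>x. \<bar>f x\<bar> \<le> c * W x" using wspace_bound[OF f] by blast
  moreover have "W x \<le> V x" for x
    using mult_left_mono[OF W_ge1[of x], of "W x"] W_pos[of x] W_V(1)[of x] by simp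
  then have "\<bar>f x\<bar> \<le> \<bar>c * V x\<bar>" for x
    using order_trans[OF c(2)[of x] order_trans[OF mult_left_mono[OF _ c(1)] abs_ge_self]] by blast
  ultimately show ?thesis
    using wspace_measurable[OF f]
    by (intro Bochner_Integration.integrable_bound[of _ "\<lambda>x. c * V x" f]) auto
qed

lemma nn_integral_kernel_operator:
  assumes "f \<in> wspace W" "\<And>x. 0 \<le> f x"
  shows "(\<integral>\<^sup>+y. ennreal (f y) \<partial>density_kernel p x) = ennreal (P f x)"
  unfolding kernel_operator_def using assms by (intro nn_integral_eq_integral integrable_kernel) auto

lemma P_W: "P W x \<le> sqrt lam * W x + sqrt b * indicator C x"
  using kernel_W[of x] lam b W_pos[of x] unfolding nn_integral_kernel_operator[OF wspace_self less_imp_le[OF W_pos]]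
  by (subst (asm) ennreal_le_iff) (auto simp: indicator_def less_imp_le)

lemma P_measurable:
  assumes [measurable]: "f \<in> borel_measurable borel"
  shows "P f \<in> borel_measurable borel"
proof -
  have "P f = (\<lambda>x. \<integral>y. p x y * f y \<partial>lborel)"
    unfolding kernel_operator_def density_kernel_def
    using p_nonneg by (subst integral_density) auto
  also have "(\<lambda>x. \<integral>y. p x y * f y \<partial>lborel) \<in> borel_measurable borel" by measurable
  finally show ?thesis .
qed

sublocale positive_operator W P
proof
  fix f g x and a :: real assume f: "f \<in> wspace W"
  show "P f \<in> wspace W"
  proof -
    obtain c where c: "0 \<le> c" "\<And>x. \<bar>f x\<bar> \<le> c * W x" using wspace_bound[OF f] by blast
    show ?thesis
    proof (rule wspaceI)
      show "P f \<in> borel_measurable borel" by (rule P_measurable[OF wspace_measurable[OF f]])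
      fix x
      have "\<bar>P f x\<bar> \<le> (\<integral>y. \<bar>f y\<bar> \<partial>density_kernel p x)"
        unfolding kernel_operator_def by (rule integral_abs_bound)
      also have "\<dots> \<le> (\<integral>y. c * W y \<partial>density_kernel p x)"
        using c f by (intro integral_mono integrable_abs integrable_kernel wspace_scale wspace_self)
      also have "\<dots> = c * P W x" unfolding kernel_operator_def by simp
      also have "\<dots> \<le> c * ((sqrt lam + sqrt b) * W x)"
      proof (rule mult_left_mono)
        have "sqrt b * indicator C x \<le> sqrt b * W x"
          using b W_ge1[of x] by (intro mult_left_mono) (auto simp: indicator_def)
        then show "P W x \<le> (sqrt lam + sqrt b) * W x" using P_W[of x] by (simp add: algebra_simps)
      qed (rule c)
      finally show "\<bar>P f x\<bar> \<le> (c * (sqrt lam + sqrt b)) * W x" by (simp add: mult.assoc)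
    qed
  qed
  show "P (\<lambda>x. a * f x) = (\<lambda>x. a * P f x)"
    unfolding kernel_operator_def by simp
  { assume "g \<in> wspace W"
    then show "P (\<lambda>x. f x + g x) = (\<lambda>x. P f x + P g x)"
      unfolding kernel_operator_def by (simp add: integrable_kernel f) }
  { assume "\<And>x. 0 \<le> f x"
    then show "0 \<le> P f x"
      unfolding kernel_operator_def by (intro Bochner_Integration.integral_nonneg) }
qed

section \<open>Iterated kernels and the potential of centred functions\<close>

lemma kernel_pow_measurable: "kernel_pow borel (density_kernel p) n \<in> borel \<rightarrow>\<^sub>M subprob_algebra borel"
proof (induction n)
  case 0
  have "kernel_pow borel (density_kernel p) 0 = return borel" by auto
  then show ?case by (simp only: return_measurable)
next
  case (Suc n)
  have "kernel_pow borel (density_kernel p) (Suc n) = (\<lambda>x. bind (density_kernel p x) (kernel_pow borel (density_kernel p) n))"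
    by auto
  then show ?case using measurable_bind2[OF kernel_measurable Suc] by simp
qed

text \<open>Small sets speak of iterated measures, the operator calculus of powers of
  \<open>P\<close>; this is the bridge. Both recursions split off the first step, so the induction
  runs over all starting points.\<close>

lemma nn_integral_kernel_pow:
  assumes f: "f \<in> wspace W" "\<And>x. 0 \<le> f x"
  shows "(\<integral>\<^sup>+y. ennreal (f y) \<partial>kernel_pow borel (density_kernel p) n x) = ennreal ((P ^^ n) f x)"
proof (induction n arbitrary: x)
  case 0
  then show ?case using wspace_measurable[OF f(1)] by (simp add: nn_integral_return)
next
  case (Suc n)
  have "(\<integral>\<^sup>+y. ennreal (f y) \<partial>kernel_pow borel (density_kernel p) (Suc n) x)
     = (\<integral>\<^sup>+z. (\<integral>\<^sup>+y. ennreal (f y) \<partial>kernel_pow borel (density_kernel p) n z) \<partial>density_kernel p x)"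
    unfolding kernel_pow.simps using wspace_measurable[OF f(1)]
    by (intro nn_integral_bind[where B = borel])
      (auto simp: measurable_cong_sets[OF sets_kernel refl] kernel_pow_measurable)
  also have "\<dots> = ennreal (P ((P ^^ n) f) x)"
    unfolding Suc using f
    by (intro nn_integral_kernel_operator funpow_closed positive_operator.op_nonneg[OF positive_operator_funpow])
  finally show ?case by simp
qed

lemma P_one: "P (\<lambda>x. 1) = (\<lambda>x. 1)"
  unfolding kernel_operator_def using prob_space.prob_space[OF prob_space_kernel] by simp

text \<open>For nonnegative functions this is Tonelli together with the invariance of the density. A
  general \<open>f\<close> is made nonnegative by adding \<open>c * W\<close>, with \<open>c\<close>
  its weighted bound.\<close>

lemma stat_P:
  assumes f: "f \<in> wspace W"
  shows "(\<integral>x. P f x \<partial>stat) = (\<integral>x. f x \<partial>stat)"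
proof -
  have pos: "(\<integral>x. P g x \<partial>stat) = (\<integral>x. g x \<partial>stat)" if g: "g \<in> wspace W" and g0: "\<And>x. 0 \<le> g x" for g
  proof -
    have "ennreal (\<integral>x. P g x \<partial>stat) = (\<integral>\<^sup>+x. ennreal (P g x) \<partial>stat)"
      using g g0 by (intro nn_integral_eq_integral[symmetric] integrable_stat op_closed) (auto intro: op_nonneg)
    also have "\<dots> = (\<integral>\<^sup>+x. ennreal (g x) \<partial>stat)"
      using stat_kernel[of "\<lambda>x. ennreal (g x)"] wspace_measurable[OF g]
      by (simp add: nn_integral_kernel_operator[OF g g0])
    also have "\<dots> = ennreal (\<integral>x. g x \<partial>stat)"
      using g g0 by (intro nn_integral_eq_integral integrable_stat) auto
    finally show ?thesis
      using g0 op_nonneg[OF g g0] by (simp add: Bochner_Integration.integral_nonneg)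
  qed
  obtain c where c: "0 \<le> c" "\<And>x. \<bar>f x\<bar> \<le> c * W x" using wspace_bound[OF f] by blast
  have cW: "(\<lambda>x. c * W x) \<in> wspace W" by (intro wspace_scale wspace_self)
  have "(\<integral>x. P (\<lambda>x. f x + c * W x) x \<partial>stat) = (\<integral>x. f x + c * W x \<partial>stat)"
    using c(2) by (intro pos wspace_add f cW) (smt (verit))
  moreover have "(\<integral>x. P (\<lambda>x. c * W x) x \<partial>stat) = (\<integral>x. c * W x \<partial>stat)"
    using c(1) W_pos by (intro pos cW) (auto simp: less_imp_le)
  moreover have "(\<integral>x. P (\<lambda>x. f x + c * W x) x \<partial>stat) = (\<integral>x. P f x \<partial>stat) + (\<integral>x. P (\<lambda>x. c * W x) x \<partial>stat)"
    unfolding op_add[OF f cW] by (intro Bochner_Integration.integral_add integrable_stat op_closed f cW)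
  moreover have "(\<integral>x. f x + c * W x \<partial>stat) = (\<integral>x. f x \<partial>stat) + (\<integral>x. c * W x \<partial>stat)"
    by (intro Bochner_Integration.integral_add integrable_stat f cW)
  ultimately show ?thesis by linarith
qed

theorem potential_bound:
  obtains D where "0 \<le> D"
    "\<And>f c n x. f \<in> borel_measurable borel \<Longrightarrow> (\<And>x. \<bar>f x\<bar> \<le> c * W x) \<Longrightarrow> (\<integral>x. f x \<partial>stat) = 0 \<Longrightarrow>
       \<bar>\<Sum>k<n. (P ^^ k) f x\<bar> \<le> D * c * W x"
proof -
  obtain m \<nu> where nu_sets: "sets \<nu> = sets borel" and nu_pos: "emeasure \<nu> (space borel) > 0"
    and nu_le: "\<And>x B. x \<in> C \<Longrightarrow> B \<in> sets borel \<Longrightarrow> emeasure \<nu> B \<le> emeasure (kernel_pow borel (density_kernel p) m x) B"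
    using small unfolding small_set_def by blast
  have nu_int: "(\<integral>\<^sup>+y. ennreal (f y) \<partial>\<nu>) \<le> ennreal ((P ^^ m) f x)"
    if "f \<in> wspace W" "\<And>x. 0 \<le> f x" "x \<in> C" for f x
  proof -
    have s: "sets (kernel_pow borel (density_kernel p) m x) = sets borel"
      using measurable_space[OF kernel_pow_measurable] by (auto simp: space_subprob_algebra)
    have "(\<integral>\<^sup>+y. ennreal (f y) \<partial>\<nu>) \<le> (\<integral>\<^sup>+y. ennreal (f y) \<partial>kernel_pow borel (density_kernel p) m x)"
      using nu_le[OF that(3)] s nu_sets by (intro nn_integral_mono_measure) (auto simp: le_measure)
    then show ?thesis using nn_integral_kernel_pow[OF that(1,2)] by simp
  qed
  \<comment> \<open>Comparison with the iterated kernel at this one point of \<open>C\<close> shows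
    that \<open>\<nu>\<close> integrates \<open>W\<close>, hence every function in
    \<open>wspace W\<close>.\<close>
  obtain y0 where y0: "y0 \<in> C" using C_nonempty by blast
  have nu_meas: "borel_measurable \<nu> = borel_measurable borel" using nu_sets by (intro measurable_cong_sets) auto
  have nu_integrable: "integrable \<nu> f" if f: "f \<in> wspace W" for f
  proof -
    have "integrable \<nu> W"
      using W_meas W_pos nu_int[OF wspace_self less_imp_le[OF W_pos] y0] nu_meas
      by (intro integrableI_nonneg) (auto simp: less_imp_le intro: le_less_trans)
    moreover obtain c where c: "\<And>x. \<bar>f x\<bar> \<le> c * W x" using wspace_bound[OF f] by blast
    ultimately show ?thesis
      using wspace_measurable[OF f] order_trans[OF c abs_ge_self] nu_meas
      by (intro Bochner_Integration.integrable_bound[of _ "\<lambda>x. c * W x" f]) auto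
  qed
  have nu_eq: "ennreal (\<integral>x. f x \<partial>\<nu>) = (\<integral>\<^sup>+x. ennreal (f x) \<partial>\<nu>)" if "f \<in> wspace W" "\<And>x. 0 \<le> f x" for f
    using that by (intro nn_integral_eq_integral[symmetric] nu_integrable) auto
  interpret D: drift_operator W P "\<lambda>f. \<integral>x. f x \<partial>\<nu>" "\<lambda>f. \<integral>x. f x \<partial>stat" C m "sqrt lam" "sqrt b"
  proof
    fix f g :: "real \<Rightarrow> real" and a :: real and x
    assume f: "f \<in> wspace W"
    show "(\<integral>x. a * f x \<partial>\<nu>) = a * (\<integral>x. f x \<partial>\<nu>)" "(\<integral>x. a * f x \<partial>stat) = a * (\<integral>x. f x \<partial>stat)" by simp_all
    show "(\<integral>x. P f x \<partial>stat) = (\<integral>x. f x \<partial>stat)" by (rule stat_P[OF f])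
    { assume g: "g \<in> wspace W"
      show "(\<integral>x. f x + g x \<partial>\<nu>) = (\<integral>x. f x \<partial>\<nu>) + (\<integral>x. g x \<partial>\<nu>)"
        by (intro Bochner_Integration.integral_add nu_integrable f g)
      show "(\<integral>x. f x + g x \<partial>stat) = (\<integral>x. f x \<partial>stat) + (\<integral>x. g x \<partial>stat)"
        by (intro Bochner_Integration.integral_add integrable_stat f g) }
    { assume f0: "\<And>x. 0 \<le> f x"
      then show "0 \<le> (\<integral>x. f x \<partial>\<nu>)" "0 \<le> (\<integral>x. f x \<partial>stat)" by (simp_all add: Bochner_Integration.integral_nonneg)
      assume "x \<in> C"
      then have "ennreal (\<integral>x. f x \<partial>\<nu>) \<le> ennreal ((P ^^ m) f x)"
        unfolding nu_eq[OF f f0] by (rule nu_int[OF f f0])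
      then show "(\<integral>x. f x \<partial>\<nu>) \<le> (P ^^ m) f x"
        using positive_operator.op_nonneg[OF positive_operator_funpow f f0] by (simp add: ennreal_le_iff) }
  next
    show "P (\<lambda>x. 1) = (\<lambda>x. 1)" by (rule P_one)
    show "P W x \<le> sqrt lam * W x + sqrt b * indicat_real C x" for x by (rule P_W)
    show "0 < (\<integral>x. (1::real) \<partial>stat)" 
    proof -
      interpret S: prob_space stat by (rule prob_space_stat)
      show ?thesis using S.prob_space by (simp del: space_density)
    qed
    have "0 < (\<integral>\<^sup>+x. ennreal 1 \<partial>\<nu>)" using nu_pos sets_eq_imp_space_eq[OF nu_sets] by simp
    then show "0 < (\<integral>x. (1::real) \<partial>\<nu>)" using nu_eq[OF wspace_const[of 1]] by (auto simp: less_le)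
  qed (use lam b C_sets in auto)
  show thesis using D.poisson_bound that by metis
qed

end

section \<open>The Markov property of the regression chain\<close>

locale regression_model = drift_chain p \<pi> V lam b C + prob_space M
  for p :: "real \<Rightarrow> real \<Rightarrow> real" and \<pi> V :: "real \<Rightarrow> real" and lam b :: real and C :: "real set"
    and M :: "'w measure" +
  fixes X \<epsilon> :: "nat \<Rightarrow> 'w \<Rightarrow> real" and q :: "real \<Rightarrow> real \<Rightarrow> real" and \<mu> :: "real \<Rightarrow> real"
  assumes chain: "regression_chain M X \<epsilon> p q \<mu>"
    and mu_V: "(\<integral>\<^sup>+x. ennreal (V x * \<mu> x) \<partial>lborel) < \<infinity>"
begin

abbreviation "Z \<equiv> \<lambda>k \<omega>. (X k \<omega>, \<epsilon> k \<omega>)"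

lemma X_meas [measurable]: "X i \<in> borel_measurable M" and eps_meas [measurable]: "\<epsilon> i \<in> borel_measurable M"
  using chain unfolding regression_chain_def by blast+

lemma Z_meas [measurable]: "Z i \<in> M \<rightarrow>\<^sub>M borel \<Otimes>\<^sub>M borel"
  by measurable

lemma q: "transition_density q"
  using chain unfolding regression_chain_def by blast

lemma q_dens: "prob_density (q x)"
  using q unfolding transition_density_def by blast

lemma q_meas [measurable]: "(\<lambda>(x, y). q x y) \<in> borel_measurable (borel \<Otimes>\<^sub>M borel)"
  using q unfolding transition_density_def by blast

lemma q_meas1 [measurable]: "q x \<in> borel_measurable borel"
  using q_dens unfolding prob_density_def by blast

lemma q_nonneg: "0 \<le> q x y"
  using q_dens unfolding prob_density_def by blast

lemma prob_space_noise: "prob_space (density_kernel q x)"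
  unfolding density_kernel_def by (rule prob_space_density_lborel[OF q_dens])

lemma sets_noise [simp, measurable_cong]: "sets (density_kernel q x) = sets borel"
  unfolding density_kernel_def by simp

lemma nn_integral_noise:
  assumes [measurable]: "f \<in> borel_measurable borel"
  shows "(\<integral>\<^sup>+e. f e \<partial>density_kernel q x) = (\<integral>\<^sup>+e. ennreal (q x e) * f e \<partial>lborel)"
  unfolding density_kernel_def by (subst nn_integral_density) auto

lemma measurable_nn_integral_noise [measurable]:
  assumes [measurable]: "\<phi> \<in> borel_measurable (borel \<Otimes>\<^sub>M borel)"
  shows "(\<lambda>x. \<integral>\<^sup>+e. \<phi> (x, e) \<partial>density_kernel q x) \<in> borel_measurable borel"
proof -
  have [measurable]: "(\<lambda>e. \<phi> (x, e)) \<in> borel_measurable borel" for x by measurable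
  have [measurable]: "\<phi> \<in> borel_measurable (borel \<Otimes>\<^sub>M lborel)"
    using assms by (simp cong: measurable_cong_sets add: sets_pair_measure_cong[OF refl sets_lborel])
  show ?thesis unfolding nn_integral_noise[OF \<open>(\<lambda>e. \<phi> (_, e)) \<in> borel_measurable borel\<close>] by measurable
qed

section \<open>The Markov property for pairs of times\<close>

definition joint_kernel :: "real \<Rightarrow> (real \<times> real) measure" where
  "joint_kernel x = density (lborel \<Otimes>\<^sub>M lborel) (\<lambda>(z, e). ennreal (p x z) * ennreal (q z e))"

lemma sets_joint [simp, measurable_cong]: "sets (joint_kernel x) = sets (borel \<Otimes>\<^sub>M borel)"
  unfolding joint_kernel_def by (simp add: sets_pair_measure_cong[OF sets_lborel sets_lborel])

lemma nn_integral_joint: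
  assumes [measurable]: "\<phi> \<in> borel_measurable (borel \<Otimes>\<^sub>M borel)"
  shows "(\<integral>\<^sup>+y. \<phi> y \<partial>joint_kernel x) = (\<integral>\<^sup>+z. (\<integral>\<^sup>+e. \<phi> (z, e) \<partial>density_kernel q z) \<partial>density_kernel p x)"
proof -
  have [measurable]: "\<phi> \<in> borel_measurable (lborel \<Otimes>\<^sub>M lborel)"
    using assms by (simp cong: measurable_cong_sets add: sets_pair_measure_cong[OF sets_lborel sets_lborel])
  have [measurable]: "(\<lambda>e. \<phi> (z, e)) \<in> borel_measurable borel" for z by measurable
  have "(\<integral>\<^sup>+y. \<phi> y \<partial>joint_kernel x)
      = (\<integral>\<^sup>+y. (case y of (z, e) \<Rightarrow> ennreal (p x z) * ennreal (q z e)) * \<phi> y \<partial>(lborel \<Otimes>\<^sub>M lborel))"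
    unfolding joint_kernel_def by (subst nn_integral_density) auto
  also have "\<dots> = (\<integral>\<^sup>+z. (\<integral>\<^sup>+e. ennreal (p x z) * (ennreal (q z e) * \<phi> (z, e)) \<partial>lborel) \<partial>lborel)"
    by (subst lborel.nn_integral_fst[symmetric]) (auto simp: mult.assoc)
  also have "\<dots> = (\<integral>\<^sup>+z. ennreal (p x z) * (\<integral>\<^sup>+e. \<phi> (z, e) \<partial>density_kernel q z) \<partial>lborel)"
    by (intro nn_integral_cong) (simp add: nn_integral_noise nn_integral_cmult)
  also have "\<dots> = (\<integral>\<^sup>+z. (\<integral>\<^sup>+e. \<phi> (z, e) \<partial>density_kernel q z) \<partial>density_kernel p x)"
    by (rule nn_integral_kernel[symmetric]) measurable
  finally show ?thesis .
qed

lemma joint_measurable: "joint_kernel \<in> borel \<rightarrow>\<^sub>M subprob_algebra (borel \<Otimes>\<^sub>M borel)"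
proof (rule measurable_subprob_algebra)
  show "subprob_space (joint_kernel x)" for x
  proof
    have "emeasure (joint_kernel x) (space (joint_kernel x)) = (\<integral>\<^sup>+y. 1 \<partial>joint_kernel x)" by simp
    also have "\<dots> = 1"
      by (subst nn_integral_joint) (simp_all only: prob_space.nn_integral_const_1[OF prob_space_noise]
        prob_space.nn_integral_const_1[OF prob_space_kernel] borel_measurable_const)
    finally show "emeasure (joint_kernel x) (space (joint_kernel x)) \<le> 1" by simp
    show "space (joint_kernel x) \<noteq> {}" unfolding joint_kernel_def by (simp add: space_pair_measure)
  qed
  show "(\<lambda>x. emeasure (joint_kernel x) A) \<in> borel_measurable borel" if [measurable]: "A \<in> sets (borel \<Otimes>\<^sub>M borel)" for A
  proof -
    have "emeasure (joint_kernel x) A = (\<integral>\<^sup>+z. (\<integral>\<^sup>+e. indicator A (z, e) \<partial>density_kernel q z) \<partial>density_kernel p x)" for x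
      using nn_integral_joint[of "indicator A" x] that by simp
    then show ?thesis by simp
  qed
qed simp

text \<open>The hypothesis on the chain is an almost sure identity for conditional expectations of
  rectangles. Integrating it over an event of \<open>Z i\<close> with \<open>i < n\<close>, which
  belongs to the past sigma-algebra, turns it into an identity of plain integrals. Events of one
  past time suffice, since only pair correlations are computed.\<close>

lemma conditional_rectangle:
  assumes i: "i < n" and S: "S \<in> sets (borel \<Otimes>\<^sub>M borel)" and A: "A \<in> sets borel" and B: "B \<in> sets borel"
  shows "(\<integral>\<^sup>+\<omega>. indicator S (Z i \<omega>) * indicator (A \<times> B) (Z n \<omega>) \<partial>M)
    = (\<integral>\<^sup>+\<omega>. indicator S (Z i \<omega>) * emeasure (joint_kernel (X (n - 1) \<omega>)) (A \<times> B) \<partial>M)"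
proof -
  let ?F = "past_algebra M Z n"
  let ?E = "{\<omega> \<in> space M. X n \<omega> \<in> A \<and> \<epsilon> n \<omega> \<in> B}"
  define D where "D = Z i -` S \<inter> space M"
  define k where "k = (\<lambda>x. LINT z:A|lborel. p x z * (LINT e:B|lborel. q z e))"
  note [measurable] = S A B
  have gen: "(\<Union>k<n. {Z k -` A \<inter> space M | A. A \<in> sets borel}) \<subseteq> sets M"
    using measurable_sets[OF Z_meas] by (auto simp: borel_prod)
  have sub: "subalgebra M ?F"
    unfolding past_algebra_def subalgebra_def
    by (simp add: space_measure_of_conv sets_measure_of[OF subset_trans[OF gen sets.space_closed]]
      sets.sigma_sets_subset[OF gen])
  interpret F: finite_measure_subalgebra M ?F
    using sub by unfold_locales
  have D_F: "D \<in> sets ?F"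
    unfolding past_algebra_def D_def
    using i S[unfolded borel_prod] by (subst sets_measure_of[OF subset_trans[OF gen sets.space_closed]]) blast+
  have D_M [measurable]: "D \<in> sets M" unfolding D_def by measurable
  have E_M [measurable]: "?E \<in> sets M" by measurable
  have cond: "AE \<omega> in M. real_cond_exp M ?F (indicator ?E) \<omega> = k (X (n - 1) \<omega>)"
    using chain i A B unfolding regression_chain_def k_def by auto
  have noise: "(LINT e:B|lborel. q z e) = measure (density_kernel q z) B" for z
  proof -
    interpret Q: prob_space "density_kernel q z" by (rule prob_space_noise)
    have "measure (density_kernel q z) B = (\<integral>e. indicator B e \<partial>density_kernel q z)"
      by simp
    also have "\<dots> = (LINT e:B|lborel. q z e)"
      unfolding density_kernel_def set_lebesgue_integral_def
      using q_nonneg by (subst integral_density) (auto simp: mult.commute)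
    finally show ?thesis ..
  qed
  have [measurable]: "(\<lambda>z. measure (density_kernel q z) B) \<in> borel_measurable borel"
    using measurable_nn_integral_noise[of "\<lambda>y. indicator B (snd y)"] unfolding measure_def by simp
  have k_eq: "k x = (\<integral>z. indicator A z * measure (density_kernel q z) B \<partial>density_kernel p x)" for x
    unfolding k_def noise unfolding set_lebesgue_integral_def density_kernel_def[of p]
    using p_nonneg by (subst integral_density) (auto simp: mult_ac)
  have k_nn: "ennreal (k x) = emeasure (joint_kernel x) (A \<times> B)" and k01: "0 \<le> k x" "k x \<le> 1" for x
  proof -
    interpret K: prob_space "density_kernel p x" by (rule prob_space_kernel)
    have int: "integrable (density_kernel p x) (\<lambda>z. indicator A z * measure (density_kernel q z) B)"
      by (intro K.integrable_const_bound[of _ 1])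
        (auto simp: indicator_def prob_space.prob_le_1[OF prob_space_noise])
    have "ennreal (k x) = (\<integral>\<^sup>+z. ennreal (indicator A z * measure (density_kernel q z) B) \<partial>density_kernel p x)"
      unfolding k_eq using int by (intro nn_integral_eq_integral[symmetric]) auto
    also have "\<dots> = (\<integral>\<^sup>+z. (\<integral>\<^sup>+e. indicator (A \<times> B) (z, e) \<partial>density_kernel q z) \<partial>density_kernel p x)"
    proof (rule nn_integral_cong)
      fix z
      interpret Q: prob_space "density_kernel q z" by (rule prob_space_noise)
      have "(\<integral>\<^sup>+e. indicator (A \<times> B) (z, e) \<partial>density_kernel q z) = (\<integral>\<^sup>+e. indicator A z * indicator B e \<partial>density_kernel q z)"
        by (intro nn_integral_cong) (auto simp: indicator_def)
      then show "ennreal (indicator A z * measure (density_kernel q z) B) = (\<integral>\<^sup>+e. indicator (A \<times> B) (z, e) \<partial>density_kernel q z)"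
        by (simp add: nn_integral_cmult Q.emeasure_eq_measure ennreal_mult' ennreal_indicator)
    qed
    also have "\<dots> = (\<integral>\<^sup>+y. indicator (A \<times> B) y \<partial>joint_kernel x)"
      by (subst nn_integral_joint) auto
    also have "\<dots> = emeasure (joint_kernel x) (A \<times> B)" by simp
    finally show "ennreal (k x) = emeasure (joint_kernel x) (A \<times> B)" .
    show "0 \<le> k x" unfolding k_eq by simp
    have "k x \<le> (\<integral>z. 1 \<partial>density_kernel p x)"
      unfolding k_eq using int
      by (intro integral_mono) (auto simp: indicator_def prob_space.prob_le_1[OF prob_space_noise])
    then show "k x \<le> 1" using K.prob_space by simp
  qed
  have k_meas [measurable]: "k \<in> borel_measurable borel"
    unfolding k_eq using P_measurable[of "\<lambda>z. indicator A z * measure (density_kernel q z) B"]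
    unfolding kernel_operator_def by (simp add: k_eq[symmetric])
  have int_k: "integrable M (\<lambda>\<omega>. indicator D \<omega> * k (X (n - 1) \<omega>))"
    using k01 by (intro integrable_const_bound[of _ 1]) (auto simp: indicator_def)
  have "(\<integral>\<^sup>+\<omega>. indicator S (Z i \<omega>) * indicator (A \<times> B) (Z n \<omega>) \<partial>M) = (\<integral>\<^sup>+\<omega>. indicator (D \<inter> ?E) \<omega> \<partial>M)"
    by (intro nn_integral_cong) (auto simp: D_def indicator_def)
  also have "\<dots> = ennreal (measure M (D \<inter> ?E))"
    by (simp add: emeasure_eq_measure)
  also have "measure M (D \<inter> ?E) = (\<integral>\<omega>\<in>D. indicator ?E \<omega> \<partial>M)"
    unfolding set_lebesgue_integral_def
    by (simp add: indicator_inter_arith[symmetric])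
  also have "\<dots> = (\<integral>\<omega>\<in>D. real_cond_exp M ?F (indicator ?E) \<omega> \<partial>M)"
    by (intro F.real_cond_exp_intA D_F) (auto simp: emeasure_eq_measure)
  also have "\<dots> = (\<integral>\<omega>. indicator D \<omega> * k (X (n - 1) \<omega>) \<partial>M)"
    unfolding set_lebesgue_integral_def
    using cond by (intro integral_cong_AE) auto
  also have "ennreal \<dots> = (\<integral>\<^sup>+\<omega>. ennreal (indicator D \<omega> * k (X (n - 1) \<omega>)) \<partial>M)"
    using k01 by (intro nn_integral_eq_integral[symmetric] int_k) auto
  also have "\<dots> = (\<integral>\<^sup>+\<omega>. indicator S (Z i \<omega>) * emeasure (joint_kernel (X (n - 1) \<omega>)) (A \<times> B) \<partial>M)"
    by (intro nn_integral_cong) (auto simp: D_def indicator_def k_nn)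
  finally show ?thesis .
qed

text \<open>Both sides are integrals of \<open>\<phi>\<close> against finite measures on the plane:
  the law of \<open>Z n\<close> restricted to the event that \<open>Z i\<close> is in
  \<open>S\<close>, and the law of \<open>X (n - 1)\<close> restricted to it and pushed through
  \<open>joint_kernel\<close>. They agree on rectangles, an intersection-stable generator.\<close>

lemma markov_indicator:
  assumes i: "i < n" and S [measurable]: "S \<in> sets (borel \<Otimes>\<^sub>M borel)"
    and \<phi> [measurable]: "\<phi> \<in> borel_measurable (borel \<Otimes>\<^sub>M borel)"
  shows "(\<integral>\<^sup>+\<omega>. indicator S (Z i \<omega>) * \<phi> (Z n \<omega>) \<partial>M)
    = (\<integral>\<^sup>+\<omega>. indicator S (Z i \<omega>) * (\<integral>\<^sup>+y. \<phi> y \<partial>joint_kernel (X (n - 1) \<omega>)) \<partial>M)"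
proof -
  let ?D = "density M (\<lambda>\<omega>. indicator S (Z i \<omega>))"
  let ?N1 = "distr ?D (borel \<Otimes>\<^sub>M borel) (Z n)"
  let ?N2 = "bind (distr ?D borel (X (n - 1))) joint_kernel"
  note [measurable] = joint_measurable
  have N1: "(\<integral>\<^sup>+y. f y \<partial>?N1) = (\<integral>\<^sup>+\<omega>. indicator S (Z i \<omega>) * f (Z n \<omega>) \<partial>M)"
    if [measurable]: "f \<in> borel_measurable (borel \<Otimes>\<^sub>M borel)" for f
    by (simp add: nn_integral_distr nn_integral_density)
  have N2: "(\<integral>\<^sup>+y. f y \<partial>?N2) = (\<integral>\<^sup>+\<omega>. indicator S (Z i \<omega>) * (\<integral>\<^sup>+y. f y \<partial>joint_kernel (X (n - 1) \<omega>)) \<partial>M)"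
    if [measurable]: "f \<in> borel_measurable (borel \<Otimes>\<^sub>M borel)" for f
  proof -
    have [measurable]: "(\<lambda>x. \<integral>\<^sup>+y. f y \<partial>joint_kernel x) \<in> borel_measurable borel"
      unfolding nn_integral_joint[OF that] by measurable
    have "(\<integral>\<^sup>+y. f y \<partial>?N2) = (\<integral>\<^sup>+x. (\<integral>\<^sup>+y. f y \<partial>joint_kernel x) \<partial>distr ?D borel (X (n - 1)))"
      by (intro nn_integral_bind[where B = "borel \<Otimes>\<^sub>M borel"]) measurable
    then show ?thesis by (simp add: nn_integral_distr nn_integral_density)
  qed
  have sets2: "sets ?N2 = sets (borel \<Otimes>\<^sub>M borel)"
    by (rule sets_bind[OF sets_joint]) simp
  have eq: "emeasure ?N1 (A \<times> B) = emeasure ?N2 (A \<times> B)" if [measurable]: "A \<in> sets borel" "B \<in> sets borel" for A B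
  proof -
    have "emeasure ?N1 (A \<times> B) = (\<integral>\<^sup>+y. indicator (A \<times> B) y \<partial>?N1)" by simp
    also have "\<dots> = (\<integral>\<^sup>+\<omega>. indicator S (Z i \<omega>) * emeasure (joint_kernel (X (n - 1) \<omega>)) (A \<times> B) \<partial>M)"
      by (subst N1) (simp_all add: conditional_rectangle[OF i S])
    also have "\<dots> = (\<integral>\<^sup>+y. indicator (A \<times> B) y \<partial>?N2)"
      by (subst N2) simp_all
    also have "\<dots> = emeasure ?N2 (A \<times> B)"
      using sets2 by (intro nn_integral_indicator) auto
    finally show ?thesis .
  qed
  have "?N1 = ?N2"
  proof (rule measure_eqI_generator_eq[OF Int_stable_pair_measure_generator[of borel borel], where A = "\<lambda>_. UNIV"])
    show "sets ?N1 = sigma_sets UNIV {a \<times> b |a b. a \<in> sets borel \<and> b \<in> sets borel}"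
      by (simp add: sets_pair_measure)
    then show "sets ?N2 = sigma_sets UNIV {a \<times> b |a b. a \<in> sets borel \<and> b \<in> sets borel}"
      using sets2 by simp
    show "emeasure ?N1 X = emeasure ?N2 X" if "X \<in> {a \<times> b |a b. a \<in> sets borel \<and> b \<in> sets borel}" for X
      using that eq by blast
    show "range (\<lambda>_. UNIV) \<subseteq> {a \<times> b |a b. a \<in> sets borel \<and> b \<in> sets borel}"
      by (auto intro!: exI[of _ UNIV])
    show "emeasure ?N1 UNIV \<noteq> \<infinity>"
    proof -
      have "emeasure ?N1 UNIV = (\<integral>\<^sup>+\<omega>. indicator S (Z i \<omega>) * 1 \<partial>M)"
        using N1[of "\<lambda>_. 1"] by (simp add: space_pair_measure)
      also have "\<dots> \<le> (\<integral>\<^sup>+\<omega>. 1 \<partial>M)" by (intro nn_integral_mono) (auto simp: indicator_def)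
      also have "\<dots> = 1" by (rule nn_integral_const_1)
      finally show ?thesis by (auto simp: top_unique)
    qed
  qed auto
  then show ?thesis using N1[OF \<phi>] N2[OF \<phi>] by simp
qed

text \<open>The argument is repeated in the other variable: with \<open>\<phi>\<close> fixed, both
  sides integrate \<open>u\<close> against image measures under \<open>Z i\<close>. These agree on
  every measurable set by \<open>markov_indicator\<close>, not merely on a generator, so infinite
  mass does no harm.\<close>

lemma markov:
  assumes i: "i < n" and u [measurable]: "u \<in> borel_measurable (borel \<Otimes>\<^sub>M borel)"
    and \<phi> [measurable]: "\<phi> \<in> borel_measurable (borel \<Otimes>\<^sub>M borel)"
  shows "(\<integral>\<^sup>+\<omega>. u (Z i \<omega>) * \<phi> (Z n \<omega>) \<partial>M)
    = (\<integral>\<^sup>+\<omega>. u (Z i \<omega>) * (\<integral>\<^sup>+z. (\<integral>\<^sup>+e. \<phi> (z, e) \<partial>density_kernel q z) \<partial>density_kernel p (X (n - 1) \<omega>)) \<partial>M)"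
proof -
  define \<Phi> where "\<Phi> = (\<lambda>x. \<integral>\<^sup>+z. (\<integral>\<^sup>+e. \<phi> (z, e) \<partial>density_kernel q z) \<partial>density_kernel p x)"
  have [measurable]: "\<Phi> \<in> borel_measurable borel" unfolding \<Phi>_def by measurable
  let ?N1 = "distr (density M (\<lambda>\<omega>. \<phi> (Z n \<omega>))) (borel \<Otimes>\<^sub>M borel) (Z i)"
  let ?N2 = "distr (density M (\<lambda>\<omega>. \<Phi> (X (n - 1) \<omega>))) (borel \<Otimes>\<^sub>M borel) (Z i)"
  have N1: "(\<integral>\<^sup>+y. f y \<partial>?N1) = (\<integral>\<^sup>+\<omega>. f (Z i \<omega>) * \<phi> (Z n \<omega>) \<partial>M)"
    if [measurable]: "f \<in> borel_measurable (borel \<Otimes>\<^sub>M borel)" for f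
    by (simp add: nn_integral_distr nn_integral_density mult.commute)
  have N2: "(\<integral>\<^sup>+y. f y \<partial>?N2) = (\<integral>\<^sup>+\<omega>. f (Z i \<omega>) * \<Phi> (X (n - 1) \<omega>) \<partial>M)"
    if [measurable]: "f \<in> borel_measurable (borel \<Otimes>\<^sub>M borel)" for f
    by (simp add: nn_integral_distr nn_integral_density mult.commute)
  have "?N1 = ?N2"
  proof (rule measure_eqI)
    fix S assume "S \<in> sets ?N1"
    then have S [measurable]: "S \<in> sets (borel \<Otimes>\<^sub>M borel)" by simp
    show "emeasure ?N1 S = emeasure ?N2 S"
      using N1[of "indicator S"] N2[of "indicator S"] markov_indicator[OF i S \<phi>]
      by (simp add: nn_integral_joint[OF \<phi>] \<Phi>_def)
  qed simp
  then show ?thesis using N1[OF u] N2[OF u] unfolding \<Phi>_def by simp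
qed

lemma markov_state:
  assumes "i < n" "u \<in> borel_measurable (borel \<Otimes>\<^sub>M borel)" and [measurable]: "F \<in> borel_measurable borel"
  shows "(\<integral>\<^sup>+\<omega>. u (Z i \<omega>) * F (X n \<omega>) \<partial>M)
    = (\<integral>\<^sup>+\<omega>. u (Z i \<omega>) * (\<integral>\<^sup>+z. F z \<partial>density_kernel p (X (n - 1) \<omega>)) \<partial>M)"
  using markov[OF assms(1,2), of "\<lambda>y. F (fst y)"]
  by (simp add: prob_space.emeasure_space_1[OF prob_space_noise])

text \<open>The noise is averaged out while \<open>X n\<close> stays: \<open>markov\<close> for
  \<open>\<phi>\<close> and \<open>markov_state\<close> for its noise average lead to the same
  integral over the step from \<open>X (n - 1)\<close>.\<close>

lemma markov_noise:
  assumes "i < n" "u \<in> borel_measurable (borel \<Otimes>\<^sub>M borel)" and [measurable]: "\<phi> \<in> borel_measurable (borel \<Otimes>\<^sub>M borel)"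
  shows "(\<integral>\<^sup>+\<omega>. u (Z i \<omega>) * \<phi> (Z n \<omega>) \<partial>M)
    = (\<integral>\<^sup>+\<omega>. u (Z i \<omega>) * (\<integral>\<^sup>+e. \<phi> (X n \<omega>, e) \<partial>density_kernel q (X n \<omega>)) \<partial>M)"
  using markov[OF assms] markov_state[OF assms(1,2), of "\<lambda>z. \<integral>\<^sup>+e. \<phi> (z, e) \<partial>density_kernel q z"] by simp

lemma markov_iterate:
  assumes u: "u \<in> borel_measurable (borel \<Otimes>\<^sub>M borel)" and "F \<in> wspace W" "\<And>x. 0 \<le> F x"
  shows "(\<integral>\<^sup>+\<omega>. u (Z i \<omega>) * ennreal (F (X (i + k) \<omega>)) \<partial>M)
    = (\<integral>\<^sup>+\<omega>. u (Z i \<omega>) * ennreal ((P ^^ k) F (X i \<omega>)) \<partial>M)"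
  using assms(2,3)
proof (induction k arbitrary: F)
  case (Suc k)
  have "(\<integral>\<^sup>+\<omega>. u (Z i \<omega>) * ennreal (F (X (i + Suc k) \<omega>)) \<partial>M)
    = (\<integral>\<^sup>+\<omega>. u (Z i \<omega>) * ennreal (P F (X (i + k) \<omega>)) \<partial>M)"
    using markov_state[OF _ u, of i "i + Suc k" "\<lambda>x. ennreal (F x)"] wspace_measurable[OF Suc.prems(1)]
    by (simp add: nn_integral_kernel_operator[OF Suc.prems])
  then show ?case
    using Suc.IH[of "P F"] Suc.prems op_closed op_nonneg by (simp add: funpow_swap1)
qed simp

lemma expectation_V:
  obtains B where "0 \<le> B" "\<And>n. (\<integral>\<^sup>+\<omega>. ennreal (V (X n \<omega>)) \<partial>M) \<le> ennreal B"
proof -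
  have V0: "0 \<le> V x" for x using V_ge1[of x] by linarith
  have mu: "prob_density \<mu>" "distributed M lborel (X 0) (\<lambda>x. ennreal (\<mu> x))"
    using chain unfolding regression_chain_def by blast+
  have mu0: "0 \<le> \<mu> x" for x using mu(1) unfolding prob_density_def by blast
  have "(\<integral>\<^sup>+\<omega>. ennreal (V (X 0 \<omega>)) \<partial>M) = (\<integral>\<^sup>+x. ennreal (\<mu> x) * ennreal (V x) \<partial>lborel)"
    using mu(2) by (intro distributed_nn_integral[symmetric]) auto
  also have "\<dots> = (\<integral>\<^sup>+x. ennreal (V x * \<mu> x) \<partial>lborel)"
    using V0 mu0 by (simp add: ennreal_mult mult.commute)
  finally have "(\<integral>\<^sup>+\<omega>. ennreal (V (X 0 \<omega>)) \<partial>M) < \<top>" using mu_V by simp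
  then obtain B0 where B0: "0 \<le> B0" "(\<integral>\<^sup>+\<omega>. ennreal (V (X 0 \<omega>)) \<partial>M) = ennreal B0"
    by (auto simp: less_top_ennreal)
  \<comment> \<open>Adding the fixed point \<open>b / (1 - lam)\<close> to the initial value gives a
    bound that the step from \<open>B\<close> to \<open>lam * B + b\<close> does not
    increase.\<close>
  define B where "B = B0 + b / (1 - lam)"
  have B: "0 \<le> B" "lam * B + b \<le> B"
  proof -
    show "0 \<le> B" unfolding B_def using B0 b lam by simp
    define t where "t = b / (1 - lam)"
    have "(1 - lam) * t = b" unfolding t_def using lam by simp
    then have "B - (lam * B + b) = (1 - lam) * B0" unfolding B_def t_def[symmetric] by (simp add: algebra_simps)
    then show "lam * B + b \<le> B" using B0 lam by (smt (verit) mult_nonneg_nonneg)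
  qed
  have "(\<integral>\<^sup>+\<omega>. ennreal (V (X n \<omega>)) \<partial>M) \<le> ennreal B" for n
  proof (induction n)
    case 0
    show ?case unfolding B0(2) B_def using b lam by (intro ennreal_leI) auto
  next
    case (Suc n)
    have "(\<integral>\<^sup>+\<omega>. ennreal (V (X (Suc n) \<omega>)) \<partial>M)
        = (\<integral>\<^sup>+\<omega>. (\<integral>\<^sup>+z. ennreal (V z) \<partial>density_kernel p (X n \<omega>)) \<partial>M)"
      using markov_state[of 0 "Suc n" "\<lambda>_. 1" "\<lambda>x. ennreal (V x)"] by simp
    also have "\<dots> \<le> (\<integral>\<^sup>+\<omega>. ennreal lam * ennreal (V (X n \<omega>)) + ennreal b \<partial>M)"
    proof (rule nn_integral_mono)
      fix \<omega>
      have "(\<integral>\<^sup>+z. ennreal (V z) \<partial>density_kernel p (X n \<omega>)) \<le> ennreal (lam * V (X n \<omega>) + b * indicator C (X n \<omega>))"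
        by (rule kernel_V)
      also have "\<dots> \<le> ennreal (lam * V (X n \<omega>) + b)" using b by (intro ennreal_leI) (auto simp: indicator_def)
      finally show "(\<integral>\<^sup>+z. ennreal (V z) \<partial>density_kernel p (X n \<omega>)) \<le> ennreal lam * ennreal (V (X n \<omega>)) + ennreal b"
        using lam b V0 by (simp add: ennreal_mult)
    qed
    also have "\<dots> = ennreal lam * (\<integral>\<^sup>+\<omega>. ennreal (V (X n \<omega>)) \<partial>M) + ennreal b"
      by (simp add: nn_integral_add nn_integral_cmult emeasure_space_1)
    also have "\<dots> \<le> ennreal lam * ennreal B + ennreal b"
      using Suc by (intro add_right_mono mult_left_mono) auto
    also have "\<dots> = ennreal (lam * B + b)" using lam b B(1) by (simp add: ennreal_mult)
    also have "\<dots> \<le> ennreal B" using B(2) by (rule ennreal_leI)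
    finally show ?case .
  qed
  then show thesis using that B(1) by blast
qed

section \<open>Variance of centred sums\<close>

definition noise_mean :: "(real \<times> real \<Rightarrow> real) \<Rightarrow> real \<Rightarrow> real" where
  "noise_mean g x = (\<integral>e. g (x, e) \<partial>density_kernel q x)"

definition stat_mean :: "(real \<times> real \<Rightarrow> real) \<Rightarrow> real" where
  "stat_mean g = (\<integral>x. noise_mean g x \<partial>stat)"

text \<open>The class over which variances are bounded uniformly: a single constant serves both
  moments and survives multiplication by indicators of the state. Extended integrals make
  integrability part of the condition.\<close>

definition dominated :: "real \<Rightarrow> (real \<times> real \<Rightarrow> real) \<Rightarrow> bool" where
  "dominated c g \<longleftrightarrow> g \<in> borel_measurable (borel \<Otimes>\<^sub>M borel) \<and> (\<forall>y. 0 \<le> g y) \<and>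
     (\<forall>x. (\<integral>\<^sup>+e. ennreal (g (x, e)) \<partial>density_kernel q x) \<le> ennreal (c * W x)) \<and>
     (\<forall>x. (\<integral>\<^sup>+e. ennreal ((g (x, e))\<^sup>2) \<partial>density_kernel q x) \<le> ennreal (c * V x))"

lemma dominatedD:
  assumes "dominated c g"
  shows "g \<in> borel_measurable (borel \<Otimes>\<^sub>M borel)" "0 \<le> g y"
    "(\<integral>\<^sup>+e. ennreal (g (x, e)) \<partial>density_kernel q x) \<le> ennreal (c * W x)"
    "(\<integral>\<^sup>+e. ennreal ((g (x, e))\<^sup>2) \<partial>density_kernel q x) \<le> ennreal (c * V x)"
  using assms unfolding dominated_def by blast+

lemma noise_mean:
  assumes g: "dominated c g" and c: "0 \<le> c"
  shows nn_noise_mean: "(\<integral>\<^sup>+e. ennreal (g (x, e)) \<partial>density_kernel q x) = ennreal (noise_mean g x)"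
    and noise_mean_nonneg: "0 \<le> noise_mean g x"
    and noise_mean_le: "noise_mean g x \<le> c * W x"
    and noise_mean_wspace: "noise_mean g \<in> wspace W"
proof -
  note [measurable] = dominatedD(1)[OF g]
  have int: "integrable (density_kernel q x) (\<lambda>e. g (x, e))" for x
    using dominatedD(2)[OF g] dominatedD(3)[OF g, of x] by (intro integrableI_nonneg) (auto intro: le_less_trans)
  show nn: "(\<integral>\<^sup>+e. ennreal (g (x, e)) \<partial>density_kernel q x) = ennreal (noise_mean g x)" for x
    unfolding noise_mean_def using int dominatedD(2)[OF g] by (intro nn_integral_eq_integral) auto
  show nonneg: "0 \<le> noise_mean g x" for x
    unfolding noise_mean_def using dominatedD(2)[OF g] by (intro Bochner_Integration.integral_nonneg)
  have cW: "0 \<le> c * W x" for x using c W_pos[of x] by (simp add: less_imp_le)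
  show le: "noise_mean g x \<le> c * W x" for x
    using dominatedD(3)[OF g, of x] cW[of x] unfolding nn by (simp add: ennreal_le_iff)
  have "noise_mean g = (\<lambda>x. enn2real (\<integral>\<^sup>+e. ennreal (g (x, e)) \<partial>density_kernel q x))"
    unfolding nn using nonneg by simp
  also have "\<dots> \<in> borel_measurable borel" by measurable
  finally have "noise_mean g \<in> borel_measurable borel" .
  then show "noise_mean g \<in> wspace W"
    using le nonneg by (intro wspaceI[of _ c]) auto
qed

text \<open>Conditioning at time \<open>i\<close> turns a covariance at lag \<open>k\<close> into
  the mean of \<open>\<xi> i\<close> times \<open>(P ^^ k) f (X i)\<close>, with \<open>f\<close>
  the centred noise mean. The sum over \<open>k\<close> is taken before estimating, so that the
  potential bound handles all lags at once. \<open>D\<close> depends on \<open>g\<close> only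
  through \<open>c\<close>.\<close>

lemma variance_bound:
  assumes c: "0 \<le> c"
  obtains D where "0 \<le> D"
    "\<And>g m n. dominated c g \<Longrightarrow> m \<le> n \<Longrightarrow>
       integrable M (\<lambda>\<omega>. (\<Sum>i\<in>{m<..n}. g (Z i \<omega>) - stat_mean g)\<^sup>2) \<and>
       (\<integral>\<omega>. (\<Sum>i\<in>{m<..n}. g (Z i \<omega>) - stat_mean g)\<^sup>2 \<partial>M) \<le> D * real (n - m)"
proof -
  obtain D0 where D0: "0 \<le> D0"
    "\<And>f a n x. f \<in> borel_measurable borel \<Longrightarrow> (\<And>x. \<bar>f x\<bar> \<le> a * W x) \<Longrightarrow> (\<integral>x. f x \<partial>stat) = 0 \<Longrightarrow>
       \<bar>\<Sum>k<n. (P ^^ k) f x\<bar> \<le> D0 * a * W x"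
    using potential_bound by metis
  obtain B where B: "0 \<le> B" "\<And>n. (\<integral>\<^sup>+\<omega>. ennreal (V (X n \<omega>)) \<partial>M) \<le> ennreal B"
    using expectation_V by blast
  have V0: "0 \<le> V x" for x using V_ge1[of x] by linarith
  have EV: "integrable M (\<lambda>\<omega>. V (X n \<omega>))" "(\<integral>\<omega>. V (X n \<omega>) \<partial>M) \<le> B" for n
  proof -
    show int: "integrable M (\<lambda>\<omega>. V (X n \<omega>))"
      using V0 le_less_trans[OF B(2) ennreal_less_top] by (intro integrableI_nonneg) auto
    show "(\<integral>\<omega>. V (X n \<omega>) \<partial>M) \<le> B"
      using B(2)[of n] V0 B(1) by (subst (asm) nn_integral_eq_integral[OF int]) auto
  qed
  have young: "\<bar>x * y\<bar> \<le> x\<^sup>2 + y\<^sup>2" for x y :: real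
  proof -
    have "0 \<le> (\<bar>x\<bar> - \<bar>y\<bar>)\<^sup>2 + (x\<^sup>2 + y\<^sup>2)" by simp
    then show ?thesis by (simp add: power2_diff abs_mult)
  qed
  \<comment> \<open>\<open>t\<close> bounds \<open>stat_mean g\<close>, \<open>a\<close> is the
    weighted bound of the centred noise mean, and \<open>e\<close> that of its potential without the
    term \<open>k = 0\<close>, whence \<open>D0 + 1\<close>. In \<open>D\<close>, the first part
    bounds a square and the second twice the product of one term with the sum of its
    successors.\<close>
  define t where "t = c * (\<integral>x. W x \<partial>stat)"
  define a where "a = c + t"
  define e where "e = (D0 + 1) * a"
  define D where "D = (c * B + t\<^sup>2) + 2 * (e * (c * B + B + t * B))"
  have t: "0 \<le> t" unfolding t_def using c W_pos by (intro mult_nonneg_nonneg Bochner_Integration.integral_nonneg) (auto simp: less_imp_le)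
  have ae: "0 \<le> a" "0 \<le> e" unfolding a_def e_def using c t D0 by auto
  have D: "0 \<le> D" unfolding D_def using c t B ae by auto
  { fix g assume g: "dominated c g"
    note [measurable] = dominatedD(1)[OF g]
    note g0 = dominatedD(2)[OF g]
    note gb_w = noise_mean_wspace[OF g c] and gb0 = noise_mean_nonneg[OF g c]
    define \<theta> where "\<theta> = stat_mean g"
    have \<theta>: "0 \<le> \<theta>" "\<theta> \<le> t"
    proof -
      show "0 \<le> \<theta>" unfolding \<theta>_def stat_mean_def using gb0 by (intro Bochner_Integration.integral_nonneg)
      have "\<theta> \<le> (\<integral>x. c * W x \<partial>stat)"
        unfolding \<theta>_def stat_mean_def
        using noise_mean_le[OF g c] by (intro integral_mono integrable_stat gb_w wspace_scale wspace_self)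
      then show "\<theta> \<le> t" unfolding t_def by simp
    qed
    define \<xi> where "\<xi> = (\<lambda>i \<omega>. g (Z i \<omega>) - \<theta>)"
    have [measurable]: "\<xi> i \<in> borel_measurable M" for i unfolding \<xi>_def by measurable
    \<comment> \<open>Times start at 1: from then on the law of the noise given the state is
      prescribed, through the transition from the previous time.\<close>
    have sq: "integrable M (\<lambda>\<omega>. (g (Z i \<omega>))\<^sup>2)" "(\<integral>\<omega>. (g (Z i \<omega>))\<^sup>2 \<partial>M) \<le> c * B" if i: "1 \<le> i" for i
    proof -
      have "(\<integral>\<^sup>+\<omega>. ennreal ((g (Z i \<omega>))\<^sup>2) \<partial>M)
          = (\<integral>\<^sup>+\<omega>. (\<integral>\<^sup>+e. ennreal ((g (X i \<omega>, e))\<^sup>2) \<partial>density_kernel q (X i \<omega>)) \<partial>M)"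
        using markov_noise[of 0 i "\<lambda>_. 1" "\<lambda>y. ennreal ((g y)\<^sup>2)"] i by simp
      also have "\<dots> \<le> (\<integral>\<^sup>+\<omega>. ennreal c * ennreal (V (X i \<omega>)) \<partial>M)"
        using dominatedD(4)[OF g] c by (intro nn_integral_mono) (simp add: ennreal_mult')
      also have "\<dots> \<le> ennreal c * ennreal B"
        by (subst nn_integral_cmult) (auto intro!: mult_left_mono B)
      finally have le: "(\<integral>\<^sup>+\<omega>. ennreal ((g (Z i \<omega>))\<^sup>2) \<partial>M) \<le> ennreal (c * B)"
        using c by (simp add: ennreal_mult')
      then show int: "integrable M (\<lambda>\<omega>. (g (Z i \<omega>))\<^sup>2)"
        by (intro integrableI_nonneg) (auto intro: le_less_trans)
      show "(\<integral>\<omega>. (g (Z i \<omega>))\<^sup>2 \<partial>M) \<le> c * B"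
        using le c B(1) by (subst (asm) nn_integral_eq_integral[OF int]) auto
    qed
    have prod_int: "integrable M (\<lambda>\<omega>. u \<omega> * v \<omega>)"
      if [measurable]: "u \<in> borel_measurable M" "v \<in> borel_measurable M"
        and "integrable M (\<lambda>\<omega>. (u \<omega>)\<^sup>2)" "integrable M (\<lambda>\<omega>. (v \<omega>)\<^sup>2)" for u v :: "'w \<Rightarrow> real"
    proof (rule Bochner_Integration.integrable_bound)
      show "integrable M (\<lambda>\<omega>. (u \<omega>)\<^sup>2 + (v \<omega>)\<^sup>2)" using that by simp
      show "AE \<omega> in M. norm (u \<omega> * v \<omega>) \<le> norm ((u \<omega>)\<^sup>2 + (v \<omega>)\<^sup>2)" using young by simp
    qed measurable
    have g_int: "integrable M (\<lambda>\<omega>. g (Z i \<omega>))" if "1 \<le> i" for i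
      using prod_int[of "\<lambda>\<omega>. g (Z i \<omega>)" "\<lambda>_. 1"] sq(1)[OF that] by simp
    have \<xi>_sq: "integrable M (\<lambda>\<omega>. (\<xi> i \<omega>)\<^sup>2)" "(\<integral>\<omega>. (\<xi> i \<omega>)\<^sup>2 \<partial>M) \<le> c * B + t\<^sup>2" if i: "1 \<le> i" for i
    proof -
      have "(\<lambda>\<omega>. (\<xi> i \<omega>)\<^sup>2) = (\<lambda>\<omega>. (g (Z i \<omega>))\<^sup>2 + (\<theta>\<^sup>2 - 2 * \<theta> * g (Z i \<omega>)))"
        unfolding \<xi>_def by (simp add: power2_diff algebra_simps)
      then show int: "integrable M (\<lambda>\<omega>. (\<xi> i \<omega>)\<^sup>2)" using sq(1)[OF i] g_int[OF i] by simp
      have "(\<integral>\<omega>. (\<xi> i \<omega>)\<^sup>2 \<partial>M) \<le> (\<integral>\<omega>. (g (Z i \<omega>))\<^sup>2 + \<theta>\<^sup>2 \<partial>M)"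
      proof (rule integral_mono[OF int])
        show "(\<xi> i \<omega>)\<^sup>2 \<le> (g (Z i \<omega>))\<^sup>2 + \<theta>\<^sup>2" for \<omega>
          unfolding \<xi>_def power2_diff using g0[of "Z i \<omega>"] \<theta>(1) by simp
      qed (use sq(1)[OF i] in simp)
      also have "\<dots> \<le> c * B + \<theta>\<^sup>2" using sq[OF i] prob_space by simp
      also have "\<theta>\<^sup>2 \<le> t\<^sup>2" using \<theta> by (intro power_mono) auto
      finally show "(\<integral>\<omega>. (\<xi> i \<omega>)\<^sup>2 \<partial>M) \<le> c * B + t\<^sup>2" by simp
    qed
    have markov_real: "integrable M (\<lambda>\<omega>. u (Z i \<omega>) * (P ^^ k) (noise_mean g) (X i \<omega>)) \<and>
        (\<integral>\<omega>. u (Z i \<omega>) * g (Z (i + k) \<omega>) \<partial>M) = (\<integral>\<omega>. u (Z i \<omega>) * (P ^^ k) (noise_mean g) (X i \<omega>) \<partial>M)"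
      if [measurable]: "u \<in> borel_measurable (borel \<Otimes>\<^sub>M borel)" and u0: "\<And>y. 0 \<le> u y"
        and int: "integrable M (\<lambda>\<omega>. u (Z i \<omega>) * g (Z (i + k) \<omega>))" and k: "1 \<le> k" for u i k
    proof -
      have Pk0: "0 \<le> (P ^^ k) (noise_mean g) x" for x
        by (rule positive_operator.op_nonneg[OF positive_operator_funpow gb_w gb0])
      have [measurable]: "(P ^^ k) (noise_mean g) \<in> borel_measurable borel"
        by (rule wspace_measurable[OF funpow_closed[OF gb_w]])
      have "(\<integral>\<^sup>+\<omega>. ennreal (u (Z i \<omega>)) * ennreal (g (Z (i + k) \<omega>)) \<partial>M)
          = (\<integral>\<^sup>+\<omega>. ennreal (u (Z i \<omega>)) * ennreal (noise_mean g (X (i + k) \<omega>)) \<partial>M)"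
        using markov_noise[of i "i + k" "\<lambda>y. ennreal (u y)" "\<lambda>y. ennreal (g y)"] k
        by (simp add: nn_noise_mean[OF g c])
      also have "\<dots> = (\<integral>\<^sup>+\<omega>. ennreal (u (Z i \<omega>)) * ennreal ((P ^^ k) (noise_mean g) (X i \<omega>)) \<partial>M)"
        by (rule markov_iterate[of "\<lambda>y. ennreal (u y)"]) (auto simp: gb_w gb0)
      finally have "(\<integral>\<^sup>+\<omega>. ennreal (u (Z i \<omega>) * (P ^^ k) (noise_mean g) (X i \<omega>)) \<partial>M)
          = (\<integral>\<^sup>+\<omega>. ennreal (u (Z i \<omega>) * g (Z (i + k) \<omega>)) \<partial>M)"
        using u0 by (simp add: ennreal_mult')
      also have "\<dots> = ennreal (\<integral>\<omega>. u (Z i \<omega>) * g (Z (i + k) \<omega>) \<partial>M)"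
        using int u0 g0 by (intro nn_integral_eq_integral) auto
      finally have "has_bochner_integral M (\<lambda>\<omega>. u (Z i \<omega>) * (P ^^ k) (noise_mean g) (X i \<omega>))
          (\<integral>\<omega>. u (Z i \<omega>) * g (Z (i + k) \<omega>) \<partial>M)"
        using u0 g0 Pk0 by (intro has_bochner_integral_nn_integral) auto
      then show ?thesis by (simp add: has_bochner_integral_iff)
    qed
    define f where "f = (\<lambda>x. noise_mean g x - \<theta>)"
    have f_w: "f \<in> wspace W" unfolding f_def by (intro wspace_diff gb_w wspace_const)
    note [measurable] = wspace_measurable[OF f_w]
    have f_bd: "\<bar>f x\<bar> \<le> a * W x" for x
    proof -
      have "\<bar>f x\<bar> \<le> c * W x + t * 1"
        unfolding f_def using gb0[of x] noise_mean_le[OF g c, of x] \<theta> by simp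
      also have "t * 1 \<le> t * W x" using t W_ge1 by (intro mult_left_mono)
      finally show ?thesis unfolding a_def by (simp add: distrib_right)
    qed
    have f_stat: "(\<integral>x. f x \<partial>stat) = 0"
      unfolding f_def using prob_space.prob_space[OF prob_space_stat]
        Bochner_Integration.integral_diff[OF integrable_stat[OF gb_w] integrable_stat[OF wspace_const[of \<theta>]]]
      by (simp add: \<theta>_def stat_mean_def del: space_density)
    have Pk_f: "(P ^^ k) f x = (P ^^ k) (noise_mean g) x - \<theta>" for k x
    proof -
      have one: "(P ^^ k) (\<lambda>x. 1) = (\<lambda>x. 1)" by (induction k) (auto simp: P_one)
      have "(P ^^ k) (\<lambda>x. \<theta> * 1) = (\<lambda>x. \<theta> * (P ^^ k) (\<lambda>x. 1) x)"
        by (rule positive_operator.op_scale[OF positive_operator_funpow wspace_const])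
      then show ?thesis
        unfolding f_def one using positive_operator.op_diff[OF positive_operator_funpow gb_w wspace_const[of \<theta>], of k]
        by simp
    qed
    \<comment> \<open>\<open>\<xi>\<close> has no sign, while \<open>markov_real\<close> is for
      nonnegative factors. So the product is expanded, each future \<open>g\<close> is replaced by
      \<open>(P ^^ k) (noise_mean g)\<close>, and the terms are recombined by
      \<open>Pk_f\<close>.\<close>
    have pair: "(\<integral>\<omega>. \<xi> i \<omega> * \<xi> (i + k) \<omega> \<partial>M) = (\<integral>\<omega>. \<xi> i \<omega> * (P ^^ k) f (X i \<omega>) \<partial>M) \<and>
        integrable M (\<lambda>\<omega>. \<xi> i \<omega> * (P ^^ k) f (X i \<omega>))"
      if i: "1 \<le> i" and k: "1 \<le> k" for i k
    proof -
      let ?G = "(P ^^ k) (noise_mean g)"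
      have ik: "1 \<le> i + k" using i by simp
      have gg: "integrable M (\<lambda>\<omega>. g (Z i \<omega>) * g (Z (i + k) \<omega>))"
        by (intro prod_int sq(1) i ik) measurable
      note 1 = markov_real[OF _ g0 gg k] and 2 = markov_real[of "\<lambda>_. 1" i k]
      have i1: "integrable M (\<lambda>\<omega>. g (Z i \<omega>) * ?G (X i \<omega>))"
        and e1: "(\<integral>\<omega>. g (Z i \<omega>) * g (Z (i + k) \<omega>) \<partial>M) = (\<integral>\<omega>. g (Z i \<omega>) * ?G (X i \<omega>) \<partial>M)"
        using 1 by auto
      have i2: "integrable M (\<lambda>\<omega>. ?G (X i \<omega>))"
        and e2: "(\<integral>\<omega>. g (Z (i + k) \<omega>) \<partial>M) = (\<integral>\<omega>. ?G (X i \<omega>) \<partial>M)"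
        using 2 k g_int[OF ik] by auto
      have "(\<integral>\<omega>. \<xi> i \<omega> * \<xi> (i + k) \<omega> \<partial>M)
          = (\<integral>\<omega>. g (Z i \<omega>) * g (Z (i + k) \<omega>) - (\<theta> * g (Z (i + k) \<omega>) + \<theta> * g (Z i \<omega>) - \<theta> * \<theta>) \<partial>M)"
        unfolding \<xi>_def by (simp add: algebra_simps)
      also have "\<dots> = (\<integral>\<omega>. g (Z i \<omega>) * g (Z (i + k) \<omega>) \<partial>M) - (\<theta> * (\<integral>\<omega>. g (Z (i + k) \<omega>) \<partial>M) + \<theta> * (\<integral>\<omega>. g (Z i \<omega>) \<partial>M) - \<theta> * \<theta>)"
        using gg g_int[OF i] g_int[OF ik] prob_space by simp
      also have "\<dots> = (\<integral>\<omega>. g (Z i \<omega>) * ?G (X i \<omega>) \<partial>M) - (\<theta> * (\<integral>\<omega>. ?G (X i \<omega>) \<partial>M) + \<theta> * (\<integral>\<omega>. g (Z i \<omega>) \<partial>M) - \<theta> * \<theta>)"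
        unfolding e1 e2 ..
      also have "\<dots> = (\<integral>\<omega>. g (Z i \<omega>) * ?G (X i \<omega>) - (\<theta> * ?G (X i \<omega>) + \<theta> * g (Z i \<omega>) - \<theta> * \<theta>) \<partial>M)"
        using i1 i2 g_int[OF i] prob_space by simp
      also have "(\<lambda>\<omega>. g (Z i \<omega>) * ?G (X i \<omega>) - (\<theta> * ?G (X i \<omega>) + \<theta> * g (Z i \<omega>) - \<theta> * \<theta>)) = (\<lambda>\<omega>. \<xi> i \<omega> * (P ^^ k) f (X i \<omega>))"
        unfolding \<xi>_def Pk_f by (simp add: algebra_simps)
      finally have eq: "(\<integral>\<omega>. \<xi> i \<omega> * \<xi> (i + k) \<omega> \<partial>M) = (\<integral>\<omega>. \<xi> i \<omega> * (P ^^ k) f (X i \<omega>) \<partial>M)" .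
      have "(\<lambda>\<omega>. \<xi> i \<omega> * (P ^^ k) f (X i \<omega>)) = (\<lambda>\<omega>. g (Z i \<omega>) * ?G (X i \<omega>) - (\<theta> * ?G (X i \<omega>) + \<theta> * g (Z i \<omega>) - \<theta> * \<theta>))"
        unfolding \<xi>_def Pk_f by (simp add: algebra_simps)
      then have "integrable M (\<lambda>\<omega>. \<xi> i \<omega> * (P ^^ k) f (X i \<omega>))"
        using i1 i2 g_int[OF i] by simp
      then show ?thesis using eq by blast
    qed
    have \<xi>_prod: "integrable M (\<lambda>\<omega>. \<xi> i \<omega> * \<xi> j \<omega>)" if "1 \<le> i" "1 \<le> j" for i j
      using that by (intro prod_int \<xi>_sq(1)) auto
    have cross: "(\<integral>\<omega>. \<xi> i \<omega> * (\<Sum>j\<in>{i<..n}. \<xi> j \<omega>) \<partial>M) \<le> e * (c * B + B + t * B)" if i: "1 \<le> i" for i n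
    proof -
      have reindex: "(\<Sum>j\<in>{i<..n}. F j) = (\<Sum>k\<in>{1..n - i}. F (i + k))" for F :: "nat \<Rightarrow> real"
        by (rule sum.reindex_bij_witness[of _ "\<lambda>k. i + k" "\<lambda>j. j - i"]) auto
      have S_bd: "\<bar>\<Sum>k\<in>{1..d}. (P ^^ k) f x\<bar> \<le> e * W x" for x d
      proof -
        have "(\<Sum>k\<in>{1..d}. (P ^^ k) f x) = (\<Sum>k<Suc d. (P ^^ k) f x) - f x"
          by (subst sum.lessThan_Suc_shift) (simp add: sum.atLeast1_atMost_eq)
        then have "\<bar>\<Sum>k\<in>{1..d}. (P ^^ k) f x\<bar> \<le> D0 * a * W x + a * W x"
          using D0(2)[OF _ f_bd f_stat, of x "Suc d"] f_bd[of x] by (simp del: sum.lessThan_Suc)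
        then show ?thesis unfolding e_def by (simp add: algebra_simps)
      qed
      have "(\<integral>\<omega>. \<xi> i \<omega> * (\<Sum>j\<in>{i<..n}. \<xi> j \<omega>) \<partial>M) = (\<Sum>k\<in>{1..n - i}. \<integral>\<omega>. \<xi> i \<omega> * \<xi> (i + k) \<omega> \<partial>M)"
        unfolding reindex sum_distrib_left using i by (intro Bochner_Integration.integral_sum \<xi>_prod) auto
      also have "\<dots> = (\<Sum>k\<in>{1..n - i}. \<integral>\<omega>. \<xi> i \<omega> * (P ^^ k) f (X i \<omega>) \<partial>M)"
        using pair[OF i] by (intro sum.cong) auto
      also have "\<dots> = (\<integral>\<omega>. (\<Sum>k\<in>{1..n - i}. \<xi> i \<omega> * (P ^^ k) f (X i \<omega>)) \<partial>M)"
        using pair[OF i] by (intro Bochner_Integration.integral_sum[symmetric]) auto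
      also have "\<dots> \<le> (\<integral>\<omega>. e * ((g (Z i \<omega>))\<^sup>2 + V (X i \<omega>) + t * V (X i \<omega>)) \<partial>M)"
      proof (rule integral_mono)
        show "integrable M (\<lambda>\<omega>. \<Sum>k\<in>{1..n - i}. \<xi> i \<omega> * (P ^^ k) f (X i \<omega>))"
          using pair[OF i] by (intro Bochner_Integration.integrable_sum) auto
        show "integrable M (\<lambda>\<omega>. e * ((g (Z i \<omega>))\<^sup>2 + V (X i \<omega>) + t * V (X i \<omega>)))"
          using sq(1)[OF i] EV(1) by simp
        fix \<omega>
        let ?g = "g (Z i \<omega>)" and ?w = "W (X i \<omega>)"
        have "(\<Sum>k\<in>{1..n - i}. \<xi> i \<omega> * (P ^^ k) f (X i \<omega>)) \<le> \<bar>\<xi> i \<omega>\<bar> * \<bar>\<Sum>k\<in>{1..n - i}. (P ^^ k) f (X i \<omega>)\<bar>"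
          unfolding sum_distrib_left[symmetric] abs_mult[symmetric] by simp
        also have "\<dots> \<le> (?g + t) * (e * ?w)"
          using S_bd g0[of "Z i \<omega>"] \<theta> t unfolding \<xi>_def by (intro mult_mono) auto
        also have "\<dots> = e * (?g * ?w + t * ?w)" by (simp add: algebra_simps)
        also have "\<dots> \<le> e * (?g\<^sup>2 + V (X i \<omega>) + t * V (X i \<omega>))"
        proof (intro mult_left_mono add_mono)
          show "?g * ?w \<le> ?g\<^sup>2 + V (X i \<omega>)"
            using young[of ?g ?w] W_V(2)[of "X i \<omega>"] by linarith
          show "?w \<le> V (X i \<omega>)"
            using mult_left_mono[OF W_ge1[of "X i \<omega>"], of ?w] W_pos[of "X i \<omega>"] W_V(1)[of "X i \<omega>"] by simp
        qed (use t ae in auto)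
        finally show "(\<Sum>k\<in>{1..n - i}. \<xi> i \<omega> * (P ^^ k) f (X i \<omega>)) \<le> e * (?g\<^sup>2 + V (X i \<omega>) + t * V (X i \<omega>))" .
      qed
      also have "\<dots> = e * ((\<integral>\<omega>. (g (Z i \<omega>))\<^sup>2 \<partial>M) + (\<integral>\<omega>. V (X i \<omega>) \<partial>M) + t * (\<integral>\<omega>. V (X i \<omega>) \<partial>M))"
        using sq(1)[OF i] EV(1) by simp
      also have "\<dots> \<le> e * (c * B + B + t * B)"
        using sq(2)[OF i] EV(2) t ae by (intro mult_left_mono add_mono) auto
      finally show ?thesis .
    qed
    \<comment> \<open>The window grows at its left end, so that the new term meets only later ones
      and \<open>cross\<close> applies to its product with the whole old sum.\<close>
    have induct: "integrable M (\<lambda>\<omega>. (\<Sum>i\<in>{n - d<..n}. \<xi> i \<omega>)\<^sup>2) \<and> (\<integral>\<omega>. (\<Sum>i\<in>{n - d<..n}. \<xi> i \<omega>)\<^sup>2 \<partial>M) \<le> D * real d"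
      if "d \<le> n" for n d
      using that
    proof (induction d)
      case (Suc d)
      let ?i = "n - d" and ?S = "\<lambda>\<omega>. \<Sum>j\<in>{n - d<..n}. \<xi> j \<omega>"
      have i: "1 \<le> ?i" using Suc.prems by simp
      have IH: "integrable M (\<lambda>\<omega>. (?S \<omega>)\<^sup>2)" "(\<integral>\<omega>. (?S \<omega>)\<^sup>2 \<partial>M) \<le> D * real d"
        using Suc by auto
      have set: "{n - Suc d<..n} = insert ?i {?i<..n}" using Suc.prems by auto
      have sum: "(\<lambda>\<omega>. (\<Sum>j\<in>{n - Suc d<..n}. \<xi> j \<omega>)\<^sup>2) = (\<lambda>\<omega>. (\<xi> ?i \<omega>)\<^sup>2 + 2 * (\<xi> ?i \<omega> * ?S \<omega>) + (?S \<omega>)\<^sup>2)"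
        unfolding set by (simp add: power2_sum algebra_simps)
      have int: "integrable M (\<lambda>\<omega>. \<xi> ?i \<omega> * ?S \<omega>)"
        by (intro prod_int \<xi>_sq(1) i IH(1)) measurable
      have "(\<integral>\<omega>. (\<xi> ?i \<omega>)\<^sup>2 + 2 * (\<xi> ?i \<omega> * ?S \<omega>) + (?S \<omega>)\<^sup>2 \<partial>M)
          = (\<integral>\<omega>. (\<xi> ?i \<omega>)\<^sup>2 \<partial>M) + 2 * (\<integral>\<omega>. \<xi> ?i \<omega> * ?S \<omega> \<partial>M) + (\<integral>\<omega>. (?S \<omega>)\<^sup>2 \<partial>M)"
        using \<xi>_sq(1)[OF i] int IH(1) by simp
      also have "\<dots> \<le> (c * B + t\<^sup>2) + 2 * (e * (c * B + B + t * B)) + D * real d"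
        using \<xi>_sq(2)[OF i] cross[OF i, of n] IH(2) by (intro add_mono mult_left_mono) auto
      also have "\<dots> = D * real (Suc d)" unfolding D_def[symmetric] by (simp add: algebra_simps)
      finally show ?case unfolding sum using \<xi>_sq(1)[OF i] int IH(1) by simp
    qed simp
    have "integrable M (\<lambda>\<omega>. (\<Sum>i\<in>{m<..n}. g (Z i \<omega>) - stat_mean g)\<^sup>2) \<and>
       (\<integral>\<omega>. (\<Sum>i\<in>{m<..n}. g (Z i \<omega>) - stat_mean g)\<^sup>2 \<partial>M) \<le> D * real (n - m)" if "m \<le> n" for m n
      using induct[of "n - m" n] that unfolding \<xi>_def \<theta>_def by simp }
  then show thesis using that D by blast
qed

end

section \<open>Maximal inequality, discretization and approximate identities\<close>

text \<open>The chaining step of the Rademacher--Menshov inequality.\<close>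

lemma dyadic_maximal:
  fixes F :: "nat \<Rightarrow> real"
  assumes n: "n < 2 ^ k"
  shows "(F n - F 0)\<^sup>2 \<le> real k * (\<Sum>i<k. \<Sum>j<2 ^ (k - i). (F (Suc j * 2 ^ i) - F (j * 2 ^ i))\<^sup>2)"
proof -
  \<comment> \<open>The value at \<open>n\<close> rounded down to a multiple of
    \<open>2 ^ i\<close>: level 0 is \<open>n\<close> itself, level \<open>k\<close> is 0. Passing
    to the next level clears one binary digit, so each difference is zero or one increment over a
    dyadic block of that level; Cauchy-Schwarz over the levels costs the factor
    \<open>k\<close>.\<close>
  define d where "d = (\<lambda>i. F (2 ^ i * (n div 2 ^ i)))"
  have "F n - F 0 = d 0 - d k" using n unfolding d_def by simp
  also have "\<dots> = (\<Sum>i<k. d i - d (Suc i))" by (simp add: sum_lessThan_telescope')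
  finally have "(F n - F 0)\<^sup>2 \<le> (\<Sum>i<k. (d i - d (Suc i))\<^sup>2) * real k"
    using sum_squared_le_sum_of_squares[of "\<lambda>i. d i - d (Suc i)" "{..<k}"] by simp
  also have "\<dots> \<le> (\<Sum>i<k. \<Sum>j<2 ^ (k - i). (F (Suc j * 2 ^ i) - F (j * 2 ^ i))\<^sup>2) * real k"
  proof (intro mult_right_mono sum_mono)
    fix i assume i: "i \<in> {..<k}"
    define j where "j = 2 * (n div 2 ^ Suc i)"
    have j_eq: "2 ^ Suc i * (n div 2 ^ Suc i) = j * 2 ^ i" unfolding j_def by simp
    have split: "n div 2 ^ i = j \<or> n div 2 ^ i = Suc j"
    proof -
      have "n div 2 ^ Suc i = n div 2 ^ i div 2" by (metis div_mult2_eq power_Suc2)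
      moreover have "a = 2 * (a div 2) \<or> a = Suc (2 * (a div 2))" for a :: nat by presburger
      ultimately show ?thesis unfolding j_def by metis
    qed
    show "(d i - d (Suc i))\<^sup>2 \<le> (\<Sum>j<2 ^ (k - i). (F (Suc j * 2 ^ i) - F (j * 2 ^ i))\<^sup>2)"
    proof (cases "n div 2 ^ i = j")
      case True
      then have "d i - d (Suc i) = 0" unfolding d_def j_eq by (simp add: mult.commute)
      then show ?thesis by (simp add: sum_nonneg)
    next
      case False
      then have e: "n div 2 ^ i = Suc j" using split by blast
      have "n div 2 ^ i < 2 ^ (k - i)"
        using n i by (simp add: less_mult_imp_div_less flip: power_add)
      then have "j \<in> {..<2 ^ (k - i)}" using e by simp
      moreover have "d i - d (Suc i) = F (Suc j * 2 ^ i) - F (j * 2 ^ i)"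
        unfolding d_def j_eq e by (simp add: mult.commute)
      ultimately show ?thesis
        using member_le_sum[of j "{..<2 ^ (k - i)}" "\<lambda>j. (F (Suc j * 2 ^ i) - F (j * 2 ^ i))\<^sup>2"] by simp
    qed
  qed simp
  finally show ?thesis by (simp add: mult.commute)
qed

text \<open>\<open>L\<close> will be a centred sum at a fixed outcome and time, seen as a linear
  functional of the test function. After summation by parts the coefficients are
  \<open>f (t 0)\<close> and the increments of \<open>f\<close>, each at most
  \<open>l * \<delta>\<close>. \<open>T\<close> converts the uniform error of the step function,
  \<open>l * \<delta>\<close> on the grid and \<open>\<tau>\<close> outside, into an error of
  \<open>L f\<close>.\<close>

lemma discretization:
  fixes L :: "(real \<Rightarrow> real) \<Rightarrow> real" and f :: "real \<Rightarrow> real"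
  assumes L_add: "\<And>f g. f \<in> borel_measurable borel \<Longrightarrow> g \<in> borel_measurable borel \<Longrightarrow> bounded (range f) \<Longrightarrow> bounded (range g) \<Longrightarrow>
        L (\<lambda>x. f x + g x) = L f + L g"
    and L_scale: "\<And>f a. f \<in> borel_measurable borel \<Longrightarrow> bounded (range f) \<Longrightarrow> L (\<lambda>x. a * f x) = a * L f"
    and L_bound: "\<And>f s. f \<in> borel_measurable borel \<Longrightarrow> (\<And>x. \<bar>f x\<bar> \<le> s) \<Longrightarrow> \<bar>L f\<bar> \<le> T * s"
    and f [measurable]: "f \<in> borel_measurable borel" and f0: "\<And>x. 0 \<le> f x" and f_bd: "\<And>x. f x \<le> \<kappa>"
    and lip: "\<And>x y. \<bar>f x - f y\<bar> \<le> l * \<bar>x - y\<bar>"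
    and tail: "\<And>x. \<bar>x - x0\<bar> \<ge> R \<Longrightarrow> f x \<le> \<tau>"
    and R: "0 < R" and J: "1 \<le> J" and l: "0 \<le> l" and \<tau>: "0 \<le> \<tau>"
  defines "\<delta> \<equiv> 2 * R / real J" and "t \<equiv> \<lambda>j. x0 - R + real j * (2 * R / real J)"
  shows "\<bar>L f\<bar> \<le> T * (l * \<delta> + \<tau>) + \<kappa> * \<bar>L (indicator {t 0<..t J})\<bar>
           + l * \<delta> * (\<Sum>j<J. \<bar>L (indicator {t (Suc j)<..t J})\<bar>)"
proof -
  have t_def: "t j = x0 - R + real j * \<delta>" for j unfolding t_def \<delta>_def ..
  have \<delta>: "0 < \<delta>" unfolding \<delta>_def using R J by simp
  have tJ: "t J = x0 + R" unfolding t_def \<delta>_def using J by simp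
  have t_mono: "t i \<le> t j \<longleftrightarrow> i \<le> j" for i j unfolding t_def using \<delta> by simp
  define I where "I = (\<lambda>j. indicat_real {t j<..t J})"
  have I_meas [measurable]: "I j \<in> borel_measurable borel" for j unfolding I_def by measurable
  have I_bdd: "bounded (range (\<lambda>x. a * I j x))" for a j
    by (rule boundedI[of _ "\<bar>a\<bar>"]) (auto simp: I_def indicator_def)
  \<comment> \<open>The step function with value \<open>f (t j)\<close> on \<open>(t j, t (j + 1)]\<close>, after summation by parts.\<close>
  define S where "S = (\<lambda>x. f (t 0) * I 0 x + (\<Sum>j<J. (f (t (Suc j)) - f (t j)) * I (Suc j) x))"
  have sum_bdd: "bounded (range (\<lambda>x. \<Sum>j<N. c j * I (Suc j) x))" for c and N :: nat
  proof (rule boundedI)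
    fix y assume "y \<in> range (\<lambda>x. \<Sum>j<N. c j * I (Suc j) x)"
    then obtain x where "y = (\<Sum>j<N. c j * I (Suc j) x)" by blast
    then show "norm y \<le> (\<Sum>j<N. \<bar>c j\<bar>)"
      unfolding real_norm_def
      by (simp only:) (intro order_trans[OF sum_abs] sum_mono, simp add: I_def indicator_def)
  qed
  have S_meas [measurable]: "S \<in> borel_measurable borel" unfolding S_def by measurable
  have L_zero: "L (\<lambda>x. 0) = 0" using L_scale[of "\<lambda>x. 0" 0] by simp
  have L_sum: "L (\<lambda>x. \<Sum>j<N. c j * I (Suc j) x) = (\<Sum>j<N. c j * L (I (Suc j)))" for c and N :: nat
  proof (induction N)
    case (Suc N)
    have "L (\<lambda>x. (\<Sum>j<N. c j * I (Suc j) x) + c N * I (Suc N) x) = L (\<lambda>x. \<Sum>j<N. c j * I (Suc j) x) + L (\<lambda>x. c N * I (Suc N) x)"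
      by (intro L_add sum_bdd I_bdd) measurable
    then show ?case using Suc L_scale[of "I (Suc N)" "c N"] I_bdd[of 1 "Suc N"] by simp
  qed (simp add: L_zero)
  have LS: "L S = f (t 0) * L (I 0) + (\<Sum>j<J. (f (t (Suc j)) - f (t j)) * L (I (Suc j)))"
  proof -
    have "L S = L (\<lambda>x. f (t 0) * I 0 x) + L (\<lambda>x. \<Sum>j<J. (f (t (Suc j)) - f (t j)) * I (Suc j) x)"
      unfolding S_def by (intro L_add sum_bdd I_bdd) measurable
    then show ?thesis using L_sum L_scale[of "I 0" "f (t 0)"] I_bdd[of 1 0] by simp
  qed
  have LS_bd: "\<bar>L S\<bar> \<le> \<kappa> * \<bar>L (I 0)\<bar> + l * \<delta> * (\<Sum>j<J. \<bar>L (I (Suc j))\<bar>)"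
  proof -
    have "\<bar>(f (t (Suc j)) - f (t j)) * L (I (Suc j))\<bar> \<le> l * \<delta> * \<bar>L (I (Suc j))\<bar>" for j
    proof -
      have "t (Suc j) - t j = \<delta>" unfolding t_def by (simp add: algebra_simps)
      then show ?thesis
        using lip[of "t (Suc j)" "t j"] \<delta> unfolding abs_mult by (intro mult_right_mono) auto
    qed
    then have "\<bar>\<Sum>j<J. (f (t (Suc j)) - f (t j)) * L (I (Suc j))\<bar> \<le> (\<Sum>j<J. l * \<delta> * \<bar>L (I (Suc j))\<bar>)"
      by (intro order_trans[OF sum_abs] sum_mono)
    moreover have "\<bar>f (t 0) * L (I 0)\<bar> \<le> \<kappa> * \<bar>L (I 0)\<bar>"
      using f0 f_bd by (auto simp: abs_mult intro!: mult_right_mono)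
    ultimately show ?thesis unfolding LS by (simp add: sum_distrib_left)
  qed
  have diff: "\<bar>f x - S x\<bar> \<le> l * \<delta> + \<tau>" for x
  proof (cases "x \<in> {t 0<..t J}")
    case False
    then have "\<bar>x - x0\<bar> \<ge> R" unfolding tJ unfolding t_def by auto
    moreover have "I j x = 0" for j
      using False t_mono[of 0 j] unfolding I_def by (auto simp: indicator_def)
    ultimately show ?thesis
      using tail[of x] f0[of x] l \<delta> unfolding S_def by (simp add: add_increasing)
  next
    case True
    \<comment> \<open>Cells are open at the left and closed at the right, so the cell of
      \<open>x\<close> is found with a ceiling; \<open>k\<close> is one less, and \<open>x\<close>
      lies in \<open>(t k, t (Suc k)]\<close>.\<close>
    define c where "c = \<lceil>(x - t 0) / \<delta>\<rceil>"
    define k where "k = nat c - 1"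
    have c: "of_int c - 1 < (x - t 0) / \<delta>" "(x - t 0) / \<delta> \<le> of_int c" unfolding c_def by linarith+
    have "0 < (x - t 0) / \<delta>" using True \<delta> by simp
    then have c1: "1 \<le> c" using c(2) by linarith
    have "(x - t 0) / \<delta> \<le> real J" using True \<delta> by (simp add: divide_le_eq t_def)
    then have cJ: "c \<le> int J" unfolding c_def by (simp add: ceiling_le_iff)
    have kc: "real k = of_int c - 1" unfolding k_def using c1 by simp
    have x1: "t k < x" and x2: "x \<le> t (Suc k)"
    proof -
      have "\<delta> * real_of_int c = \<delta> * real k + \<delta>" unfolding kc by (simp add: right_diff_distrib)
      then show "t k < x" "x \<le> t (Suc k)" using c \<delta> unfolding t_def by (auto simp: field_simps)
    qed
    have kJ: "k < J" unfolding k_def using c1 cJ by linarith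
    have I_val: "I j x = (if j \<le> k then 1 else 0)" for j
    proof (cases "j \<le> k")
      case True
      then have "t j < x" using t_mono[of j k] x1 by linarith
      then show ?thesis using True \<open>x \<in> {t 0<..t J}\<close> unfolding I_def by simp
    next
      case False
      then have "x \<le> t j" using t_mono[of "Suc k" j] x2 by linarith
      then show ?thesis using False unfolding I_def by simp
    qed
    have "(\<Sum>j<J. (f (t (Suc j)) - f (t j)) * I (Suc j) x) = (\<Sum>j<k. f (t (Suc j)) - f (t j))"
      unfolding I_val using kJ by (intro sum.mono_neutral_cong_right) auto
    also have "\<dots> = f (t k) - f (t 0)" by (rule sum_lessThan_telescope)
    finally have "S x = f (t k)" unfolding S_def I_val by simp
    then have "\<bar>f x - S x\<bar> \<le> l * \<bar>x - t k\<bar>" using lip by simp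
    also have "\<dots> \<le> l * \<delta>" using x1 x2 l by (intro mult_left_mono) (auto simp: t_def algebra_simps)
    finally show ?thesis using \<tau> by simp
  qed
  have S_bdd: "bounded (range S)"
  proof (rule boundedI)
    fix y assume "y \<in> range S"
    then obtain x where "y = S x" by blast
    then show "norm y \<le> \<kappa> + (l * \<delta> + \<tau>)" using diff[of x] f0[of x] f_bd[of x] by simp
  qed
  have f_bdd: "bounded (range (\<lambda>x. f x - S x))"
    by (rule boundedI[of _ "l * \<delta> + \<tau>"]) (use diff in auto)
  have "L f = L (\<lambda>x. (f x - S x) + S x)" by simp
  also have "\<dots> = L (\<lambda>x. f x - S x) + L S" by (intro L_add S_bdd f_bdd) measurable
  finally have "\<bar>L f\<bar> \<le> \<bar>L (\<lambda>x. f x - S x)\<bar> + \<bar>L S\<bar>" by simp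
  also have "\<bar>L (\<lambda>x. f x - S x)\<bar> \<le> T * (l * \<delta> + \<tau>)"
    by (intro L_bound diff) measurable
  finally show ?thesis using LS_bd unfolding I_def by simp
qed

text \<open>The expectation of the whole series is finite by Tonelli, so the series converges almost
  surely and its terms tend to zero. This takes the place of Markov's inequality with
  Borel-Cantelli.\<close>

lemma AE_tendsto_0_summable:
  fixes f :: "nat \<Rightarrow> 'a \<Rightarrow> real"
  assumes int: "\<And>k. integrable M (f k)" and nonneg: "\<And>k \<omega>. 0 \<le> f k \<omega>"
    and sum: "summable (\<lambda>k. \<integral>\<omega>. f k \<omega> \<partial>M)"
  shows "AE \<omega> in M. (\<lambda>k. f k \<omega>) \<longlonglongrightarrow> 0"
proof -
  have [measurable]: "f k \<in> borel_measurable M" for k using int by auto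
  have "(\<integral>\<^sup>+\<omega>. (\<Sum>k. ennreal (f k \<omega>)) \<partial>M) = (\<Sum>k. \<integral>\<^sup>+\<omega>. ennreal (f k \<omega>) \<partial>M)"
    by (rule nn_integral_suminf) measurable
  also have "\<dots> = (\<Sum>k. ennreal (\<integral>\<omega>. f k \<omega> \<partial>M))"
    using int nonneg by (simp add: nn_integral_eq_integral)
  also have "\<dots> = ennreal (\<Sum>k. \<integral>\<omega>. f k \<omega> \<partial>M)"
    using sum nonneg by (intro suminf_ennreal2) auto
  finally have "(\<integral>\<^sup>+\<omega>. (\<Sum>k. ennreal (f k \<omega>)) \<partial>M) \<noteq> \<infinity>" by simp
  then have "AE \<omega> in M. (\<Sum>k. ennreal (f k \<omega>)) \<noteq> \<infinity>"
    by (rule nn_integral_PInf_AE[rotated]) measurable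
  then show ?thesis
  proof eventually_elim
    case (elim \<omega>)
    then have "summable (\<lambda>k. f k \<omega>)"
      using nonneg by (intro summable_suminf_not_top) auto
    then show ?case by (rule summable_LIMSEQ_zero)
  qed
qed

text \<open>\<open>K\<close> may have unbounded support and \<open>g\<close> may be unbounded away
  from \<open>x0\<close>, so the far region is treated in two ways. Against
  \<open>\<bar>g\<bar>\<close>, which is integrable, the tail condition makes the rescaled kernel
  uniformly small there; against the constant \<open>g x0\<close>, it is the far mass of
  \<open>K\<close> that vanishes.\<close>

lemma parzen:
  fixes K g :: "real \<Rightarrow> real" and h :: "nat \<Rightarrow> real"
  assumes K0: "\<And>x. 0 \<le> K x" and K1: "has_bochner_integral lborel K 1"
    and tail: "((\<lambda>x. \<bar>x\<bar> * K x) \<longlongrightarrow> 0) at_infinity"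
    and h: "eventually (\<lambda>n. 0 < h n) sequentially" "h \<longlonglongrightarrow> 0"
    and g: "integrable lborel g" and cont: "isCont g x0"
  shows "(\<lambda>n. (\<integral>x. g x * K ((x0 - x) / h n) \<partial>lborel) / h n) \<longlonglongrightarrow> g x0"
proof -
  have K_int: "integrable lborel K" "(\<integral>x. K x \<partial>lborel) = 1"
    using K1 by (simp_all add: has_bochner_integral_iff)
  have [measurable]: "K \<in> borel_measurable borel" "g \<in> borel_measurable borel"
    using K_int(1) g by (auto dest!: borel_measurable_integrable)
  have affine: "integrable lborel (\<lambda>x. F ((x0 - x) / s))" "(\<integral>x. F ((x0 - x) / s) \<partial>lborel) = s * (\<integral>x. F x \<partial>lborel)"
    if F: "integrable lborel F" and s: "0 < s" for F :: "real \<Rightarrow> real" and s :: real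
  proof -
    have eq: "(x0 - x) / s = x0 / s + (- 1 / s) * x" for x by (simp add: diff_divide_distrib)
    show "integrable lborel (\<lambda>x. F ((x0 - x) / s))"
      unfolding eq using s by (intro lborel_integrable_real_affine F) auto
    show "(\<integral>x. F ((x0 - x) / s) \<partial>lborel) = s * (\<integral>x. F x \<partial>lborel)"
      unfolding eq using s lborel_integral_real_affine[of "- 1 / s" F "x0 / s"] by simp
  qed
  show ?thesis
  proof (rule LIMSEQ_I)
    fix r :: real assume r: "0 < r"
    define G where "G = (\<integral>x. \<bar>g x\<bar> \<partial>lborel)"
    have G: "0 \<le> G" unfolding G_def by simp
    obtain d where d: "0 < d" "\<And>x. \<bar>x - x0\<bar> < d \<Longrightarrow> \<bar>g x - g x0\<bar> < r / 4"
      using cont[unfolded continuous_at_real_range, rule_format, of "r / 4"] r by auto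
    \<comment> \<open>Makes \<open>(e / d) * G\<close> at most \<open>r / 4\<close>; the
      \<open>+ 1\<close> covers \<open>G = 0\<close>. Each of the three error terms gets
      \<open>r / 4\<close>, which leaves a strict inequality.\<close>
    define e where "e = r * d / (4 * (G + 1))"
    have e: "0 < e" unfolding e_def using r d G by simp
    obtain b where b: "\<And>x. b \<le> \<bar>x\<bar> \<Longrightarrow> \<bar>x\<bar> * K x < e"
      using tail[unfolded tendsto_iff, rule_format, OF e] K0 unfolding eventually_at_infinity by (auto simp: abs_mult)
    \<comment> \<open>The mass of the rescaled kernel beyond distance \<open>d\<close>, after the
      substitution \<open>v = (x0 - x) / h n\<close>.\<close>
    define tl where "tl = (\<lambda>n. \<integral>v. K v * indicator {v. d \<le> \<bar>v\<bar> * h n} v \<partial>lborel)"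
    have "tl \<longlonglongrightarrow> (\<integral>v. 0 \<partial>(lborel :: real measure))"
      unfolding tl_def
    proof (rule integral_dominated_convergence[where w = K])
      show "AE v in lborel. (\<lambda>n. K v * indicator {v. d \<le> \<bar>v\<bar> * h n} v) \<longlonglongrightarrow> 0"
      proof (rule AE_I2)
        fix v :: real
        have "(\<lambda>n. \<bar>v\<bar> * h n) \<longlonglongrightarrow> \<bar>v\<bar> * 0" by (intro tendsto_intros h)
        then have "eventually (\<lambda>n. \<bar>v\<bar> * h n < d) sequentially" using d by (intro order_tendstoD(2)) auto
        then have "eventually (\<lambda>n. K v * indicator {v. d \<le> \<bar>v\<bar> * h n} v = 0) sequentially"
            by (rule eventually_mono) simp
          then show "(\<lambda>n. K v * indicator {v. d \<le> \<bar>v\<bar> * h n} v) \<longlonglongrightarrow> 0"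
            by (rule tendsto_eventually)
      qed
    qed (use K_int K0 in \<open>auto simp: indicator_def\<close>)
    then have tl: "tl \<longlonglongrightarrow> 0" by simp
    have ev1: "eventually (\<lambda>n. tl n < r / (4 * (\<bar>g x0\<bar> + 1))) sequentially"
      using r by (intro order_tendstoD(2)[OF tl]) auto
    have ev2: "eventually (\<lambda>n. h n * (\<bar>b\<bar> + 1) < d) sequentially"
    proof -
      have "(\<lambda>n. h n * (\<bar>b\<bar> + 1)) \<longlonglongrightarrow> 0 * (\<bar>b\<bar> + 1)" by (intro tendsto_intros h)
      then show ?thesis using d by (intro order_tendstoD(2)) auto
    qed
    have "eventually (\<lambda>n. norm ((\<integral>x. g x * K ((x0 - x) / h n) \<partial>lborel) / h n - g x0) < r) sequentially"
      using h(1) ev1 ev2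
    proof eventually_elim
      case (elim n)
      let ?s = "h n"
      have s: "0 < ?s" by fact
      let ?k = "\<lambda>x. K ((x0 - x) / ?s) / ?s"
      let ?far = "\<lambda>x. K ((x0 - x) / ?s) * indicator {v. d \<le> \<bar>v\<bar> * ?s} ((x0 - x) / ?s) / ?s"
      \<comment> \<open>As \<open>\<bar>x - x0\<bar> = \<bar>v\<bar> * h n\<close> for
        \<open>v = (x0 - x) / h n\<close>, the bound on \<open>\<bar>v\<bar> * K v\<close> is one on
        \<open>\<bar>x - x0\<bar> * ?k x\<close>: the distance absorbs the factor
        \<open>1 / h n\<close>.\<close>
      have far: "?k x \<le> e / d" if "d \<le> \<bar>x - x0\<bar>" for x
      proof -
        let ?v = "(x0 - x) / ?s"
        have v: "\<bar>?v\<bar> * ?s = \<bar>x - x0\<bar>" using s by (simp add: abs_minus_commute)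
        have "?s * b < \<bar>x - x0\<bar>"
          using elim(3) that s by (smt (verit) mult_left_mono abs_ge_self)
        then have "b \<le> \<bar>?v\<bar>" using s by (simp add: pos_le_divide_eq mult.commute abs_minus_commute)
        then have "\<bar>?v\<bar> * K ?v < e" by (rule b)
        then have "\<bar>x - x0\<bar> * ?k x \<le> e" unfolding v[symmetric] using s by simp
        moreover have "d * ?k x \<le> \<bar>x - x0\<bar> * ?k x" using that s K0 by (intro mult_right_mono) auto
        ultimately show ?thesis using d by (simp add: field_simps)
      qed
      have k_int: "integrable lborel ?k" "(\<integral>x. ?k x \<partial>lborel) = 1"
        using affine[OF K_int(1) s] K_int(2) s by simp_all
      have tl_int: "integrable lborel (\<lambda>v. K v * indicator {v. d \<le> \<bar>v\<bar> * ?s} v)"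
        by (intro integrable_real_mult_indicator K_int) measurable
      have far_int: "integrable lborel ?far" "(\<integral>x. ?far x \<partial>lborel) = tl n"
        using affine[OF tl_int s] s unfolding tl_def by simp_all
      have pt: "\<bar>(g x - g x0) * ?k x\<bar> \<le> r / 4 * ?k x + (e / d) * \<bar>g x\<bar> + \<bar>g x0\<bar> * ?far x" for x
      proof (cases "\<bar>x - x0\<bar> < d")
        case True
        have "\<bar>(g x - g x0) * ?k x\<bar> \<le> r / 4 * ?k x"
          using d(2)[OF True] K0 s r unfolding abs_mult by (intro mult_mono) auto
        moreover have "0 \<le> (e / d) * \<bar>g x\<bar>" "0 \<le> \<bar>g x0\<bar> * ?far x" using e d K0 s by auto
        ultimately show ?thesis by linarith
      next
        case False
        have "\<bar>(x0 - x) / ?s\<bar> * ?s = \<bar>x - x0\<bar>" using s by (simp add: abs_minus_commute)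
        then have "?far x = ?k x" using False by simp
        have "\<bar>(g x - g x0) * ?k x\<bar> \<le> (\<bar>g x\<bar> + \<bar>g x0\<bar>) * ?k x"
          using K0 s unfolding abs_mult by (intro mult_mono) auto
        also have "\<dots> = ?k x * \<bar>g x\<bar> + \<bar>g x0\<bar> * ?far x"
          unfolding \<open>?far x = ?k x\<close> by (simp only: distrib_right mult.commute)
        also have "?k x * \<bar>g x\<bar> \<le> (e / d) * \<bar>g x\<bar>" using far False by (intro mult_right_mono) auto
        finally have "\<bar>(g x - g x0) * ?k x\<bar> \<le> (e / d) * \<bar>g x\<bar> + \<bar>g x0\<bar> * ?far x" by simp
        moreover have "0 \<le> r / 4 * ?k x" using r K0 s by simp
        ultimately show ?thesis by linarith
      qed
      have bd_int: "integrable lborel (\<lambda>x. r / 4 * ?k x + (e / d) * \<bar>g x\<bar> + \<bar>g x0\<bar> * ?far x)"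
        using k_int far_int g by (intro Bochner_Integration.integrable_add integrable_mult_right) auto
      have diff_int: "integrable lborel (\<lambda>x. (g x - g x0) * ?k x)"
        using order_trans[OF pt abs_ge_self] by (intro Bochner_Integration.integrable_bound[OF bd_int]) auto
      have gk0_int: "integrable lborel (\<lambda>x. g x0 * ?k x)" by (intro integrable_mult_right k_int(1))
      have "(\<integral>x. g x * K ((x0 - x) / ?s) \<partial>lborel) / ?s = (\<integral>x. g x * ?k x \<partial>lborel)" by simp
      also have "\<dots> = (\<integral>x. (g x - g x0) * ?k x + g x0 * ?k x \<partial>lborel)"
        by (intro Bochner_Integration.integral_cong refl) (simp only: left_diff_distrib diff_add_cancel)
      also have "\<dots> = (\<integral>x. (g x - g x0) * ?k x \<partial>lborel) + (\<integral>x. g x0 * ?k x \<partial>lborel)"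
        using diff_int gk0_int by (intro Bochner_Integration.integral_add) auto
      also have "(\<integral>x. g x0 * ?k x \<partial>lborel) = g x0"
        using k_int(2) by (simp only: integral_mult_right_zero)
      finally have "norm ((\<integral>x. g x * K ((x0 - x) / ?s) \<partial>lborel) / ?s - g x0) = \<bar>\<integral>x. (g x - g x0) * ?k x \<partial>lborel\<bar>"
        by simp
      also have "\<dots> \<le> (\<integral>x. \<bar>(g x - g x0) * ?k x\<bar> \<partial>lborel)" by (rule integral_abs_bound)
      also have "\<dots> \<le> (\<integral>x. r / 4 * ?k x + (e / d) * \<bar>g x\<bar> + \<bar>g x0\<bar> * ?far x \<partial>lborel)"
        by (intro integral_mono integrable_abs diff_int bd_int pt)
      also have "\<dots> = r / 4 * (\<integral>x. ?k x \<partial>lborel) + (e / d) * (\<integral>x. \<bar>g x\<bar> \<partial>lborel) + \<bar>g x0\<bar> * (\<integral>x. ?far x \<partial>lborel)"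
      proof -
        have i: "integrable lborel (\<lambda>x. r / 4 * ?k x)" "integrable lborel (\<lambda>x. (e / d) * \<bar>g x\<bar>)"
          "integrable lborel (\<lambda>x. \<bar>g x0\<bar> * ?far x)"
          by (intro integrable_mult_right integrable_abs k_int(1) far_int(1) g)+
        show ?thesis
          by (simp only: Bochner_Integration.integral_add[OF Bochner_Integration.integrable_add[OF i(1,2)] i(3)]
            Bochner_Integration.integral_add[OF i(1,2)] integral_mult_right_zero)
      qed
      also have "\<dots> = r / 4 + (e / d) * G + \<bar>g x0\<bar> * tl n"
        unfolding k_int(2) far_int(2) G_def by simp
      also have "(e / d) * G \<le> r / 4"
      proof -
        have "(e / d) * G = r / 4 * (G / (G + 1))" unfolding e_def using d by simp
        also have "\<dots> \<le> r / 4 * 1" using r G by (intro mult_left_mono) (auto simp: divide_le_eq)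
        finally show ?thesis by simp
      qed
      also have "\<bar>g x0\<bar> * tl n \<le> r / 4"
      proof -
        have "\<bar>g x0\<bar> * tl n \<le> \<bar>g x0\<bar> * (r / (4 * (\<bar>g x0\<bar> + 1)))" using elim(2) by (intro mult_left_mono) auto
        also have "\<dots> = r / 4 * (\<bar>g x0\<bar> / (\<bar>g x0\<bar> + 1))" by simp
        also have "\<dots> \<le> r / 4 * 1" using r by (intro mult_left_mono) (auto simp: divide_le_eq)
        finally show ?thesis by simp
      qed
      finally show ?case using r by simp
    qed
    then show "\<exists>N. \<forall>n\<ge>N. norm ((\<integral>x. g x * K ((x0 - x) / h n) \<partial>lborel) / h n - g x0) < r"
      unfolding eventually_sequentially .
  qed
qed

section \<open>Almost sure convergence\<close>

lemma dyadic_index: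
  assumes "1 \<le> (n::nat)"
  obtains k where "n < 2 ^ k" "2 ^ k \<le> 2 * n" "1 \<le> k"
proof -
  obtain j where "2 ^ j \<le> n" "n < 2 ^ Suc j"
    using ex_power_ivl1[of 2 n] assms by auto
  then show thesis using that[of "Suc j"] by simp
qed

section \<open>Centred sums, uniformly over dyadic blocks and bandwidths\<close>

context regression_model
begin

text \<open>Kept as a functional of the test function \<open>f\<close> of the state, so that
  linearity in \<open>f\<close> and \<open>discretization\<close> apply outcome by outcome. Index 0
  is left out, as in the estimator.\<close>

definition centred_sum :: "(real \<times> real \<Rightarrow> real) \<Rightarrow> 'w \<Rightarrow> nat \<Rightarrow> (real \<Rightarrow> real) \<Rightarrow> real" where
  "centred_sum g \<omega> n f = (\<Sum>i\<in>{0<..n}. g (Z i \<omega>) * f (X i \<omega>)) - real n * (\<integral>x. noise_mean g x * f x \<partial>stat)"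

text \<open>The constant does not deteriorate: this is what makes the variance bound uniform over
  all grid intervals.\<close>

lemma dominated_mult_indicator:
  assumes g: "dominated c g" and B [measurable]: "B \<in> sets borel"
  shows "dominated c (\<lambda>y. g y * indicator B (fst y))"
proof -
  note [measurable] = dominatedD(1)[OF g]
  show ?thesis
    unfolding dominated_def
  proof (intro conjI allI)
    show "(\<integral>\<^sup>+e. ennreal (g (x, e) * indicator B (fst (x, e))) \<partial>density_kernel q x) \<le> ennreal (c * W x)" for x
      by (rule order_trans[OF nn_integral_mono dominatedD(3)[OF g, of x]])
        (use dominatedD(2)[OF g] in \<open>auto simp: indicator_def\<close>)
    show "(\<integral>\<^sup>+e. ennreal ((g (x, e) * indicator B (fst (x, e)))\<^sup>2) \<partial>density_kernel q x) \<le> ennreal (c * V x)" for x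
      by (rule order_trans[OF nn_integral_mono dominatedD(4)[OF g, of x]]) (auto simp: indicator_def)
  qed (use dominatedD(2)[OF g] in \<open>auto simp: indicator_def\<close>)
qed

lemma noise_mean_mult_integrable:
  assumes g: "dominated c g" "0 \<le> c" and f: "f \<in> borel_measurable borel" "bounded (range f)"
  shows "integrable stat (\<lambda>x. noise_mean g x * f x)"
proof -
  note gw = noise_mean_wspace[OF g]
  obtain s where s: "\<And>x. \<bar>f x\<bar> \<le> s" using f(2) unfolding bounded_iff by auto
  have "(\<lambda>x. noise_mean g x * f x) \<in> wspace W"
  proof (rule wspace_mono[OF _ wspace_scale[OF gw, of s]])
    show "(\<lambda>x. noise_mean g x * f x) \<in> borel_measurable borel"
      using wspace_measurable[OF gw] f(1) by measurable
    show "\<bar>noise_mean g x * f x\<bar> \<le> \<bar>s * noise_mean g x\<bar>" for x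
      using mult_right_mono[OF order_trans[OF s abs_ge_self], of "\<bar>noise_mean g x\<bar>" x]
      by (simp add: abs_mult mult.commute)
  qed
  then show ?thesis by (rule integrable_stat)
qed

lemma centred_sum_add:
  assumes "dominated c g" "0 \<le> c"
    and "f \<in> borel_measurable borel" "f' \<in> borel_measurable borel" "bounded (range f)" "bounded (range f')"
  shows "centred_sum g \<omega> n (\<lambda>x. f x + f' x) = centred_sum g \<omega> n f + centred_sum g \<omega> n f'"
  unfolding centred_sum_def
  using Bochner_Integration.integral_add[OF noise_mean_mult_integrable[OF assms(1,2,3,5)] noise_mean_mult_integrable[OF assms(1,2,4,6)]]
  by (simp add: distrib_left sum.distrib)

lemma centred_sum_scale:
  "centred_sum g \<omega> n (\<lambda>x. a * f x) = a * centred_sum g \<omega> n f"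
proof -
  have "(\<integral>x. noise_mean g x * (a * f x) \<partial>stat) = (\<integral>x. a * (noise_mean g x * f x) \<partial>stat)"
    by (intro Bochner_Integration.integral_cong) auto
  also have "\<dots> = a * (\<integral>x. noise_mean g x * f x \<partial>stat)" by (rule integral_mult_right_zero)
  finally show ?thesis
    unfolding centred_sum_def by (simp add: right_diff_distrib sum_distrib_left mult_ac)
qed

text \<open>Since \<open>g\<close> is nonnegative, the sum is at most \<open>s\<close> times the sum
  of the \<open>g (Z i \<omega>)\<close>. The latter is \<open>n * stat_mean g\<close> plus the
  centred sum of the constant 1, hence subject to the same variance estimates; the centring
  contributes the second \<open>n * stat_mean g\<close>.\<close>

lemma centred_sum_bound:
  assumes g: "dominated c g" "0 \<le> c" and f: "f \<in> borel_measurable borel" "\<And>x. \<bar>f x\<bar> \<le> s"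
  shows "\<bar>centred_sum g \<omega> n f\<bar> \<le> (centred_sum g \<omega> n (\<lambda>x. 1) + 2 * (real n * stat_mean g)) * s"
proof -
  note g0 = dominatedD(2)[OF g(1)] and gw = noise_mean_wspace[OF g]
  have bdd: "bounded (range f)" by (rule boundedI[of _ s]) (use f(2) in auto)
  have "\<bar>\<Sum>i\<in>{0<..n}. g (Z i \<omega>) * f (X i \<omega>)\<bar> \<le> (\<Sum>i\<in>{0<..n}. g (Z i \<omega>) * s)"
    using g0 f(2) by (intro order_trans[OF sum_abs] sum_mono) (auto simp: abs_mult intro!: mult_left_mono)
  moreover have "\<bar>\<integral>x. noise_mean g x * f x \<partial>stat\<bar> \<le> stat_mean g * s"
  proof -
    have int: "integrable stat (\<lambda>x. noise_mean g x * f x)" by (rule noise_mean_mult_integrable[OF g f(1) bdd])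
    have "\<bar>\<integral>x. noise_mean g x * f x \<partial>stat\<bar> \<le> (\<integral>x. \<bar>noise_mean g x * f x\<bar> \<partial>stat)" by (rule integral_abs_bound)
    also have "\<dots> \<le> (\<integral>x. noise_mean g x * s \<partial>stat)"
      using noise_mean_nonneg[OF g] f(2) int integrable_stat[OF gw]
      by (intro integral_mono integrable_abs integrable_mult_left) (auto simp: abs_mult intro!: mult_left_mono)
    finally show ?thesis unfolding stat_mean_def by simp
  qed
  then have "\<bar>real n * (\<integral>x. noise_mean g x * f x \<partial>stat)\<bar> \<le> real n * (stat_mean g * s)"
    unfolding abs_mult by (intro mult_mono) auto
  ultimately have "\<bar>centred_sum g \<omega> n f\<bar> \<le> (\<Sum>i\<in>{0<..n}. g (Z i \<omega>)) * s + real n * (stat_mean g * s)"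
    unfolding centred_sum_def sum_distrib_right by linarith
  also have "(\<Sum>i\<in>{0<..n}. g (Z i \<omega>)) = centred_sum g \<omega> n (\<lambda>x. 1) + real n * stat_mean g"
    unfolding centred_sum_def stat_mean_def by simp
  finally show ?thesis by (simp add: algebra_simps)
qed

lemma centred_sum_increment:
  assumes "m \<le> n"
  shows "centred_sum g \<omega> n (indicator B) - centred_sum g \<omega> m (indicator B)
    = (\<Sum>i\<in>{m<..n}. g (Z i \<omega>) * indicator B (X i \<omega>) - stat_mean (\<lambda>y. g y * indicator B (fst y)))"
proof -
  have mean: "stat_mean (\<lambda>y. g y * indicator B (fst y)) = (\<integral>x. noise_mean g x * indicator B x \<partial>stat)"
    unfolding stat_mean_def noise_mean_def by simp
  have "{0<..n} = {0<..m} \<union> {m<..n}" using assms by auto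
  then have "(\<Sum>i\<in>{0<..n}. F i) = (\<Sum>i\<in>{0<..m}. F i) + (\<Sum>i\<in>{m<..n}. F i)" for F :: "nat \<Rightarrow> real"
    by (simp only:) (intro sum.union_disjoint, auto)
  then show ?thesis
    unfolding centred_sum_def mean using assms by (simp add: sum_subtractf of_nat_diff algebra_simps)
qed

text \<open>The majorant of \<open>dyadic_maximal\<close> for the centred sums of one indicator: a
  single random variable dominating all their squares with \<open>n < 2 ^ k\<close>.\<close>

definition dyadic_sq :: "(real \<times> real \<Rightarrow> real) \<Rightarrow> nat \<Rightarrow> real set \<Rightarrow> 'w \<Rightarrow> real" where
  "dyadic_sq g k B \<omega> = real k * (\<Sum>i<k. \<Sum>j<2 ^ (k - i).
     (centred_sum g \<omega> (Suc j * 2 ^ i) (indicator B) - centred_sum g \<omega> (j * 2 ^ i) (indicator B))\<^sup>2)"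

lemma dyadic_sq_nonneg: "0 \<le> dyadic_sq g k B \<omega>"
  unfolding dyadic_sq_def by (intro mult_nonneg_nonneg sum_nonneg) auto

lemma dyadic_sq_bound:
  assumes "n < 2 ^ k"
  shows "(centred_sum g \<omega> n (indicator B))\<^sup>2 \<le> dyadic_sq g k B \<omega>"
proof -
  have "centred_sum g \<omega> 0 (indicator B) = 0" unfolding centred_sum_def by simp
  then show ?thesis
    using dyadic_maximal[OF assms, of "\<lambda>n. centred_sum g \<omega> n (indicator B)"] unfolding dyadic_sq_def by simp
qed

text \<open>Level \<open>i\<close> has \<open>2 ^ (k - i)\<close> blocks of length
  \<open>2 ^ i\<close> and contributes at most \<open>D * 2 ^ k\<close> whatever \<open>i\<close>
  is; the \<open>k\<close> levels and the factor \<open>k\<close> of the chaining give the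
  square.\<close>

lemma dyadic_sq_expectation:
  assumes c: "0 \<le> c"
  obtains D where "0 \<le> D"
    "\<And>g k B. dominated c g \<Longrightarrow> B \<in> sets borel \<Longrightarrow>
       integrable M (dyadic_sq g k B) \<and> (\<integral>\<omega>. dyadic_sq g k B \<omega> \<partial>M) \<le> D * (real k)\<^sup>2 * 2 ^ k"
proof -
  obtain D where D: "0 \<le> D"
    "\<And>g m n. dominated c g \<Longrightarrow> m \<le> n \<Longrightarrow>
       integrable M (\<lambda>\<omega>. (\<Sum>i\<in>{m<..n}. g (Z i \<omega>) - stat_mean g)\<^sup>2) \<and>
       (\<integral>\<omega>. (\<Sum>i\<in>{m<..n}. g (Z i \<omega>) - stat_mean g)\<^sup>2 \<partial>M) \<le> D * real (n - m)"
    using variance_bound[OF c] by blast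
  show thesis
  proof (rule that[OF D(1)])
    fix g k and B :: "real set" assume g: "dominated c g" and B: "B \<in> sets borel"
    let ?T = "\<lambda>i j \<omega>. (centred_sum g \<omega> (Suc j * 2 ^ i) (indicator B) - centred_sum g \<omega> (j * 2 ^ i) (indicator B))\<^sup>2"
    have T: "integrable M (?T i j)" "(\<integral>\<omega>. ?T i j \<omega> \<partial>M) \<le> D * 2 ^ i" for i j
      using D(2)[OF dominated_mult_indicator[OF g B], of "j * 2 ^ i" "Suc j * 2 ^ i"]
      by (simp_all add: centred_sum_increment)
    have "(\<integral>\<omega>. dyadic_sq g k B \<omega> \<partial>M) = real k * (\<Sum>i<k. \<Sum>j<2 ^ (k - i). \<integral>\<omega>. ?T i j \<omega> \<partial>M)"
      unfolding dyadic_sq_def using T(1) by simp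
    also have "\<dots> \<le> real k * (\<Sum>i<k. \<Sum>j<(2::nat) ^ (k - i). D * 2 ^ i)"
      by (intro mult_left_mono sum_mono T) auto
    also have "(\<Sum>i<k. \<Sum>j<(2::nat) ^ (k - i). D * 2 ^ i) = (\<Sum>i<k. D * 2 ^ k)"
      by (intro sum.cong) (auto simp flip: power_add)
    also have "real k * \<dots> = D * (real k)\<^sup>2 * 2 ^ k" by (simp add: power2_eq_square)
    finally show "integrable M (dyadic_sq g k B) \<and> (\<integral>\<omega>. dyadic_sq g k B \<omega> \<partial>M) \<le> D * (real k)\<^sup>2 * 2 ^ k"
      unfolding dyadic_sq_def using T(1) by simp
  qed
qed

text \<open>All large \<open>n\<close> with \<open>2 ^ (k - 1) \<le> n < 2 ^ k\<close> are handled
  by one random variable \<open>H k\<close> and deterministic rates, so it is enough that the single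
  sequence \<open>w k * H k\<close> tends to zero almost surely.\<close>

theorem smoothed_sum_convergence:
  fixes K :: "real \<Rightarrow> real" and h :: "nat \<Rightarrow> real"
  assumes g: "dominated c g" and c: "0 \<le> c"
    and K_meas [measurable]: "K \<in> borel_measurable borel" and K0: "\<And>x. 0 \<le> K x" and K_bd: "\<And>x. K x \<le> \<kappa>"
    and K_tail: "\<And>x. \<bar>x\<bar> * K x \<le> \<tau>" and K_lip: "\<And>x y. \<bar>K x - K y\<bar> \<le> l * \<bar>x - y\<bar>"
    and h_pos: "\<And>n. n \<ge> 1 \<Longrightarrow> h n > 0"
    and \<beta>: "0 < \<beta>" "\<beta> < 1/4" and h: "h \<sim>[at_top] (\<lambda>n. real n powr (-\<beta>))"
  shows "AE \<omega> in M. (\<lambda>n. centred_sum g \<omega> n (\<lambda>x. K ((x0 - x) / h n)) / (real n * h n)) \<longlonglongrightarrow> 0"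
proof -
  obtain D where D: "0 \<le> D"
    "\<And>k B. B \<in> sets borel \<Longrightarrow>
       integrable M (dyadic_sq g k B) \<and> (\<integral>\<omega>. dyadic_sq g k B \<omega> \<partial>M) \<le> D * (real k)\<^sup>2 * 2 ^ k"
    using dyadic_sq_expectation[OF c] g by metis
  have \<kappa>: "0 \<le> \<kappa>" using K0 K_bd order_trans by blast
  have \<tau>: "0 \<le> \<tau>" using K_tail[of 0] by simp
  have l: "0 \<le> l" using K_lip[of 1 0] by (auto intro: order_trans[OF abs_ge_zero])
  define \<theta> where "\<theta> = stat_mean g"
  have \<theta>: "0 \<le> \<theta>"
    unfolding \<theta>_def stat_mean_def using noise_mean_nonneg[OF g c] by (intro Bochner_Integration.integral_nonneg)
  \<comment> \<open>For \<open>n < 2\<^sup>k\<close> the grid has \<open>2\<^sup>k\<close> cells in \<open>(x0 - k, x0 + k]\<close>: any half-width tending to infinity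
    slowly and any mesh of order \<open>o(h\<^sup>2)\<close> would do.\<close>
  define t where "t = (\<lambda>k j. x0 - real k + real j * (2 * real k / real (2 ^ k)))"
  define B where "B = (\<lambda>k j. {t k j<..t k (2 ^ k)})"
  \<comment> \<open>One summand for each random quantity that \<open>discretization\<close>
    produces: the mean square over the grid intervals, the full grid interval of the boundary term,
    and the whole line for the factor \<open>T\<close>.\<close>
  define H where "H = (\<lambda>k \<omega>. (\<Sum>j<2 ^ k. dyadic_sq g k (B k (Suc j)) \<omega>) / 2 ^ k
     + dyadic_sq g k (B k 0) \<omega> + dyadic_sq g k UNIV \<omega>)"
  \<comment> \<open>Its square root is the order of \<open>k / (n h\<^sup>2)\<close>, with which a
    centred sum enters: \<open>n\<close> is of order \<open>2 ^ k\<close> and \<open>h\<close> of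
    order \<open>2 powr (- \<beta> k)\<close>. As \<open>H k\<close> has mean at most of order
    \<open>k\<^sup>2 * 2 ^ k\<close>, the product has mean at most of order
    \<open>k ^ 4 * 2 powr (- (1 - 4 \<beta>) k)\<close>, which is summable for
    \<open>\<beta> < 1/4\<close>.\<close>
  define w where "w = (\<lambda>k. (real k)\<^sup>2 * 2 powr (- 2 * real k * (1 - 2 * \<beta>)))"
  have B_sets: "B k j \<in> sets borel" for k j unfolding B_def by simp
  have H0: "0 \<le> H k \<omega>" for k \<omega>
    unfolding H_def by (intro add_nonneg_nonneg divide_nonneg_nonneg sum_nonneg dyadic_sq_nonneg) auto
  have H_int: "integrable M (H k)" for k
    unfolding H_def using D(2) B_sets by simp
  have H_exp: "(\<integral>\<omega>. H k \<omega> \<partial>M) \<le> 3 * (D * (real k)\<^sup>2 * 2 ^ k)" for k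
  proof -
    let ?e = "D * (real k)\<^sup>2 * 2 ^ k"
    have "(\<integral>\<omega>. H k \<omega> \<partial>M) = (\<Sum>j<2 ^ k. \<integral>\<omega>. dyadic_sq g k (B k (Suc j)) \<omega> \<partial>M) / 2 ^ k
        + (\<integral>\<omega>. dyadic_sq g k (B k 0) \<omega> \<partial>M) + (\<integral>\<omega>. dyadic_sq g k UNIV \<omega> \<partial>M)"
      unfolding H_def using D(2) B_sets by simp
    also have "\<dots> \<le> (\<Sum>j<(2::nat) ^ k. ?e) / 2 ^ k + ?e + ?e"
      using D(2) B_sets by (intro add_mono divide_right_mono sum_mono) auto
    also have "\<dots> = 3 * ?e" by simp
    finally show ?thesis .
  qed
  have w0: "0 \<le> w k" for k unfolding w_def by simp
  have "summable (\<lambda>k. \<integral>\<omega>. w k * H k \<omega> \<partial>M)"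
  proof (rule summable_comparison_test')
    define \<eta> where "\<eta> = 1 - 4 * \<beta>"
    have \<eta>: "0 < \<eta>" unfolding \<eta>_def using \<beta> by simp
    have bigo: "(\<lambda>k. real k ^ 4 * 2 powr (- \<eta> * real k)) \<in> O(\<lambda>k. 1 / real k ^ 2)"
      using \<eta> by real_asymp
    have "summable (\<lambda>k. norm (1 / real k ^ 2))"
      using inverse_power_summable[of 2, where 'a = real] by (simp add: inverse_eq_divide)
    from summable_comparison_test_bigo[OF this bigo] have "summable (\<lambda>k. real k ^ 4 * 2 powr (- \<eta> * real k))" .
    then show "summable (\<lambda>k. 3 * D * (real k ^ 4 * 2 powr (- \<eta> * real k)))" by (rule summable_mult)
    fix k :: nat
    have "norm (\<integral>\<omega>. w k * H k \<omega> \<partial>M) = w k * (\<integral>\<omega>. H k \<omega> \<partial>M)"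
      using w0 H0 by (simp add: abs_mult Bochner_Integration.integral_nonneg)
    also have "\<dots> \<le> w k * (3 * (D * (real k)\<^sup>2 * 2 ^ k))" by (intro mult_left_mono H_exp w0)
    also have "\<dots> = 3 * D * (real k ^ 4 * (2 powr (- 2 * real k * (1 - 2 * \<beta>)) * 2 powr (real k)))"
      unfolding w_def by (simp add: powr_realpow power4_eq_xxxx power2_eq_square)
    also have "2 powr (- 2 * real k * (1 - 2 * \<beta>)) * 2 powr (real k) = 2 powr (- \<eta> * real k)"
      unfolding powr_add[symmetric] \<eta>_def by (simp add: algebra_simps)
    finally show "norm (\<integral>\<omega>. w k * H k \<omega> \<partial>M) \<le> 3 * D * (real k ^ 4 * 2 powr (- \<eta> * real k))" .
  qed
  then have "AE \<omega> in M. (\<lambda>k. w k * H k \<omega>) \<longlonglongrightarrow> 0"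
    using H_int H0 w0 by (intro AE_tendsto_0_summable) auto
  moreover have "(\<lambda>n. centred_sum g \<omega> n (\<lambda>x. K ((x0 - x) / h n)) / (real n * h n)) \<longlonglongrightarrow> 0"
    if wH: "(\<lambda>k. w k * H k \<omega>) \<longlonglongrightarrow> 0" for \<omega>
  proof -
    define S where "S = (\<lambda>k. sqrt (H k \<omega>))"
    define s where "s = (\<lambda>k. real k * 2 powr (- real k * (1 - 2 * \<beta>)) * S k)"
    have S0: "0 \<le> S k" for k unfolding S_def using H0 by simp
    have s_eq: "s k = sqrt (w k * H k \<omega>)" for k
    proof -
      have "(s k)\<^sup>2 = w k * H k \<omega>"
        unfolding s_def S_def w_def using H0
        by (simp add: power_mult_distrib powr_power) (simp add: algebra_simps)
      moreover have "0 \<le> s k" unfolding s_def using S0 by simp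
      ultimately show ?thesis by (simp add: real_sqrt_unique)
    qed
    have s_lim: "s \<longlonglongrightarrow> 0" unfolding s_eq using tendsto_real_sqrt[OF wH] by simp
    \<comment> \<open>For \<open>n = 0\<close> there is no such exponent and the value is
      unspecified; all uses have \<open>1 \<le> n\<close>.\<close>
    define kk where "kk = (\<lambda>n. SOME k. n < (2::nat) ^ k \<and> 2 ^ k \<le> 2 * n \<and> 1 \<le> k)"
    have kk: "n < 2 ^ kk n" "2 ^ kk n \<le> 2 * n" "1 \<le> kk n" if "1 \<le> n" for n
      using dyadic_index[OF that] someI_ex[of "\<lambda>k. n < (2::nat) ^ k \<and> 2 ^ k \<le> 2 * n \<and> 1 \<le> k"]
      unfolding kk_def by metis+
    have kk_lim: "filterlim kk at_top sequentially"
      unfolding filterlim_at_top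
    proof
      fix Z :: nat
      show "\<forall>\<^sub>F n in sequentially. Z \<le> kk n"
        using eventually_ge_at_top[of "2 ^ Z + 1"]
      proof eventually_elim
        case (elim n)
        then have "(2::nat) ^ Z < 2 ^ kk n" using kk(1)[of n] by linarith
        then show ?case using power_less_imp_less_exp[of 2 Z "kk n"] by simp
      qed
    qed
    have h_low: "\<forall>\<^sub>F n in sequentially. real n powr (-\<beta>) / 2 \<le> h n"
    proof -
      have "(\<lambda>n. h n / real n powr (-\<beta>)) \<longlonglongrightarrow> 1"
        using h by (intro asymp_equivD_strong) (auto intro: eventually_mono[OF eventually_gt_at_top[of 0]])
      then have "\<forall>\<^sub>F n in sequentially. 1/2 < h n / real n powr (-\<beta>)" by (intro order_tendstoD) auto
      then show ?thesis
        using eventually_gt_at_top[of 0]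
      proof eventually_elim
        case (elim n)
        then show ?case by (simp add: field_simps)
      qed
    qed
    have h_lim: "h \<longlonglongrightarrow> 0"
    proof -
      have "(\<lambda>n. real n powr (-\<beta>)) \<longlonglongrightarrow> 0" using \<beta> by real_asymp
      then show ?thesis using tendsto_asymp_equiv_cong[OF h] by blast
    qed
    have h_up: "\<forall>\<^sub>F n in sequentially. h n < 1" by (intro order_tendstoD(2)[OF h_lim]) simp
    \<comment> \<open>Both factors 8 are 2 times 4. The 4 comes from squaring
      \<open>h n \<ge> n powr (-\<beta>) / 2\<close>; the 2 comes from
      \<open>n \<ge> 2 ^ k / 2\<close> in \<open>A\<close> and from the mesh
      \<open>2 * k / 2 ^ k\<close> in \<open>E\<close>. The term \<open>\<tau> / k\<close> accounts
      for the kernel outside the grid.\<close>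
    define A where "A = (\<lambda>n. 8 * s (kk n))"
    define E where "E = (\<lambda>n. l * (8 * (real (kk n) * 2 powr (- real (kk n) * (1 - 2 * \<beta>)))) + \<tau> / real (kk n))"
    have A_lim: "A \<longlonglongrightarrow> 0"
      unfolding A_def using tendsto_mult_left[OF filterlim_compose[OF s_lim kk_lim], of 8] by simp
    have E_lim: "E \<longlonglongrightarrow> 0"
    proof -
      define \<gamma> where "\<gamma> = 1 - 2 * \<beta>"
      have "0 < \<gamma>" using \<beta> unfolding \<gamma>_def by simp
      then have "(\<lambda>k. real k * 2 powr (- real k * \<gamma>)) \<longlonglongrightarrow> 0" by real_asymp
      then have "(\<lambda>k. l * (8 * (real k * 2 powr (- real k * \<gamma>))) + \<tau> / real k) \<longlonglongrightarrow> l * (8 * 0) + 0"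
        by (intro tendsto_intros lim_const_over_n)
      then have "(\<lambda>k. l * (8 * (real k * 2 powr (- real k * (1 - 2 * \<beta>)))) + \<tau> / real k) \<longlonglongrightarrow> 0"
        unfolding \<gamma>_def by simp
      then show ?thesis unfolding E_def by (rule filterlim_compose[OF _ kk_lim])
    qed
    have bound: "\<forall>\<^sub>F n in sequentially. \<bar>centred_sum g \<omega> n (\<lambda>x. K ((x0 - x) / h n)) / (real n * h n)\<bar>
        \<le> (A n + 2 * \<theta>) * E n + (\<kappa> + 2 * l) * A n"
      using h_low h_up eventually_ge_at_top[of 1]
    proof eventually_elim
      case (elim n)
      define k where "k = kk n"
      define s' where "s' = S k"
      have k: "n < 2 ^ k" "2 ^ k \<le> 2 * n" "1 \<le> k" using kk[OF elim(3)] unfolding k_def by auto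
      have n: "1 \<le> real n" using elim(3) by simp
      have hn: "0 < h n" "h n < 1" using h_pos[OF elim(3)] elim(2) by auto
      have s'0: "0 \<le> s'" unfolding s'_def by (rule S0)
      let ?L = "centred_sum g \<omega> n"
      have sq_le: "(?L (indicator U))\<^sup>2 \<le> dyadic_sq g k U \<omega>" for U by (rule dyadic_sq_bound[OF k(1)])
      have single: "\<bar>?L (indicator U)\<bar> \<le> s'" if "dyadic_sq g k U \<omega> \<le> H k \<omega>" for U
        unfolding s'_def S_def using order_trans[OF sq_le that] by (intro real_le_rsqrt) simp
      have sum0: "0 \<le> (\<Sum>j<2 ^ k. dyadic_sq g k (B k (Suc j)) \<omega>) / 2 ^ k"
        by (intro divide_nonneg_nonneg sum_nonneg dyadic_sq_nonneg) auto
      have L0: "\<bar>?L (indicator (B k 0))\<bar> \<le> s'" and L1: "\<bar>?L (indicator UNIV)\<bar> \<le> s'"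
        using sum0 dyadic_sq_nonneg[of g k "B k 0" \<omega>] dyadic_sq_nonneg[of g k UNIV \<omega>]
        by (intro single; simp add: H_def)+
      \<comment> \<open>Cauchy-Schwarz over the \<open>2 ^ k\<close> intervals: the average of the
        squares is controlled by the first summand of \<open>H\<close>, so no maximum over the grid
        is taken.\<close>
      have Lsum: "(\<Sum>j<2 ^ k. \<bar>?L (indicator (B k (Suc j)))\<bar>) \<le> 2 ^ k * s'"
      proof -
        have "(\<Sum>j<2 ^ k. \<bar>?L (indicator (B k (Suc j)))\<bar>)\<^sup>2 \<le> (\<Sum>j<2 ^ k. \<bar>?L (indicator (B k (Suc j)))\<bar>\<^sup>2) * 2 ^ k"
          using sum_squared_le_sum_of_squares[of "\<lambda>j. \<bar>?L (indicator (B k (Suc j)))\<bar>" "{..<2 ^ k}"] by simp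
        also have "\<dots> \<le> (\<Sum>j<2 ^ k. dyadic_sq g k (B k (Suc j)) \<omega>) * 2 ^ k"
          using sq_le by (intro mult_right_mono sum_mono) auto
        also have "\<dots> = (\<Sum>j<2 ^ k. dyadic_sq g k (B k (Suc j)) \<omega>) / 2 ^ k * (2 ^ k)\<^sup>2"
          by (simp add: power2_eq_square)
        also have "\<dots> \<le> H k \<omega> * (2 ^ k)\<^sup>2"
          using dyadic_sq_nonneg[of g k "B k 0" \<omega>] dyadic_sq_nonneg[of g k UNIV \<omega>]
          by (intro mult_right_mono) (auto simp: H_def)
        also have "\<dots> = (2 ^ k * s')\<^sup>2" unfolding s'_def S_def using H0 by (simp add: power_mult_distrib)
        finally have "(\<Sum>j<2 ^ k. \<bar>?L (indicator (B k (Suc j)))\<bar>)\<^sup>2 \<le> (2 ^ k * s')\<^sup>2" .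
        then show ?thesis by (rule power2_le_imp_le) (simp add: s'0)
      qed
      define f where "f = (\<lambda>x. K ((x0 - x) / h n))"
      define \<delta> where "\<delta> = 2 * real k / 2 ^ k"
      have \<delta>0: "0 \<le> \<delta>" unfolding \<delta>_def by simp
      let ?T = "?L (\<lambda>x. 1) + 2 * (real n * stat_mean g)"
      \<comment> \<open>Rescaling multiplies the Lipschitz constant by \<open>1 / h n\<close>, and
        \<open>\<bar>v\<bar> * K v \<le> \<tau>\<close> at distance at least \<open>k\<close> from
        \<open>x0\<close> gives the tail bound \<open>\<tau> * h n / k\<close>.\<close>
      have disc: "\<bar>?L f\<bar> \<le> ?T * (l / h n * (2 * real k / real (2 ^ k)) + \<tau> * h n / real k)
          + \<kappa> * \<bar>?L (indicator (B k 0))\<bar>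
          + l / h n * (2 * real k / real (2 ^ k)) * (\<Sum>j<2 ^ k. \<bar>?L (indicator (B k (Suc j)))\<bar>)"
        unfolding B_def t_def
      proof (rule discretization)
        show "f \<in> borel_measurable borel" unfolding f_def by measurable
        show "0 \<le> f x" "f x \<le> \<kappa>" for x unfolding f_def by (auto intro: K0 K_bd)
        show "\<bar>f x - f y\<bar> \<le> l / h n * \<bar>x - y\<bar>" for x y
        proof -
          have "(x0 - x) / h n - (x0 - y) / h n = (y - x) / h n" by (simp add: diff_divide_distrib)
          then have "\<bar>(x0 - x) / h n - (x0 - y) / h n\<bar> = \<bar>x - y\<bar> / h n" using hn by simp
          then show ?thesis using K_lip[of "(x0 - x) / h n" "(x0 - y) / h n"] unfolding f_def by simp
        qed
        show "f x \<le> \<tau> * h n / real k" if "real k \<le> \<bar>x - x0\<bar>" for x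
        proof -
          have "real k * K ((x0 - x) / h n) \<le> \<bar>x - x0\<bar> * K ((x0 - x) / h n)"
            using that K0 by (intro mult_right_mono) auto
          also have "\<dots> = h n * (\<bar>(x0 - x) / h n\<bar> * K ((x0 - x) / h n))"
            using hn by (simp add: abs_minus_commute)
          also have "\<dots> \<le> h n * \<tau>" using hn by (intro mult_left_mono K_tail) auto
          finally show ?thesis unfolding f_def using k by (simp add: field_simps)
        qed
        show "\<bar>?L u\<bar> \<le> ?T * v" if "u \<in> borel_measurable borel" "\<And>x. \<bar>u x\<bar> \<le> v" for u v
          by (rule centred_sum_bound[OF g c that])
      qed (use k l \<tau> hn in \<open>auto intro: centred_sum_add[OF g c] centred_sum_scale\<close>)
      have T: "?T \<le> s' + 2 * (real n * \<theta>)"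
        using L1 unfolding \<theta>_def by (simp add: indicator_def[of UNIV] abs_le_iff)
      have "\<bar>?L f\<bar> \<le> (s' + 2 * (real n * \<theta>)) * (l / h n * \<delta> + \<tau> * h n / real k) + \<kappa> * s' + l / h n * \<delta> * (2 ^ k * s')"
      proof -
        have "?T * (l / h n * \<delta> + \<tau> * h n / real k) \<le> (s' + 2 * (real n * \<theta>)) * (l / h n * \<delta> + \<tau> * h n / real k)"
          using T hn \<delta>0 l \<tau> by (intro mult_right_mono) auto
        moreover have "\<kappa> * \<bar>?L (indicator (B k 0))\<bar> \<le> \<kappa> * s'" by (intro mult_left_mono L0 \<kappa>)
        moreover have "l / h n * \<delta> * (\<Sum>j<2 ^ k. \<bar>?L (indicator (B k (Suc j)))\<bar>) \<le> l / h n * \<delta> * (2 ^ k * s')"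
          using hn \<delta>0 l by (intro mult_left_mono Lsum) auto
        ultimately show ?thesis using disc unfolding \<delta>_def by simp
      qed
      also have "l / h n * \<delta> * (2 ^ k * s') = 2 * l * (real k * s') / h n" unfolding \<delta>_def by simp
      finally have "\<bar>?L f\<bar> / (real n * h n)
          \<le> ((s' + 2 * (real n * \<theta>)) * (l / h n * \<delta> + \<tau> * h n / real k) + \<kappa> * s' + 2 * l * (real k * s') / h n) / (real n * h n)"
        using hn n by (intro divide_right_mono) auto
      \<comment> \<open>The last term has \<open>(h n)\<^sup>2\<close> in its denominator, one power
        from the Lipschitz constant and one from the normalisation; mesh times number of cells
        leaves the factor \<open>k\<close>.\<close>
      also have "\<dots> = (s' / real n + 2 * \<theta>) * (l * (\<delta> / (h n)\<^sup>2) + \<tau> / real k)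
          + \<kappa> * (s' / (real n * h n)) + 2 * l * (real k * s' / (real n * (h n)\<^sup>2))"
        using hn n k by (simp add: field_simps power2_eq_square)
      also have "\<dots> \<le> (A n + 2 * \<theta>) * E n + \<kappa> * A n + 2 * l * A n"
      proof -
        have hsq: "real n powr (-2 * \<beta>) / 4 \<le> (h n)\<^sup>2"
        proof -
          have "(real n powr (-\<beta>) / 2)\<^sup>2 \<le> (h n)\<^sup>2" using elim(1) by (intro power_mono) auto
          then show ?thesis by (simp add: power2_eq_square powr_add[symmetric])
        qed
        have n_up: "real n \<le> 2 powr real k" using k(1) by (simp add: powr_realpow less_imp_le)
        have n_low: "2 powr real k / 2 \<le> real n"
          using of_nat_mono[OF k(2), where 'a = real] by (simp add: powr_realpow)
        have hsq_low: "2 powr (- 2 * \<beta> * real k) / 4 \<le> (h n)\<^sup>2"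
        proof -
          have "2 powr (- 2 * \<beta> * real k) = (2 powr real k) powr (- 2 * \<beta>)" by (simp add: powr_powr mult.commute)
          also have "\<dots> \<le> real n powr (- 2 * \<beta>)" using n n_up \<beta> by (intro powr_mono2') auto
          finally show ?thesis using hsq by simp
        qed
        have nh_low: "2 powr (real k * (1 - 2 * \<beta>)) / 8 \<le> real n * (h n)\<^sup>2"
        proof -
          have "2 powr (real k * (1 - 2 * \<beta>)) / 8 = (2 powr real k / 2) * (2 powr (- 2 * \<beta> * real k) / 4)"
            by (simp add: powr_add[symmetric] algebra_simps)
          also have "\<dots> \<le> real n * (h n)\<^sup>2" using n_low hsq_low by (intro mult_mono) auto
          finally show ?thesis .
        qed
        have A_bd: "real k * s' / (real n * (h n)\<^sup>2) \<le> A n"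
        proof -
          have "real k * s' / (real n * (h n)\<^sup>2) \<le> real k * s' / (2 powr (real k * (1 - 2 * \<beta>)) / 8)"
            using nh_low s'0 hn n by (intro divide_left_mono) (auto intro!: mult_pos_pos)
          also have "\<dots> = A n"
            unfolding A_def s_def k_def[symmetric] s'_def minus_mult_left[symmetric] powr_minus
            by (simp add: divide_simps)
          finally show ?thesis .
        qed
        \<comment> \<open>Since \<open>1 \<le> k\<close> and \<open>h n < 1\<close>, the milder
          terms \<open>s' / n\<close> and \<open>s' / (n * h n)\<close> are dominated by the one
          already bounded by \<open>A n\<close>.\<close>
        have ks: "s' \<le> real k * s'" using k(3) s'0 by (simp add: mult_le_cancel_right1)
        have nh: "real n * (h n)\<^sup>2 \<le> real n * h n" "real n * (h n)\<^sup>2 \<le> real n"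
        proof -
          have "(h n)\<^sup>2 \<le> h n"
            using mult_right_mono[of "h n" 1 "h n"] hn by (simp add: power2_eq_square)
          then show "real n * (h n)\<^sup>2 \<le> real n * h n" "real n * (h n)\<^sup>2 \<le> real n"
            using hn n mult_left_mono[of "(h n)\<^sup>2" 1 "real n"] by auto
        qed
        have "s' / real n \<le> real k * s' / (real n * (h n)\<^sup>2)"
          using ks nh s'0 hn n by (intro frac_le) auto
        then have b1: "s' / real n \<le> A n" using A_bd by linarith
        have "s' / (real n * h n) \<le> real k * s' / (real n * (h n)\<^sup>2)"
          using ks nh s'0 hn n by (intro frac_le) auto
        then have b2: "s' / (real n * h n) \<le> A n" using A_bd by linarith
        have b3: "\<delta> / (h n)\<^sup>2 \<le> 8 * (real k * 2 powr (- real k * (1 - 2 * \<beta>)))"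
        proof -
          have "\<delta> / (h n)\<^sup>2 \<le> \<delta> / (2 powr (- 2 * \<beta> * real k) / 4)"
            using hsq_low \<delta>0 hn by (intro divide_left_mono) (auto intro!: mult_pos_pos)
          also have "\<dots> = 8 * (real k * (2 powr (- real k) * 2 powr (2 * \<beta> * real k)))"
            unfolding \<delta>_def by (simp add: powr_minus powr_realpow field_simps)
          also have "2 powr (- real k) * 2 powr (2 * \<beta> * real k) = 2 powr (- real k * (1 - 2 * \<beta>))"
            unfolding powr_add[symmetric] by (simp add: algebra_simps)
          finally show ?thesis .
        qed
        have b4: "l * (\<delta> / (h n)\<^sup>2) + \<tau> / real k \<le> E n"
          unfolding E_def k_def[symmetric] by (intro add_right_mono mult_left_mono b3 l)
        have A0: "0 \<le> A n" using b1 s'0 n by (meson divide_nonneg_nonneg order_trans zero_le_one)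
        have E0: "0 \<le> l * (\<delta> / (h n)\<^sup>2) + \<tau> / real k" using l \<delta>0 \<tau> by simp
        show ?thesis
          using b1 b2 b4 A_bd A0 E0 \<theta> \<kappa> l by (intro add_mono mult_mono mult_left_mono) auto
      qed
      also have "\<dots> = (A n + 2 * \<theta>) * E n + (\<kappa> + 2 * l) * A n" by (simp add: algebra_simps)
      finally show ?case using hn n unfolding f_def by (simp add: abs_mult)
    qed
    have "(\<lambda>n. (A n + 2 * \<theta>) * E n + (\<kappa> + 2 * l) * A n) \<longlonglongrightarrow> (0 + 2 * \<theta>) * 0 + (\<kappa> + 2 * l) * 0"
      by (intro tendsto_intros A_lim E_lim)
    then have "(\<lambda>n. (A n + 2 * \<theta>) * E n + (\<kappa> + 2 * l) * A n) \<longlonglongrightarrow> 0" by simp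
    then show ?thesis by (rule Lim_null_comparison[rotated]) (use bound in simp)
  qed
  ultimately show ?thesis by (rule eventually_mono)
qed

lemma regression_convergence:
  fixes r \<psi> K :: "real \<Rightarrow> real" and h :: "nat \<Rightarrow> real" and \<beta> x0 :: real
  assumes r [measurable]: "r \<in> borel_measurable borel" and \<psi> [measurable]: "\<psi> \<in> borel_measurable borel"
    and Y: "\<And>i \<omega>. Y i \<omega> = r (X i \<omega>) + \<epsilon> i \<omega>"
    and K0: "\<And>x. 0 \<le> K x" and K1: "has_bochner_integral lborel K 1"
    and h_pos: "\<And>n. n \<ge> 1 \<Longrightarrow> h n > 0"
    and mom1: "(SUP x. ennreal (V x powr (-1/2) * (1 + \<bar>x\<bar>)) * nn_cond_mean r q (\<lambda>y. \<bar>\<psi> y\<bar>) x) < \<infinity>"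
    and mom2: "(SUP x. ennreal (inverse (V x)) * nn_cond_mean r q (\<lambda>y. (\<psi> y)\<^sup>2) x) < \<infinity>"
    and K_bdd: "bdd_above (range K)"
    and K_tail: "((\<lambda>x. \<bar>x\<bar> * K x) \<longlongrightarrow> 0) at_infinity"
    and K_lip: "bdd_above {\<bar>K x - K x'\<bar> / \<bar>x - x'\<bar> | x x'. x \<noteq> x'}"
    and \<beta>: "0 < \<beta>" "\<beta> < 1/4"
    and h: "h \<sim>[at_top] (\<lambda>n. real n powr (-\<beta>))"
    and cont: "isCont (\<lambda>x. \<pi> x * cond_mean r q \<psi> x) x0"
  shows "AE \<omega> in M. (\<lambda>n. kernel_estimator K h \<psi> X Y x0 n \<omega>) \<longlonglongrightarrow> \<pi> x0 * cond_mean r q \<psi> x0"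
proof -
  have [measurable]: "K \<in> borel_measurable borel"
    using K1 by (auto simp: has_bochner_integral_iff dest!: borel_measurable_integrable)
  have V0: "0 < V x" for x using V_ge1[of x] by linarith
  have nn_cond_mean_eq: "nn_cond_mean r q U x = (\<integral>\<^sup>+e. ennreal (U (r x + e)) \<partial>density_kernel q x)"
    if [measurable]: "U \<in> borel_measurable borel" for U x
    unfolding nn_cond_mean_def
    by (subst nn_integral_noise) (auto simp: ennreal_mult'[OF q_nonneg] mult.commute intro!: nn_integral_cong)
  obtain s1 where s1: "0 \<le> s1"
    "(SUP x. ennreal (V x powr (-1/2) * (1 + \<bar>x\<bar>)) * nn_cond_mean r q (\<lambda>y. \<bar>\<psi> y\<bar>) x) = ennreal s1"
    using mom1 by (auto simp: less_top_ennreal)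
  obtain s2 where s2: "0 \<le> s2" "(SUP x. ennreal (inverse (V x)) * nn_cond_mean r q (\<lambda>y. (\<psi> y)\<^sup>2) x) = ennreal s2"
    using mom2 by (auto simp: less_top_ennreal)
  define c where "c = max s1 s2"
  have c: "0 \<le> c" unfolding c_def using s1 by simp
  \<comment> \<open>\<open>V x powr (-1/2)\<close> is \<open>1 / W x\<close>, so multiplying the
    supremum bound by \<open>W x\<close> leaves a first moment of order \<open>W\<close>.\<close>
  have m1: "(\<integral>\<^sup>+e. ennreal \<bar>\<psi> (r x + e)\<bar> \<partial>density_kernel q x) \<le> ennreal (c * W x)" for x
  proof -
    let ?N = "nn_cond_mean r q (\<lambda>y. \<bar>\<psi> y\<bar>) x" and ?a = "V x powr (-1/2) * (1 + \<bar>x\<bar>)"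
    have "V x powr (-1/2) = inverse (W x)" using V0[of x] by (simp add: powr_minus powr_half_sqrt)
    moreover have "W x \<noteq> 0" using W_pos[of x] by linarith
    ultimately have "W x * ?a = 1 + \<bar>x\<bar>" by (simp only: mult.assoc[symmetric] right_inverse mult_1_left not_False_eq_True)
    then have "1 \<le> W x * ?a" by linarith
    then have "1 \<le> ennreal (W x * ?a)" by (simp only: ennreal_ge_1)
    then have "1 * ?N \<le> ennreal (W x * ?a) * ?N" by (intro mult_right_mono) auto
    also have "\<dots> = ennreal (W x) * (ennreal ?a * ?N)"
      using W_pos[of x] by (simp add: ennreal_mult mult.assoc less_imp_le)
    also have "ennreal ?a * ?N \<le> ennreal s1" unfolding s1(2)[symmetric] by (rule SUP_upper) simp
    also have "ennreal (W x) * ennreal s1 = ennreal (s1 * W x)"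
      using W_pos[of x] s1(1) by (simp add: ennreal_mult mult.commute less_imp_le)
    also have "\<dots> \<le> ennreal (c * W x)"
      using W_pos[of x] unfolding c_def by (intro ennreal_leI mult_right_mono) (auto simp: less_imp_le)
    finally show ?thesis by (simp add: nn_cond_mean_eq mult_left_mono)
  qed
  have m2: "(\<integral>\<^sup>+e. ennreal ((\<psi> (r x + e))\<^sup>2) \<partial>density_kernel q x) \<le> ennreal (c * V x)" for x
  proof -
    let ?N = "nn_cond_mean r q (\<lambda>y. (\<psi> y)\<^sup>2) x"
    have "?N = ennreal (V x * inverse (V x)) * ?N" using V0[of x] by simp
    also have "\<dots> = ennreal (V x) * (ennreal (inverse (V x)) * ?N)"
      using V0[of x] by (simp only: ennreal_mult less_imp_le inverse_nonnegative_iff_nonnegative mult.assoc)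
    also have "ennreal (inverse (V x)) * ?N \<le> ennreal s2" unfolding s2(2)[symmetric] by (rule SUP_upper) simp
    also have "ennreal (V x) * ennreal s2 = ennreal (s2 * V x)"
      using V0[of x] s2(1) by (simp add: ennreal_mult mult.commute less_imp_le)
    also have "\<dots> \<le> ennreal (c * V x)"
      using V0[of x] unfolding c_def by (intro ennreal_leI mult_right_mono) (auto simp: less_imp_le)
    finally show ?thesis by (simp add: nn_cond_mean_eq mult_left_mono)
  qed
  \<comment> \<open>\<open>g 1\<close> and \<open>g (-1)\<close> are the positive and negative parts
    of \<open>\<psi> (Y)\<close> as functions of state and noise; the sign parameter lets one proof
    of domination serve both.\<close>
  define g where "g = (\<lambda>(\<sigma>::real) y. max (\<sigma> * \<psi> (r (fst y) + snd y)) 0)"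
  have g_meas [measurable]: "g \<sigma> \<in> borel_measurable (borel \<Otimes>\<^sub>M borel)" for \<sigma> unfolding g_def by measurable
  have g_dom: "dominated c (g \<sigma>)" if \<sigma>: "\<bar>\<sigma>\<bar> = 1" for \<sigma>
    unfolding dominated_def
  proof (intro conjI allI)
    have le: "0 \<le> g \<sigma> (x, e)" "g \<sigma> (x, e) \<le> \<bar>\<psi> (r x + e)\<bar>" for x e
      unfolding g_def using \<sigma> by (auto simp: abs_if split: if_splits)
    show "(\<integral>\<^sup>+e. ennreal (g \<sigma> (x, e)) \<partial>density_kernel q x) \<le> ennreal (c * W x)" for x
      using le by (intro order_trans[OF nn_integral_mono m1] ennreal_leI)
    show "(\<integral>\<^sup>+e. ennreal ((g \<sigma> (x, e))\<^sup>2) \<partial>density_kernel q x) \<le> ennreal (c * V x)" for x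
    proof (rule order_trans[OF nn_integral_mono m2], rule ennreal_leI)
      show "(g \<sigma> (x, e))\<^sup>2 \<le> (\<psi> (r x + e))\<^sup>2" for e using power_mono[OF le(2,1)[of x e], where n = 2] by simp
    qed
    show "0 \<le> g \<sigma> y" for y unfolding g_def by simp
  qed measurable
  have g_pos: "dominated c (g 1)" and g_neg: "dominated c (g (-1))" by (simp_all add: g_dom)
  have g_diff: "g 1 (x, e) - g (-1) (x, e) = \<psi> (r x + e)" for x e unfolding g_def by simp
  have mean_diff: "noise_mean (g 1) x - noise_mean (g (-1)) x = cond_mean r q \<psi> x" for x
  proof -
    have int: "integrable (density_kernel q x) (\<lambda>e. g \<sigma> (x, e))" if "\<bar>\<sigma>\<bar> = 1" for \<sigma>
      using dominatedD(2)[OF g_dom[OF that]] le_less_trans[OF dominatedD(3)[OF g_dom[OF that]] ennreal_less_top]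
      by (intro integrableI_nonneg) auto
    have "noise_mean (g 1) x - noise_mean (g (-1)) x = (\<integral>e. g 1 (x, e) - g (-1) (x, e) \<partial>density_kernel q x)"
      unfolding noise_mean_def by (intro Bochner_Integration.integral_diff[symmetric] int) auto
    also have "\<dots> = (\<integral>e. q x e *\<^sub>R \<psi> (r x + e) \<partial>lborel)"
      unfolding g_diff density_kernel_def using q_nonneg by (subst integral_density) auto
    finally show ?thesis unfolding cond_mean_def by (simp add: mult.commute)
  qed
  \<comment> \<open>The two stationary integrals are recombined and rewritten with the density, so
    that the bias involves only \<open>\<pi> x * cond_mean r q \<psi> x\<close>, the function
    assumed continuous at \<open>x0\<close>.\<close>
  have stat_int: "integrable lborel (\<lambda>x. \<pi> x * (cond_mean r q \<psi> x * f x))"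
    "(\<integral>x. noise_mean (g 1) x * f x \<partial>stat) - (\<integral>x. noise_mean (g (-1)) x * f x \<partial>stat)
      = (\<integral>x. \<pi> x * (cond_mean r q \<psi> x * f x) \<partial>lborel)"
    if f [measurable]: "f \<in> borel_measurable borel" and bdd: "bounded (range f)" for f
  proof -
    note [measurable] = wspace_measurable[OF noise_mean_wspace[OF g_pos c]] wspace_measurable[OF noise_mean_wspace[OF g_neg c]]
    note i = noise_mean_mult_integrable[OF g_pos c f bdd] noise_mean_mult_integrable[OF g_neg c f bdd]
    have eq: "noise_mean (g 1) x * f x - noise_mean (g (-1)) x * f x = cond_mean r q \<psi> x * f x" for x
      unfolding mean_diff[symmetric] by (simp add: left_diff_distrib)
    have meas: "(\<lambda>x. cond_mean r q \<psi> x * f x) \<in> borel_measurable lborel" unfolding eq[symmetric] by measurable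
    have "integrable stat (\<lambda>x. cond_mean r q \<psi> x * f x)"
      unfolding eq[symmetric] by (intro Bochner_Integration.integrable_diff i)
    then show "integrable lborel (\<lambda>x. \<pi> x * (cond_mean r q \<psi> x * f x))"
      using meas pi_nonneg by (subst (asm) integrable_density) auto
    have "(\<integral>x. noise_mean (g 1) x * f x \<partial>stat) - (\<integral>x. noise_mean (g (-1)) x * f x \<partial>stat)
        = (\<integral>x. cond_mean r q \<psi> x * f x \<partial>stat)"
      unfolding eq[symmetric] by (intro Bochner_Integration.integral_diff[symmetric] i)
    also have "\<dots> = (\<integral>x. \<pi> x * (cond_mean r q \<psi> x * f x) \<partial>lborel)"
      using meas pi_nonneg by (subst integral_density) auto
    finally show "(\<integral>x. noise_mean (g 1) x * f x \<partial>stat) - (\<integral>x. noise_mean (g (-1)) x * f x \<partial>stat)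
      = (\<integral>x. \<pi> x * (cond_mean r q \<psi> x * f x) \<partial>lborel)" .
  qed
  obtain \<kappa> where \<kappa>: "\<And>x. K x \<le> \<kappa>" using K_bdd unfolding bdd_above_def by auto
  obtain l where l: "\<And>x y. \<bar>K x - K y\<bar> \<le> l * \<bar>x - y\<bar>"
  proof -
    obtain l where l: "\<And>v. v \<in> {\<bar>K x - K x'\<bar> / \<bar>x - x'\<bar> | x x'. x \<noteq> x'} \<Longrightarrow> v \<le> l"
      using K_lip unfolding bdd_above_def by blast
    have "\<bar>K x - K y\<bar> \<le> l * \<bar>x - y\<bar>" for x y
    proof (cases "x = y")
      case False
      then have "\<bar>K x - K y\<bar> / \<bar>x - y\<bar> \<le> l" by (intro l) blast
      then show ?thesis using False by (simp add: divide_le_eq)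
    qed simp
    then show thesis using that by blast
  qed
  obtain \<tau> where \<tau>: "\<And>x. \<bar>x\<bar> * K x \<le> \<tau>"
  proof -
    have "\<forall>\<^sub>F x in at_infinity. \<bar>x\<bar> * K x < 1" by (rule order_tendstoD(2)[OF K_tail]) simp
    then obtain B where B: "\<And>x. B \<le> \<bar>x\<bar> \<Longrightarrow> \<bar>x\<bar> * K x < 1" unfolding eventually_at_infinity by auto
    have "\<bar>x\<bar> * K x \<le> max 1 (\<bar>B\<bar> * \<kappa>)" for x
    proof (cases "B \<le> \<bar>x\<bar>")
      case True
      then show ?thesis using B by (simp add: le_max_iff_disj less_imp_le)
    next
      case False
      then have "\<bar>x\<bar> * K x \<le> \<bar>B\<bar> * \<kappa>" using \<kappa> K0 by (intro mult_mono) auto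
      then show ?thesis by simp
    qed
    then show thesis using that by blast
  qed
  have h_lim: "h \<longlonglongrightarrow> 0"
  proof -
    have "(\<lambda>n. real n powr (-\<beta>)) \<longlonglongrightarrow> 0" using \<beta> by real_asymp
    then show ?thesis using tendsto_asymp_equiv_cong[OF h] by blast
  qed
  have bias: "(\<lambda>n. (\<integral>x. \<pi> x * cond_mean r q \<psi> x * K ((x0 - x) / h n) \<partial>lborel) / h n) \<longlonglongrightarrow> \<pi> x0 * cond_mean r q \<psi> x0"
  proof (rule parzen[OF K0 K1 K_tail _ h_lim _ cont])
    show "\<forall>\<^sub>F n in sequentially. 0 < h n" using eventually_ge_at_top[of 1] by eventually_elim (rule h_pos)
    show "integrable lborel (\<lambda>x. \<pi> x * cond_mean r q \<psi> x)" using stat_int(1)[of "\<lambda>x. 1"] by simp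
  qed
  let ?E = "\<lambda>\<sigma> \<omega> n. centred_sum (g \<sigma>) \<omega> n (\<lambda>x. K ((x0 - x) / h n)) / (real n * h n)"
  have decomp: "kernel_estimator K h \<psi> X Y x0 n \<omega> = ?E 1 \<omega> n - ?E (-1) \<omega> n
      + (\<integral>x. \<pi> x * cond_mean r q \<psi> x * K ((x0 - x) / h n) \<partial>lborel) / h n" if n: "1 \<le> n" for n \<omega>
  proof -
    let ?f = "\<lambda>x. K ((x0 - x) / h n)"
    have f: "?f \<in> borel_measurable borel" by measurable
    have bdd: "bounded (range ?f)" by (rule boundedI[of _ \<kappa>]) (use \<kappa> K0 in auto)
    have "centred_sum (g 1) \<omega> n ?f - centred_sum (g (-1)) \<omega> n ?f
        = (\<Sum>i\<in>{0<..n}. g 1 (Z i \<omega>) * ?f (X i \<omega>)) - (\<Sum>i\<in>{0<..n}. g (-1) (Z i \<omega>) * ?f (X i \<omega>))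
          - real n * ((\<integral>x. noise_mean (g 1) x * ?f x \<partial>stat) - (\<integral>x. noise_mean (g (-1)) x * ?f x \<partial>stat))"
      unfolding centred_sum_def by (simp add: algebra_simps)
    also have "(\<Sum>i\<in>{0<..n}. g 1 (Z i \<omega>) * ?f (X i \<omega>)) - (\<Sum>i\<in>{0<..n}. g (-1) (Z i \<omega>) * ?f (X i \<omega>))
        = (\<Sum>i=1..n. \<psi> (Y i \<omega>) * ?f (X i \<omega>))"
      unfolding sum_subtractf[symmetric] left_diff_distrib[symmetric] g_diff Y
      by (intro sum.cong) auto
    also have "(\<integral>x. noise_mean (g 1) x * ?f x \<partial>stat) - (\<integral>x. noise_mean (g (-1)) x * ?f x \<partial>stat)
        = (\<integral>x. \<pi> x * cond_mean r q \<psi> x * ?f x \<partial>lborel)"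
      using stat_int(2)[OF f bdd] by (simp add: mult.assoc)
    finally have eq: "centred_sum (g 1) \<omega> n ?f - centred_sum (g (-1)) \<omega> n ?f
      = (\<Sum>i=1..n. \<psi> (Y i \<omega>) * ?f (X i \<omega>)) - real n * (\<integral>x. \<pi> x * cond_mean r q \<psi> x * ?f x \<partial>lborel)" .
    show ?thesis
      unfolding diff_divide_distrib[symmetric] eq kernel_estimator_def
      using n h_pos[OF n] by (simp add: field_simps)
  qed
  have conv: "AE \<omega> in M. (\<lambda>n. ?E \<sigma> \<omega> n) \<longlonglongrightarrow> 0" if "\<bar>\<sigma>\<bar> = 1" for \<sigma>
    by (rule smoothed_sum_convergence[OF g_dom[OF that] c _ K0 \<kappa> \<tau> l h_pos \<beta> h]) measurable
  have "AE \<omega> in M. (\<lambda>n. ?E 1 \<omega> n) \<longlonglongrightarrow> 0" "AE \<omega> in M. (\<lambda>n. ?E (-1) \<omega> n) \<longlonglongrightarrow> 0"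
    by (simp_all only: conv abs_one abs_minus)
  then show ?thesis
  proof eventually_elim
    case (elim \<omega>)
    from tendsto_add[OF tendsto_diff[OF elim] bias]
    have lim: "(\<lambda>n. ?E 1 \<omega> n - ?E (-1) \<omega> n + (\<integral>x. \<pi> x * cond_mean r q \<psi> x * K ((x0 - x) / h n) \<partial>lborel) / h n)
        \<longlonglongrightarrow> \<pi> x0 * cond_mean r q \<psi> x0" by simp
    show ?case
      by (rule Lim_transform_eventually[OF lim], rule eventually_mono[OF eventually_ge_at_top[of 1]])
        (rule decomp[symmetric])
  qed
qed

end

theorem theorem2p1:
  fixes M :: "'w measure"
    and X \<epsilon> Y :: "nat \<Rightarrow> 'w \<Rightarrow> real"
    and p q :: "real \<Rightarrow> real \<Rightarrow> real"
    and \<mu> \<pi> r \<psi> K V :: "real \<Rightarrow> real"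
    and h :: "nat \<Rightarrow> real"
    and lam b \<beta> x0 :: real
    and C :: "real set"
  assumes "prob_space M"
    and "regression_chain M X \<epsilon> p q \<mu>"
    and "invariant_density p \<pi>"
    and "centred_noise \<pi> q"
    and "r \<in> borel_measurable borel"
    and "\<And>i \<omega>. Y i \<omega> = r (X i \<omega>) + \<epsilon> i \<omega>"
    and "\<psi> \<in> borel_measurable borel"
    and "\<And>x. 0 \<le> K x" and "has_bochner_integral lborel K 1"
    and "\<And>n. n \<ge> 1 \<Longrightarrow> h n > 0"
    \<comment> \<open>(1)\<close>
    and "phi_irreducible borel (density_kernel p)" and "aperiodic borel (density_kernel p)"
    and "V \<in> borel_measurable borel" and "\<And>x. 1 \<le> V x"
    and "0 < lam" and "lam < 1" and "0 < b"
    and "small_set borel (density_kernel p) C"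
    and "\<And>x. (\<integral>\<^sup>+y. ennreal (p x y * V y) \<partial>lborel) \<le> ennreal (lam * V x + b * indicator C x)"
    and "(\<integral>\<^sup>+x. ennreal (V x * \<mu> x) \<partial>lborel) < \<infinity>"
    \<comment> \<open>(2)\<close>
    and "(SUP x. ennreal (V x powr (-1/2) * (1 + \<bar>x\<bar>)) * nn_cond_mean r q (\<lambda>y. \<bar>\<psi> y\<bar>) x) < \<infinity>"
    and "(SUP x. ennreal (inverse (V x)) * nn_cond_mean r q (\<lambda>y. (\<psi> y)\<^sup>2) x) < \<infinity>"
    \<comment> \<open>(3)\<close>
    and "bdd_above (range K)"
    and "((\<lambda>x. \<bar>x\<bar> * K x) \<longlongrightarrow> 0) at_infinity"
    and "bdd_above {\<bar>K x - K x'\<bar> / \<bar>x - x'\<bar> | x x'. x \<noteq> x'}"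
    \<comment> \<open>(4)\<close>
    and "0 < \<beta>" and "\<beta> < 1/4"
    and "h \<sim>[at_top] (\<lambda>n. real n powr (-\<beta>))"
    and "isCont (\<lambda>x. \<pi> x * cond_mean r q \<psi> x) x0"
  shows "AE \<omega> in M. (\<lambda>n. kernel_estimator K h \<psi> X Y x0 n \<omega>) \<longlonglongrightarrow> \<pi> x0 * cond_mean r q \<psi> x0"
proof -
  interpret regression_model p \<pi> V lam b C M X \<epsilon> q \<mu>
    using assms unfolding regression_chain_def
    by (intro regression_model.intro drift_chain.intro regression_model_axioms.intro) (auto simp: regression_chain_def)
  show ?thesis
    by (rule regression_convergence) (use assms in auto)
qed

end
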